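(* Let $d\ge 1$ be an integer and let $0<a<d$. Then the algebras $A(\mathcal{D}_a(\mathbb{B}_d))$ and $\mathrm{Mult}(\mathcal{D}_a(\mathbb{B}_d))$ are not topologically subhomogeneous.
   Context: $\mathbb{B}_d$ is the open Euclidean unit ball of $\mathbb{C}^d$. $\mathcal{D}_a(\mathbb{B}_d)$ is the reproducing kernel Hilbert space on $\mathbb{B}_d$ with kernel $\frac{1}{(1-\langle z,w\rangle)^a}$; $\mathrm{Mult}(\mathcal{D}_a(\mathbb{B}_d))$ is its multiplier algebra with the operator norm of multiplication operators, and $A(\mathcal{D}_a(\mathbb{B}_d))$ is the norm closure of the polynomials in $\mathrm{Mult}(\mathcal{D}_a(\mathbb{B}_d))$. A unital operator algebra $\mathcal{A}$ is topologically subhomogeneous if there exist constants $c$ and $C$ and an integer $N$ such that for all $f\in\mathcal{A}$, $\|f\|\le c\sup\{\|\pi(f)\|\}$, where the supremum is taken over all $k\le N$ and all unital homomorphisms $\pi:\mathcal{A}\to M_k$ with $\|\pi\|\le C$; here $M_k$ is the algebra of $k\times k$ complex matrices with the operator norm. *)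

theory Defs
  imports
    "HOL-Analysis.Analysis"
    "HOL-Algebra.Module"
    "Jordan_Normal_Form.Matrix"
begin

no_notation vec_index (infixl "$" 100)

section \<open>Topological subhomogeneity\<close>

text \<open>A complex algebra together with its norm.\<close>

record 'b normed_alg = "(complex, 'b) module" +
  alg_norm :: "'b \<Rightarrow> real"

definition vec_l2_norm :: "complex Matrix.vec \<Rightarrow> real" where
  "vec_l2_norm v = L2_set (\<lambda>i. cmod (vec_index v i)) {..<dim_vec v}"

definition mat_op_norm :: "complex mat \<Rightarrow> real" where
  "mat_op_norm A =
     (SUP v \<in> {v \<in> carrier_vec (dim_col A). vec_l2_norm v \<le> 1}. vec_l2_norm (A *\<^sub>v v))"

text \<open>Unital homomorphisms into \<open>M\<^sub>k\<close>; preservation of the unit is part of \<^const>\<open>ring_hom\<close>.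
  Every matrix has finite norm, but a homomorphism need not be bounded, so that its norm
  is taken in \<^typ>\<open>ennreal\<close>.\<close>

definition matrix_homs :: "('b, 'c) normed_alg_scheme \<Rightarrow> nat \<Rightarrow> ('b \<Rightarrow> complex mat) set" where
  "matrix_homs \<A> k =
     {\<pi> \<in> ring_hom \<A> (ring_mat TYPE(complex) k ()).
        \<forall>c. \<forall>f \<in> carrier \<A>. \<pi> (c \<odot>\<^bsub>\<A>\<^esub> f) = c \<cdot>\<^sub>m \<pi> f}"

definition hom_norm :: "('b, 'c) normed_alg_scheme \<Rightarrow> ('b \<Rightarrow> complex mat) \<Rightarrow> ennreal" where
  "hom_norm \<A> \<pi> =
     (SUP f \<in> {f \<in> carrier \<A>. alg_norm \<A> f \<le> 1}. ennreal (mat_op_norm (\<pi> f)))"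

definition topologically_subhomogeneous :: "('b, 'c) normed_alg_scheme \<Rightarrow> bool" where
  "topologically_subhomogeneous \<A> \<longleftrightarrow>
     (\<exists>(c::real) (C::real) (N::nat). \<forall>f \<in> carrier \<A>.
        ennreal (alg_norm \<A> f) \<le> ennreal c *
          (SUP (k, \<pi>) \<in> {(k, \<pi>). 1 \<le> k \<and> k \<le> N \<and> \<pi> \<in> matrix_homs \<A> k \<and>
                               hom_norm \<A> \<pi> \<le> ennreal C}.
             ennreal (mat_op_norm (\<pi> f))))"

section \<open>Reproducing kernel Hilbert spaces and multipliers\<close>

text \<open>Functions on a set \<open>X\<close> are encoded as total functions vanishing outside \<open>X\<close>.\<close>

type_synonym 'p ip = "('p \<Rightarrow> complex) \<Rightarrow> ('p \<Rightarrow> complex) \<Rightarrow> complex"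

definition ip_norm :: "'p ip \<Rightarrow> ('p \<Rightarrow> complex) \<Rightarrow> real" where
  "ip_norm ip f = sqrt (Re (ip f f))"

text \<open>The set \<open>H\<close> of functions with inner product \<open>ip\<close> (linear in the first argument) is the
  reproducing kernel Hilbert space on \<open>X\<close> with kernel \<open>K\<close>. By the Moore--Aronszajn theorem
  \<open>H\<close>, and \<open>ip\<close> on \<open>H\<close>, are uniquely determined by \<open>X\<close> and \<open>K\<close>.\<close>

locale rkhs =
  fixes X :: "'p set" and K :: "'p \<Rightarrow> 'p \<Rightarrow> complex"
    and H :: "('p \<Rightarrow> complex) set" and ip :: "'p ip"
  assumes zero_outside: "f \<in> H \<Longrightarrow> x \<notin> X \<Longrightarrow> f x = 0"
    and zero_mem: "(\<lambda>x. 0) \<in> H"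
    and add_mem: "f \<in> H \<Longrightarrow> g \<in> H \<Longrightarrow> (\<lambda>x. f x + g x) \<in> H"
    and scale_mem: "f \<in> H \<Longrightarrow> (\<lambda>x. c * f x) \<in> H"
    and ip_add: "f \<in> H \<Longrightarrow> g \<in> H \<Longrightarrow> h \<in> H \<Longrightarrow> ip (\<lambda>x. f x + g x) h = ip f h + ip g h"
    and ip_scale: "f \<in> H \<Longrightarrow> h \<in> H \<Longrightarrow> ip (\<lambda>x. c * f x) h = c * ip f h"
    and ip_cnj: "f \<in> H \<Longrightarrow> g \<in> H \<Longrightarrow> ip g f = cnj (ip f g)"
    and ip_nonneg: "f \<in> H \<Longrightarrow> 0 \<le> Re (ip f f)"
    and ip_definite: "f \<in> H \<Longrightarrow> ip f f = 0 \<Longrightarrow> f = (\<lambda>x. 0)"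
    and complete:
      "(\<And>n. s n \<in> H) \<Longrightarrow>
       (\<And>e. e > 0 \<Longrightarrow> \<exists>N. \<forall>m\<ge>N. \<forall>n\<ge>N. ip_norm ip (\<lambda>x. s m x - s n x) < e) \<Longrightarrow>
       \<exists>f\<in>H. (\<lambda>n::nat. ip_norm ip (\<lambda>x. s n x - f x)) \<longlonglongrightarrow> 0"
    and kernel_mem: "w \<in> X \<Longrightarrow> (\<lambda>z. if z \<in> X then K z w else 0) \<in> H"
    and reproducing: "f \<in> H \<Longrightarrow> w \<in> X \<Longrightarrow> ip f (\<lambda>z. if z \<in> X then K z w else 0) = f w"

text \<open>By the closed graph theorem, boundedness of \<open>f \<mapsto> \<phi> f\<close> follows from \<open>\<phi> H \<subseteq> H\<close> in a
  reproducing kernel Hilbert space; it is included so that the supremum in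
  \<open>mult_norm\<close> is visibly finite.\<close>

definition multipliers :: "'p set \<Rightarrow> ('p \<Rightarrow> complex) set \<Rightarrow> 'p ip \<Rightarrow> ('p \<Rightarrow> complex) set" where
  "multipliers X H ip =
     {\<phi>. (\<forall>x. x \<notin> X \<longrightarrow> \<phi> x = 0) \<and>
         (\<forall>f \<in> H. (\<lambda>x. \<phi> x * f x) \<in> H) \<and>
         (\<exists>B. \<forall>f \<in> H. ip_norm ip (\<lambda>x. \<phi> x * f x) \<le> B * ip_norm ip f)}"

definition mult_norm :: "('p \<Rightarrow> complex) set \<Rightarrow> 'p ip \<Rightarrow> ('p \<Rightarrow> complex) \<Rightarrow> real" where
  "mult_norm H ip \<phi> = (SUP f \<in> {f \<in> H. ip_norm ip f \<le> 1}. ip_norm ip (\<lambda>x. \<phi> x * f x))"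

definition Mult_alg :: "'p set \<Rightarrow> ('p \<Rightarrow> complex) set \<Rightarrow> 'p ip \<Rightarrow> ('p \<Rightarrow> complex) normed_alg" where
  "Mult_alg X H ip =
     \<lparr>carrier = multipliers X H ip,
      mult = (\<lambda>\<phi> \<psi> x. \<phi> x * \<psi> x),
      one = (\<lambda>x. if x \<in> X then 1 else 0),
      zero = (\<lambda>x. 0),
      add = (\<lambda>\<phi> \<psi> x. \<phi> x + \<psi> x),
      smult = (\<lambda>c \<phi> x. c * \<phi> x),
      alg_norm = mult_norm H ip\<rparr>"

section \<open>The spaces \<open>\<D>\<^sub>a\<close> on the unit ball\<close>

definition hermitian :: "complex ^ 'd \<Rightarrow> complex ^ 'd \<Rightarrow> complex" where
  "hermitian z w = (\<Sum>i\<in>UNIV. z $ i * cnj (w $ i))"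

text \<open>On the unit ball \<open>Re (1 - \<langle>z, w\<rangle>) > 0\<close>, so \<open>powr\<close> is the principal branch there.\<close>

definition D_kernel :: "real \<Rightarrow> complex ^ 'd \<Rightarrow> complex ^ 'd \<Rightarrow> complex" where
  "D_kernel a z w = 1 / (1 - hermitian z w) powr (complex_of_real a)"

text \<open>Polynomials in the \<open>d\<close> coordinates, restricted to \<open>X\<close>; a multi-index is a function
  \<open>\<alpha> :: 'd \<Rightarrow> nat\<close>.\<close>

definition polynomials_on :: "(complex ^ 'd) set \<Rightarrow> (complex ^ 'd \<Rightarrow> complex) set" where
  "polynomials_on X =
     {p. \<exists>(S :: ('d \<Rightarrow> nat) set) (coef :: ('d \<Rightarrow> nat) \<Rightarrow> complex). finite S \<and>
         p = (\<lambda>z. if z \<in> X then (\<Sum>\<alpha>\<in>S. coef \<alpha> * (\<Prod>i\<in>UNIV. (z $ i) ^ \<alpha> i)) else 0)}"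

text \<open>The norm closure of the polynomials in the multiplier algebra.\<close>

definition A_alg ::
  "(complex ^ 'd) set \<Rightarrow> (complex ^ 'd \<Rightarrow> complex) set \<Rightarrow> (complex ^ 'd) ip \<Rightarrow>
   (complex ^ 'd \<Rightarrow> complex) normed_alg" where
  "A_alg X H ip = (Mult_alg X H ip)
     \<lparr>carrier := {\<phi> \<in> multipliers X H ip.
        \<forall>e>0. \<exists>p \<in> polynomials_on X \<inter> multipliers X H ip. mult_norm H ip (\<lambda>x. \<phi> x - p x) < e}\<rparr>"

end

theory Submission
  imports Defs "Jordan_Normal_Form.Schur_Decomposition"
begin

text \<open>
  The idea is that representations of bounded size and bounded norm are blind to cancellation in sums of
  Cauchy kernels, whereas the multiplier norm is not. The sums are
  \<open>f = \<Sum>\<^sub>i e\<^sub>i (t / (1 - (1 - t) \<langle>z, \<zeta>\<^sub>i\<rangle>))\<^sup>2\<^sup>d\<close> with \<open>t = 1 / n\<close>, signs \<open>e\<^sub>i\<close>, and about \<open>n\<^sup>d\<close> unit vectors \<open>\<zeta>\<^sub>i\<close>, spread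
  over a piece of the sphere at the scale on which these kernels decay.

  From above, let \<open>\<pi>\<close> be a unital homomorphism into the \<open>k \<times> k\<close> matrices with norm at most \<open>C\<close>. The eigenvalues \<open>u\<close> of
  the matrix of \<open>\<langle>z, \<zeta>\<rangle>\<close> are the numbers \<open>\<langle>\<mu>, \<zeta>\<rangle>\<close> with \<open>\<mu>\<close> in the joint spectrum of the coordinates, a set of at most
  \<open>k\<^sup>d\<close> points of the closed ball. Expand the Cauchy kernel \<open>1 / (1 - r \<langle>z, \<zeta>\<rangle>)\<close> in the Takenaka--Malmquist system with zeros
  at these eigenvalues. On \<open>\<pi>\<close> the expansion is finite by the Cayley--Hamilton theorem, its coefficients are at most
  \<open>1 / |1 - r u|\<close>, and Moebius functions of \<open>\<langle>z, \<zeta>\<rangle>\<close> have multiplier norms bounded in terms of \<open>a\<close> only. Therefore the image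
  of the kernel is at most a constant times \<open>\<Sum>\<^sub>\<mu> 1 / |1 - r \<langle>\<mu>, \<zeta>\<rangle>|\<close> (\<open>cauchy_bound\<close>), and the image of \<open>f\<close> at most a constant
  times the supremum over the closed ball of \<open>\<Sum>\<^sub>i (t / |1 - (1 - t) \<langle>\<mu>, \<zeta>\<^sub>i\<rangle>|)\<^sup>2\<^sup>d\<close> (\<open>test_function_bound\<close>). For suitable \<open>\<zeta>\<^sub>i\<close>
  this supremum stays bounded as \<open>n\<close> grows (\<open>grid_family\<close>).

  From below, \<open>\<parallel>f\<parallel> \<ge> \<parallel>f \<cdot> 1\<parallel>\<close>, and for suitable signs the squared norm of \<open>f\<close> in the Hilbert space is at least the sum of the
  squared norms of its terms. Each of these is at least a constant times \<open>n\<^sup>-\<^sup>a\<close>, by evaluation near \<open>\<zeta>\<^sub>i\<close>. The total is of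
  order \<open>n\<^sup>d\<^sup>-\<^sup>a\<close>, which is unbounded for \<open>a < d\<close> (\<open>not_subhomogeneous\<close>).

  The multiplier norms come from positivity of kernels: \<open>\<parallel>\<phi>\<parallel>\<^sup>2 \<le> W\<close> as soon as \<open>(W - \<phi> \<phi>\<^sup>*) K\<close> is positive
  (\<open>multiplier_if_pos_kernel\<close>), and for Moebius functions this is a statement on Taylor coefficients in one variable
  (\<open>pos_kernel_moebius\<close>). The same estimate shows that the powers of a coordinate have norms \<open>O(\<surd>n)\<close>. Hence the geometric
  series of the Cauchy kernels converge in norm, and the smaller algebra contains the functions \<open>f\<close>.
\<close>

section \<open>Positive kernels\<close>

definition gram :: "('p \<Rightarrow> complex) list \<Rightarrow> 'p \<Rightarrow> 'p \<Rightarrow> complex" where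
  "gram fs x y = (\<Sum>f\<leftarrow>fs. f x * cnj (f y))"

text \<open>The approximating sums of squares may depend on the finite set. This makes the class closed under
  products and under pointwise limits, the two operations that build all kernels below.\<close>

definition pos_kernel :: "'p set \<Rightarrow> ('p \<Rightarrow> 'p \<Rightarrow> complex) \<Rightarrow> bool" where
  "pos_kernel X k \<longleftrightarrow> (\<forall>F. finite F \<longrightarrow> F \<subseteq> X \<longrightarrow>
     (\<exists>L. \<forall>x\<in>F. \<forall>y\<in>F. (\<lambda>n. gram (L n) x y) \<longlonglongrightarrow> k x y))"

lemma gram_append: "gram (fs @ gs) x y = gram fs x y + gram gs x y"
  by (simp add: gram_def)

lemma gram_Cons: "gram (f # fs) x y = f x * cnj (f y) + gram fs x y"
  by (simp add: gram_def)

lemma gram_times: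
  "gram (concat (map (\<lambda>f. map (\<lambda>g x. f x * g x) gs) fs)) x y = gram fs x y * gram gs x y"
proof (induction fs)
  case Nil
  then show ?case by (simp add: gram_def)
next
  case (Cons f fs)
  have "gram (map (\<lambda>g x. f x * g x) gs) x y = f x * cnj (f y) * gram gs x y"
    by (induction gs) (auto simp: gram_def algebra_simps)
  then show ?case
    using Cons by (simp add: gram_append) (simp add: gram_def algebra_simps)
qed

lemma pos_kernelI_gram: "(\<And>x y. x \<in> X \<Longrightarrow> y \<in> X \<Longrightarrow> k x y = gram fs x y) \<Longrightarrow> pos_kernel X k"
  unfolding pos_kernel_def
  by (intro allI impI exI[of _ "\<lambda>n. fs"]) (auto simp: subset_iff)

lemma pos_kernel_rank_one: "pos_kernel X (\<lambda>x y. f x * cnj (f y))"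
  by (rule pos_kernelI_gram[of _ _ "[f]"]) (simp add: gram_def)

lemma pos_kernel_const: "0 \<le> c \<Longrightarrow> pos_kernel X (\<lambda>x y. complex_of_real c)"
  by (rule pos_kernelI_gram[of _ _ "[\<lambda>x. complex_of_real (sqrt c)]"])
     (simp add: gram_def flip: of_real_mult)

lemma pos_kernel_cong:
  "pos_kernel X k \<Longrightarrow> (\<And>x y. x \<in> X \<Longrightarrow> y \<in> X \<Longrightarrow> k x y = l x y) \<Longrightarrow> pos_kernel X l"
  unfolding pos_kernel_def by (metis subset_iff)

lemma pos_kernel_add:
  assumes "pos_kernel X k" "pos_kernel X l"
  shows "pos_kernel X (\<lambda>x y. k x y + l x y)"
  unfolding pos_kernel_def
proof (intro allI impI)
  fix F assume F: "finite F" "F \<subseteq> X"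
  obtain L M where "\<forall>x\<in>F. \<forall>y\<in>F. (\<lambda>n. gram (L n) x y) \<longlonglongrightarrow> k x y"
    "\<forall>x\<in>F. \<forall>y\<in>F. (\<lambda>n. gram (M n) x y) \<longlonglongrightarrow> l x y"
    using assms F unfolding pos_kernel_def by metis
  then show "\<exists>L. \<forall>x\<in>F. \<forall>y\<in>F. (\<lambda>n. gram (L n) x y) \<longlonglongrightarrow> k x y + l x y"
    by (intro exI[of _ "\<lambda>n. L n @ M n"]) (auto simp: gram_append intro!: tendsto_add)
qed

text \<open>This is the Schur product theorem; for kernels that are limits of finite sums of squares
  it only needs that products of such sums are again sums of squares.\<close>

lemma pos_kernel_mult:
  assumes "pos_kernel X k" "pos_kernel X l"
  shows "pos_kernel X (\<lambda>x y. k x y * l x y)"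
  unfolding pos_kernel_def
proof (intro allI impI)
  fix F assume F: "finite F" "F \<subseteq> X"
  obtain L M where "\<forall>x\<in>F. \<forall>y\<in>F. (\<lambda>n. gram (L n) x y) \<longlonglongrightarrow> k x y"
    "\<forall>x\<in>F. \<forall>y\<in>F. (\<lambda>n. gram (M n) x y) \<longlonglongrightarrow> l x y"
    using assms F unfolding pos_kernel_def by metis
  then show "\<exists>L. \<forall>x\<in>F. \<forall>y\<in>F. (\<lambda>n. gram (L n) x y) \<longlonglongrightarrow> k x y * l x y"
    by (intro exI[of _ "\<lambda>n. concat (map (\<lambda>f. map (\<lambda>g x. f x * g x) (M n)) (L n))"])
       (auto simp: gram_times intro!: tendsto_mult)
qed

lemma pos_kernel_scale: "pos_kernel X k \<Longrightarrow> 0 \<le> c \<Longrightarrow> pos_kernel X (\<lambda>x y. complex_of_real c * k x y)"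
  by (rule pos_kernel_mult[OF pos_kernel_const])

lemma pos_kernel_sum:
  "(\<And>i. i \<in> I \<Longrightarrow> pos_kernel X (k i)) \<Longrightarrow> pos_kernel X (\<lambda>x y. \<Sum>i\<in>I. k i x y)"
proof (induction I rule: infinite_finite_induct)
  case (insert i I)
  then show ?case using pos_kernel_add[of X "k i" "\<lambda>x y. \<Sum>i\<in>I. k i x y"] by simp
qed (use pos_kernel_const[of 0 X] in simp_all)

lemma pos_kernel_power: "pos_kernel X k \<Longrightarrow> pos_kernel X (\<lambda>x y. k x y ^ n)"
proof (induction n)
  case 0
  then show ?case using pos_kernel_const[of 1 X] by simp
qed (simp add: pos_kernel_mult)

lemma pos_kernel_limit:
  assumes pos: "\<And>n. pos_kernel X (k n)"
    and lim: "\<And>x y. x \<in> X \<Longrightarrow> y \<in> X \<Longrightarrow> (\<lambda>n. k n x y) \<longlonglongrightarrow> l x y"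
  shows "pos_kernel X l"
  unfolding pos_kernel_def
proof (intro allI impI)
  fix F assume F: "finite F" "F \<subseteq> X"
  have "\<exists>fs. \<forall>x\<in>F. \<forall>y\<in>F. cmod (gram fs x y - l x y) < 1 / Suc n" for n
  proof -
    have "\<forall>\<^sub>F m in sequentially. \<forall>x\<in>F. \<forall>y\<in>F. cmod (k m x y - l x y) < 1 / Suc n / 2"
      using F lim by (intro eventually_ball_finite ballI)
        (auto simp: dist_norm[symmetric] subset_iff intro!: tendstoD)
    then obtain m where m: "\<forall>x\<in>F. \<forall>y\<in>F. cmod (k m x y - l x y) < 1 / Suc n / 2"
      by (auto simp: eventually_sequentially)
    obtain L where L: "\<forall>x\<in>F. \<forall>y\<in>F. (\<lambda>n. gram (L n) x y) \<longlonglongrightarrow> k m x y"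
      using pos[of m] F unfolding pos_kernel_def by metis
    have "\<forall>\<^sub>F j in sequentially. \<forall>x\<in>F. \<forall>y\<in>F. cmod (gram (L j) x y - k m x y) < 1 / Suc n / 2"
      using F L by (intro eventually_ball_finite ballI)
        (auto simp: dist_norm[symmetric] subset_iff intro!: tendstoD)
    then obtain j where j: "\<forall>x\<in>F. \<forall>y\<in>F. cmod (gram (L j) x y - k m x y) < 1 / Suc n / 2"
      by (auto simp: eventually_sequentially)
    have "cmod (gram (L j) x y - l x y) < 1 / Suc n" if "x \<in> F" "y \<in> F" for x y
    proof -
      have "cmod (gram (L j) x y - l x y) \<le>
          cmod (gram (L j) x y - k m x y) + cmod (k m x y - l x y)"
        using norm_triangle_ineq[of "gram (L j) x y - k m x y" "k m x y - l x y"] by simp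
      also have "\<dots> < 1 / Suc n / 2 + 1 / Suc n / 2"
        using j m that by (intro add_strict_mono) blast+
      finally show ?thesis by (simp only: field_sum_of_halves)
    qed
    then show ?thesis by blast
  qed
  then obtain L where L: "\<And>n. \<forall>x\<in>F. \<forall>y\<in>F. cmod (gram (L n) x y - l x y) < 1 / Suc n" by metis
  have "(\<lambda>n. gram (L n) x y) \<longlonglongrightarrow> l x y" if "x \<in> F" "y \<in> F" for x y
  proof (rule LIM_zero_cancel, rule Lim_null_comparison)
    show "\<forall>\<^sub>F n in sequentially. cmod (gram (L n) x y - l x y) \<le> 1 / Suc n"
      using L that by (auto intro!: always_eventually less_imp_le)
    show "(\<lambda>n. 1 / real (Suc n)) \<longlonglongrightarrow> 0"
      using LIMSEQ_inverse_real_of_nat by (simp add: inverse_eq_divide)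
  qed
  then show "\<exists>L. \<forall>x\<in>F. \<forall>y\<in>F. (\<lambda>n. gram (L n) x y) \<longlonglongrightarrow> l x y" by blast
qed

lemma pos_kernel_sums:
  assumes "\<And>n. pos_kernel X (k n)"
    and "\<And>x y. x \<in> X \<Longrightarrow> y \<in> X \<Longrightarrow> (\<lambda>n. k n x y) sums l x y"
  shows "pos_kernel X l"
proof (rule pos_kernel_limit[of X "\<lambda>n x y. \<Sum>i<n. k i x y"])
  show "pos_kernel X (\<lambda>x y. \<Sum>i<n. k i x y)" for n
    using assms(1) by (rule pos_kernel_sum)
qed (use assms(2) in \<open>simp add: sums_def\<close>)

lemma pos_kernel_exp:
  assumes "pos_kernel X k"
  shows "pos_kernel X (\<lambda>x y. exp (k x y))"
proof (rule pos_kernel_sums)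
  fix n show "pos_kernel X (\<lambda>x y. complex_of_real (1 / fact n) * k x y ^ n)"
    by (intro pos_kernel_scale pos_kernel_power assms) simp
next
  fix x y
  show "(\<lambda>n. complex_of_real (1 / fact n) * k x y ^ n) sums exp (k x y)"
    using exp_converges[of "k x y"] by (simp add: scaleR_conv_of_real divide_inverse)
qed

text \<open>Positivity in the usual sense: the quadratic form of a sum of squares is a sum of \<open>|\<Sum> c f|\<^sup>2\<close>.\<close>

lemma pos_kernel_quadratic_form:
  assumes "pos_kernel X k" "finite F" "F \<subseteq> X"
  shows "0 \<le> Re (\<Sum>x\<in>F. \<Sum>y\<in>F. c x * cnj (c y) * k x y)"
proof -
  have gram: "0 \<le> Re (\<Sum>x\<in>F. \<Sum>y\<in>F. c x * cnj (c y) * gram fs x y)" for fs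
  proof (induction fs)
    case (Cons f fs)
    have split: "c x * cnj (c y) * gram (f # fs) x y =
        (c x * f x) * cnj (c y * f y) + c x * cnj (c y) * gram fs x y" for x y
      by (simp add: gram_Cons ring_distribs)
    have "(\<Sum>x\<in>F. \<Sum>y\<in>F. (c x * f x) * cnj (c y * f y)) =
        (\<Sum>x\<in>F. c x * f x) * cnj (\<Sum>x\<in>F. c x * f x)"
      by (simp only: sum_product cnj_sum)
    also have "\<dots> = complex_of_real ((cmod (\<Sum>x\<in>F. c x * f x))\<^sup>2)"
      by (simp only: complex_norm_square[symmetric] of_real_power)
    finally show ?case
      using Cons by (simp only: split sum.distrib plus_complex.sel Re_complex_of_real) (rule add_nonneg_nonneg[OF zero_le_power2])
  qed (simp add: gram_def)
  obtain L where L: "\<forall>x\<in>F. \<forall>y\<in>F. (\<lambda>n. gram (L n) x y) \<longlonglongrightarrow> k x y"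
    using assms unfolding pos_kernel_def by metis
  have "(\<lambda>n. Re (\<Sum>x\<in>F. \<Sum>y\<in>F. c x * cnj (c y) * gram (L n) x y)) \<longlonglongrightarrow>
      Re (\<Sum>x\<in>F. \<Sum>y\<in>F. c x * cnj (c y) * k x y)"
    using L by (intro tendsto_Re tendsto_sum tendsto_mult tendsto_const) auto
  then show ?thesis by (rule LIMSEQ_le_const) (auto intro!: exI[of _ 0] gram simp del: Re_sum)
qed

section \<open>Multipliers of a reproducing kernel Hilbert space\<close>

context rkhs
begin

abbreviation ker :: "'p \<Rightarrow> 'p \<Rightarrow> complex" where
  "ker w \<equiv> (\<lambda>z. if z \<in> X then K z w else 0)"

abbreviation nrm :: "('p \<Rightarrow> complex) \<Rightarrow> real" where
  "nrm \<equiv> ip_norm ip"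

lemma diff_mem: "f \<in> H \<Longrightarrow> g \<in> H \<Longrightarrow> (\<lambda>x. f x - g x) \<in> H"
  using add_mem[of f "\<lambda>x. (-1) * g x"] scale_mem[of g "-1"] by simp

lemma sum_mem: "(\<And>i. i \<in> I \<Longrightarrow> f i \<in> H) \<Longrightarrow> (\<lambda>x. \<Sum>i\<in>I. f i x) \<in> H"
  by (induction I rule: infinite_finite_induct) (auto intro: zero_mem add_mem)

lemma ip_add_right: "f \<in> H \<Longrightarrow> g \<in> H \<Longrightarrow> h \<in> H \<Longrightarrow> ip h (\<lambda>x. f x + g x) = ip h f + ip h g"
  using ip_cnj[of "\<lambda>x. f x + g x" h] ip_cnj[of f h] ip_cnj[of g h] by (simp add: add_mem ip_add)

lemma ip_scale_right: "f \<in> H \<Longrightarrow> h \<in> H \<Longrightarrow> ip h (\<lambda>x. c * f x) = cnj c * ip h f"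
  using ip_cnj[of "\<lambda>x. c * f x" h] ip_cnj[of f h] by (simp add: scale_mem ip_scale)

lemma ip_self: "f \<in> H \<Longrightarrow> ip f f = complex_of_real ((nrm f)\<^sup>2)"
  using ip_cnj[of f f] ip_nonneg[of f] by (auto simp: ip_norm_def complex_eq_iff)

lemma nrm_nonneg: "f \<in> H \<Longrightarrow> 0 \<le> nrm f"
  by (simp add: ip_norm_def ip_nonneg)

lemma nrm_scale: "f \<in> H \<Longrightarrow> nrm (\<lambda>x. c * f x) = cmod c * nrm f"
proof -
  assume f: "f \<in> H"
  have "ip (\<lambda>x. c * f x) (\<lambda>x. c * f x) = (c * cnj c) * ip f f"
    using f by (simp add: ip_scale ip_scale_right scale_mem)
  also have "\<dots> = complex_of_real ((cmod c * nrm f)\<^sup>2)"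
    using f by (simp add: ip_self power_mult_distrib flip: complex_norm_square)
  finally show ?thesis
    unfolding ip_norm_def[of ip "\<lambda>x. c * f x"] using nrm_nonneg[OF f] by simp
qed

lemma nrm_add_square:
  "f \<in> H \<Longrightarrow> g \<in> H \<Longrightarrow> (nrm (\<lambda>x. f x + g x))\<^sup>2 = (nrm f)\<^sup>2 + (nrm g)\<^sup>2 + 2 * Re (ip f g)"
proof -
  assume fg: "f \<in> H" "g \<in> H"
  have "complex_of_real ((nrm (\<lambda>x. f x + g x))\<^sup>2) =
      ip (\<lambda>x. f x + g x) (\<lambda>x. f x + g x)"
    using fg by (simp only: ip_self[OF add_mem])
  also have "\<dots> = ip f f + ip g g + (ip f g + cnj (ip f g))"
    using fg ip_cnj[of f g] by (simp add: add_mem ip_add ip_add_right)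
  finally have "complex_of_real ((nrm (\<lambda>x. f x + g x))\<^sup>2) =
      complex_of_real ((nrm f)\<^sup>2 + (nrm g)\<^sup>2 + 2 * Re (ip f g))"
    using fg by (simp add: ip_self complex_add_cnj)
  then show ?thesis by (simp only: of_real_eq_iff)
qed

lemma nrm_diff_square:
  "f \<in> H \<Longrightarrow> g \<in> H \<Longrightarrow> (nrm (\<lambda>x. f x - g x))\<^sup>2 = (nrm f)\<^sup>2 + (nrm g)\<^sup>2 - 2 * Re (ip f g)"
  using nrm_add_square[of f "\<lambda>x. (-1) * g x"] nrm_scale[of g "-1"] ip_scale_right[of g f "-1"]
    scale_mem[of g "-1"] by simp

lemma cauchy_schwarz: "f \<in> H \<Longrightarrow> g \<in> H \<Longrightarrow> cmod (ip f g) \<le> nrm f * nrm g"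
proof -
  assume fg: "f \<in> H" "g \<in> H"
  show ?thesis
  proof (cases "nrm g = 0")
    case True
    then have "g = (\<lambda>x. 0)" using ip_definite[of g] fg by (simp add: ip_self)
    then have "ip f g = 0" using ip_scale_right[of g f 0] fg by simp
    then show ?thesis using True by simp
  next
    case False
    define c where "c = - ip f g / complex_of_real ((nrm g)\<^sup>2)"
    have "0 \<le> (nrm (\<lambda>x. f x + c * g x))\<^sup>2" by simp
    also have "\<dots> = (nrm f)\<^sup>2 + (cmod c * nrm g)\<^sup>2 + 2 * Re (cnj c * ip f g)"
      using fg by (simp add: nrm_add_square scale_mem nrm_scale ip_scale_right)
    also have "cmod c * nrm g = cmod (ip f g) / nrm g"
      using False nrm_nonneg[OF fg(2)] by (simp add: c_def norm_divide norm_mult power2_eq_square)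
    also have "cnj c * ip f g = - complex_of_real ((cmod (ip f g))\<^sup>2 / (nrm g)\<^sup>2)"
      by (simp add: c_def mult.commute flip: complex_norm_square)
    finally have "(cmod (ip f g) / nrm g)\<^sup>2 \<le> (nrm f)\<^sup>2"
      by (simp add: power_divide)
    then have "cmod (ip f g) / nrm g \<le> nrm f"
      by (rule power2_le_imp_le) (use nrm_nonneg[OF fg(1)] in auto)
    then show ?thesis
      using False nrm_nonneg[OF fg(2)] by (simp add: divide_le_eq)
  qed
qed

lemma nrm_triangle: "f \<in> H \<Longrightarrow> g \<in> H \<Longrightarrow> nrm (\<lambda>x. f x + g x) \<le> nrm f + nrm g"
proof -
  assume fg: "f \<in> H" "g \<in> H"
  have "Re (ip f g) \<le> nrm f * nrm g"
    using cauchy_schwarz[OF fg] complex_Re_le_cmod[of "ip f g"] by linarith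
  then have "(nrm (\<lambda>x. f x + g x))\<^sup>2 \<le> (nrm f + nrm g)\<^sup>2"
    using nrm_add_square[OF fg] by (simp add: power2_sum)
  then show ?thesis
    by (rule power2_le_imp_le) (use nrm_nonneg fg in auto)
qed

lemma kernel_self: "w \<in> X \<Longrightarrow> (nrm (ker w))\<^sup>2 = Re (K w w)"
  using reproducing[OF kernel_mem, of w w] arg_cong[OF ip_self[OF kernel_mem, of w], of Re] by simp

lemma evaluation_bound: "f \<in> H \<Longrightarrow> w \<in> X \<Longrightarrow> cmod (f w) \<le> nrm f * nrm (ker w)"
  using cauchy_schwarz[OF _ kernel_mem, of f w] by (simp add: reproducing)

text \<open>Adding one vector at a time, the sign is chosen so that the mixed term is nonnegative. This bounds a
  signed sum from below without knowing anything about the angles between its terms.\<close>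

lemma exists_signs:
  assumes "finite I" "\<And>i. i \<in> I \<Longrightarrow> f i \<in> H"
  shows "\<exists>e. (\<forall>i. e i = 1 \<or> e i = (-1::complex)) \<and>
    (\<Sum>i\<in>I. (nrm (f i))\<^sup>2) \<le> (nrm (\<lambda>x. \<Sum>i\<in>I. e i * f i x))\<^sup>2"
  using assms
proof (induction I rule: finite_induct)
  case (insert i I)
  then obtain e where e: "\<forall>i. e i = 1 \<or> e i = (-1::complex)"
    "(\<Sum>i\<in>I. (nrm (f i))\<^sup>2) \<le> (nrm (\<lambda>x. \<Sum>i\<in>I. e i * f i x))\<^sup>2" by auto
  define g where "g = (\<lambda>x. \<Sum>i\<in>I. e i * f i x)"
  have g: "g \<in> H" unfolding g_def using insert.prems by (intro sum_mem scale_mem) auto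
  have fi: "f i \<in> H" using insert.prems by auto
  define s where "s = (if Re (ip (f i) g) \<ge> 0 then 1 else (-1::complex))"
  define e' where "e' = e(i := s)"
  have "(\<Sum>j\<in>I. e' j * f j x) = g x" for x
    using insert.hyps unfolding g_def e'_def by (intro sum.cong) auto
  then have "(\<lambda>x. \<Sum>j\<in>insert i I. e' j * f j x) = (\<lambda>x. s * f i x + g x)"
    using insert.hyps by (simp add: e'_def)
  then have "(nrm (\<lambda>x. \<Sum>j\<in>insert i I. e' j * f j x))\<^sup>2 =
      (nrm (f i))\<^sup>2 + (nrm g)\<^sup>2 + 2 * Re (s * ip (f i) g)"
    using g fi by (simp add: nrm_add_square scale_mem nrm_scale ip_scale) (simp add: s_def)
  also have "\<dots> \<ge> (nrm (f i))\<^sup>2 + (\<Sum>i\<in>I. (nrm (f i))\<^sup>2)"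
    using e(2) by (auto simp: s_def g_def)
  finally have "(\<Sum>i\<in>insert i I. (nrm (f i))\<^sup>2) \<le> (nrm (\<lambda>x. \<Sum>j\<in>insert i I. e' j * f j x))\<^sup>2"
    using insert.hyps by simp
  moreover have "\<forall>j. e' j = 1 \<or> e' j = -1"
    using e(1) by (simp add: e'_def s_def)
  ultimately show ?case by blast
qed auto

lemma ip_zero_left: "h \<in> H \<Longrightarrow> ip (\<lambda>x. 0) h = 0"
  using ip_scale[of h h 0] by simp

lemma ip_sum_left:
  "(\<And>i. i \<in> I \<Longrightarrow> f i \<in> H) \<Longrightarrow> h \<in> H \<Longrightarrow> ip (\<lambda>x. \<Sum>i\<in>I. f i x) h = (\<Sum>i\<in>I. ip (f i) h)"
  by (induction I rule: infinite_finite_induct) (auto simp: ip_zero_left ip_add sum_mem)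

lemma kernel_sum_norm:
  assumes "finite F" "F \<subseteq> X"
  shows "(nrm (\<lambda>z. \<Sum>y\<in>F. d y * ker y z))\<^sup>2 = Re (\<Sum>y\<in>F. \<Sum>x\<in>F. d y * cnj (d x) * K x y)"
proof -
  define g where "g = (\<lambda>z. \<Sum>y\<in>F. d y * ker y z)"
  have g: "g \<in> H" unfolding g_def using assms by (intro sum_mem scale_mem kernel_mem) auto
  have "ip g g = (\<Sum>y\<in>F. d y * ip (ker y) g)"
    unfolding g_def using assms g[unfolded g_def]
    by (subst ip_sum_left) (auto intro!: sum.cong scale_mem kernel_mem ip_scale)
  also have "\<dots> = (\<Sum>y\<in>F. d y * cnj (g y))"
  proof (intro sum.cong refl)
    fix y assume "y \<in> F"
    then have "y \<in> X" using assms by blast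
    then show "d y * ip (ker y) g = d y * cnj (g y)"
      using ip_cnj[OF g kernel_mem] reproducing[OF g] by simp
  qed
  also have "\<dots> = (\<Sum>y\<in>F. \<Sum>x\<in>F. d y * cnj (d x) * cnj (K y x))"
    using assms by (intro sum.cong refl) (auto simp: g_def sum_distrib_left mult.assoc subset_iff)
  also have "\<dots> = (\<Sum>y\<in>F. \<Sum>x\<in>F. d y * cnj (d x) * K x y)"
  proof (intro sum.cong refl)
    fix x y assume xy: "x \<in> F" "y \<in> F"
    have "cnj (K y x) = K x y"
      using ip_cnj[OF kernel_mem kernel_mem, of x y] xy assms
      by (simp add: reproducing kernel_mem subset_iff)
    then show "d y * cnj (d x) * cnj (K y x) = d y * cnj (d x) * K x y" by simp
  qed
  finally show ?thesis
    using arg_cong[OF ip_self[OF g], of Re] by (simp add: g_def)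
qed

text \<open>The Aronszajn description of the ball of radius \<open>\<surd>c\<close>. The function is recovered as the
  minimiser of \<open>\<parallel>g\<parallel>\<^sup>2 / 2 - Re \<langle>g, f\<rangle>\<close> over the span of the kernel functions, where \<open>\<langle>g, f\<rangle>\<close> makes
  sense before \<open>f\<close> is known to lie in the space.\<close>

lemma mem_if_kernel_dominates:
  fixes f :: "'p \<Rightarrow> complex"
  assumes out: "\<And>x. x \<notin> X \<Longrightarrow> f x = 0" and c: "0 \<le> c"
    and pos: "\<And>F d. finite F \<Longrightarrow> F \<subseteq> X \<Longrightarrow>
      0 \<le> Re (\<Sum>x\<in>F. \<Sum>y\<in>F. d x * cnj (d y) * (complex_of_real c * K x y - f x * cnj (f y)))"
  shows "f \<in> H" "nrm f \<le> sqrt c"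
proof -
  \<comment> \<open>Pairs of an element \<open>g\<close> of the span and the value that \<open>\<langle>g, f\<rangle>\<close> ought to have.\<close>
  define Gr where "Gr = {(g, l). \<exists>F d. finite F \<and> F \<subseteq> X \<and>
    g = (\<lambda>z. \<Sum>y\<in>F. d y * ker y z) \<and> l = (\<Sum>y\<in>F. d y * cnj (f y))}"
  have Gr_mem: "g \<in> H" if "(g, l) \<in> Gr" for g l
    using that unfolding Gr_def by (auto intro!: sum_mem scale_mem kernel_mem)
  have Gr_bound: "cmod l \<le> sqrt c * nrm g" if "(g, l) \<in> Gr" for g l
  proof -
    obtain F d where F: "finite F" "F \<subseteq> X" and g: "g = (\<lambda>z. \<Sum>y\<in>F. d y * ker y z)"
      and l: "l = (\<Sum>y\<in>F. d y * cnj (f y))" using \<open>(g, l) \<in> Gr\<close> unfolding Gr_def by auto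
    have "(\<Sum>x\<in>F. \<Sum>y\<in>F. cnj (d x) * cnj (cnj (d y)) * (complex_of_real c * K x y - f x * cnj (f y)))
      = complex_of_real c * (\<Sum>x\<in>F. \<Sum>y\<in>F. d y * cnj (d x) * K x y)
        - (\<Sum>x\<in>F. \<Sum>y\<in>F. (cnj (d x) * f x) * (d y * cnj (f y)))"
    proof -
      have "cnj (d x) * cnj (cnj (d y)) * (complex_of_real c * K x y - f x * cnj (f y)) =
          complex_of_real c * (d y * cnj (d x) * K x y) - (cnj (d x) * f x) * (d y * cnj (f y))"
        for x y by (simp add: algebra_simps)
      then show ?thesis by (simp only: sum_subtractf sum_distrib_left)
    qed
    also have "(\<Sum>x\<in>F. \<Sum>y\<in>F. d y * cnj (d x) * K x y) = (\<Sum>y\<in>F. \<Sum>x\<in>F. d y * cnj (d x) * K x y)"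
      by (rule sum.swap)
    also have "(\<Sum>x\<in>F. \<Sum>y\<in>F. (cnj (d x) * f x) * (d y * cnj (f y))) = cnj l * l"
      by (simp add: l sum_product)
    also have "cnj l * l = complex_of_real ((cmod l)\<^sup>2)"
      by (simp add: mult.commute flip: complex_norm_square)
    finally have "(cmod l)\<^sup>2 \<le> c * (nrm g)\<^sup>2"
      using pos[OF F, of "\<lambda>x. cnj (d x)"] kernel_sum_norm[OF F, of d] by (simp add: g)
    then have "(cmod l)\<^sup>2 \<le> (sqrt c * nrm g)\<^sup>2" using c by (simp add: power_mult_distrib)
    then show ?thesis by (rule power2_le_imp_le) (use c nrm_nonneg[OF Gr_mem[OF that]] in auto)
  qed
  have Gr_add: "(\<lambda>z. g z + t * h z, l + t * m) \<in> Gr"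
    if gl: "(g, l) \<in> Gr" and hm: "(h, m) \<in> Gr" for g l h m t
  proof -
    obtain F d where F: "finite F" "F \<subseteq> X" and g: "g = (\<lambda>z. \<Sum>y\<in>F. d y * ker y z)"
      and l: "l = (\<Sum>y\<in>F. d y * cnj (f y))" using gl unfolding Gr_def by auto
    obtain F' d' where F': "finite F'" "F' \<subseteq> X" and h: "h = (\<lambda>z. \<Sum>y\<in>F'. d' y * ker y z)"
      and m: "m = (\<Sum>y\<in>F'. d' y * cnj (f y))" using hm unfolding Gr_def by auto
    define e where "e y = (if y \<in> F then d y else 0) + t * (if y \<in> F' then d' y else 0)" for y
    have sum_e: "(\<Sum>y\<in>F \<union> F'. e y * k y) = (\<Sum>y\<in>F. d y * k y) + t * (\<Sum>y\<in>F'. d' y * k y)"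
      for k :: "'p \<Rightarrow> complex"
    proof -
      have "(\<Sum>y\<in>F \<union> F'. e y * k y) = (\<Sum>y\<in>F \<union> F'. if y \<in> F then d y * k y else 0) +
          (\<Sum>y\<in>F \<union> F'. if y \<in> F' then t * (d' y * k y) else 0)"
        unfolding sum.distrib[symmetric] e_def by (intro sum.cong) (auto simp: algebra_simps)
      also have "\<dots> = (\<Sum>y\<in>F. d y * k y) + (\<Sum>y\<in>F'. t * (d' y * k y))"
        using F F' by (simp add: sum.inter_restrict[symmetric] Int_absorb1)
      finally show ?thesis by (simp add: sum_distrib_left)
    qed
    show ?thesis
      unfolding Gr_def g l h m
      using F F' by (auto intro!: exI[of _ "F \<union> F'"] exI[of _ e] simp only: sum_e finite_Un)
  qed
  have Gr_ker: "(ker w, cnj (f w)) \<in> Gr" if "w \<in> X" for w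
    unfolding Gr_def using that by (auto intro!: exI[of _ "{w}"] exI[of _ "\<lambda>_. 1"])
  have Gr_zero: "((\<lambda>z. 0), 0) \<in> Gr"
    unfolding Gr_def by (auto intro!: exI[of _ "{}"])
  have Gr_half: "(\<lambda>z. (1/2) * g z + (1/2) * h z, (1/2) * l + (1/2) * m) \<in> Gr"
    if "(g, l) \<in> Gr" "(h, m) \<in> Gr" for g l h m
    using Gr_add[OF Gr_add[OF Gr_zero that(1), of "1/2"] that(2), of "1/2"] by simp
  define J where "J = (\<lambda>(g, l). (nrm g)\<^sup>2 / 2 - Re l)"
  have J_lower: "- c / 2 \<le> J p" if "p \<in> Gr" for p
  proof -
    obtain g l where p: "p = (g, l)" by (cases p)
    have "Re l \<le> sqrt c * nrm g"
      using Gr_bound that complex_Re_le_cmod[of l] unfolding p by fastforce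
    moreover have "0 \<le> (sqrt c - nrm g)\<^sup>2" by simp
    ultimately show ?thesis using c by (simp add: J_def p power2_diff)
  qed
  define m where "m = Inf (J ` Gr)"
  have m_le: "m \<le> J p" if "p \<in> Gr" for p
    unfolding m_def using that J_lower by (intro cInf_lower bdd_belowI[of _ "- c / 2"]) auto
  have "\<exists>p\<in>Gr. J p < m + 1 / Suc n" for n
  proof -
    have "\<exists>x\<in>J ` Gr. x < m + 1 / Suc n"
      unfolding m_def using Gr_zero by (intro cInf_lessD) auto
    then show ?thesis by blast
  qed
  then obtain p where p: "\<And>n. p n \<in> Gr" "\<And>n. J (p n) < m + 1 / Suc n" by metis
  define g where "g n = fst (p n)" for n
  define l where "l n = snd (p n)" for n
  have gl: "(g n, l n) \<in> Gr" for n using p(1)[of n] by (simp add: g_def l_def)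
  have gH: "g n \<in> H" for n using Gr_mem[OF gl] .
  have Jgl: "(nrm (g n))\<^sup>2 / 2 - Re (l n) < m + 1 / Suc n" for n
    using p(2)[of n] by (simp add: J_def g_def l_def split_beta)
  \<comment> \<open>The parallelogram law makes a minimising sequence a Cauchy sequence.\<close>
  have small: "(nrm (\<lambda>x. g n x - g k x))\<^sup>2 \<le> 4 * (1 / Suc n + 1 / Suc k)" for n k
  proof -
    have "m \<le> J (\<lambda>z. (1/2) * g n z + (1/2) * g k z, (1/2) * l n + (1/2) * l k)"
      by (intro m_le Gr_half gl)
    also have "\<dots> = ((nrm (g n))\<^sup>2 + (nrm (g k))\<^sup>2 + 2 * Re (ip (g n) (g k))) / 8
        - (Re (l n) + Re (l k)) / 2"
    proof -
      have "(\<lambda>z. (1/2) * g n z + (1/2) * g k z) = (\<lambda>z. (1/2) * (g n z + g k z))"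
        by (simp add: algebra_simps)
      then have "nrm (\<lambda>z. (1/2) * g n z + (1/2) * g k z) = 1/2 * nrm (\<lambda>z. g n z + g k z)"
        using nrm_scale[OF add_mem[OF gH gH], of "1/2" n k] by simp
      then have "(nrm (\<lambda>z. (1/2) * g n z + (1/2) * g k z))\<^sup>2 =
          ((nrm (g n))\<^sup>2 + (nrm (g k))\<^sup>2 + 2 * Re (ip (g n) (g k))) / 4"
        using nrm_add_square[OF gH gH, of n k] by (simp only: power_mult_distrib) (simp add: power2_eq_square)
      then show ?thesis
        unfolding J_def prod.case by (simp only:) (simp add: field_simps)
    qed
    finally have "m \<le> ((nrm (g n))\<^sup>2 + (nrm (g k))\<^sup>2 + 2 * Re (ip (g n) (g k))) / 8
        - (Re (l n) + Re (l k)) / 2" .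
    then show ?thesis
      using nrm_diff_square[OF gH gH, of n k] Jgl[of n] Jgl[of k] by argo
  qed
  have cauchy: "\<exists>N. \<forall>n\<ge>N. \<forall>k\<ge>N. nrm (\<lambda>x. g n x - g k x) < e" if "e > 0" for e
  proof -
    obtain N where N: "1 / Suc N < e\<^sup>2 / 8"
      using \<open>e > 0\<close> by (metis divide_pos_pos inverse_eq_divide reals_Archimedean zero_less_numeral zero_less_power)
    have "nrm (\<lambda>x. g n x - g k x) < e" if "n \<ge> N" "k \<ge> N" for n k
    proof -
      have "1 / Suc n \<le> 1 / real (Suc N)" "1 / Suc k \<le> 1 / real (Suc N)"
        using that by (auto intro!: divide_left_mono)
      then have "(nrm (\<lambda>x. g n x - g k x))\<^sup>2 < e\<^sup>2"
        using small[of n k] N by argo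
      then show ?thesis by (rule power2_less_imp_less) (use \<open>e > 0\<close> in auto)
    qed
    then show ?thesis by blast
  qed
  obtain u where u: "u \<in> H" and lim: "(\<lambda>n. nrm (\<lambda>x. g n x - u x)) \<longlonglongrightarrow> 0"
    using complete[of g, OF gH cauchy] by blast
  have inv0: "(\<lambda>n. 1 / real (Suc n)) \<longlonglongrightarrow> 0"
    using LIMSEQ_inverse_real_of_nat by (simp add: inverse_eq_divide)
  have u_eq: "u w = f w" if w: "w \<in> X" for w
  proof (rule ccontr)
    assume neq: "u w \<noteq> f w"
    define \<delta> where "\<delta> = u w - f w"
    define \<kappa> where "\<kappa> = (nrm (ker w))\<^sup>2"
    have lim_w: "(\<lambda>n. g n w) \<longlonglongrightarrow> u w"
    proof (rule LIM_zero_cancel, rule Lim_null_comparison)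
      show "\<forall>\<^sub>F n in sequentially. norm (g n w - u w) \<le> nrm (\<lambda>x. g n x - u x) * nrm (ker w)"
        using evaluation_bound[OF diff_mem[OF gH u] w] by (intro always_eventually) auto
      show "(\<lambda>n. nrm (\<lambda>x. g n x - u x) * nrm (ker w)) \<longlonglongrightarrow> 0"
        using tendsto_mult_left_zero[OF lim] by simp
    qed
    \<comment> \<open>The first variation of the functional in the direction of the kernel function at \<open>w\<close>.\<close>
    have var: "0 \<le> (cmod t)\<^sup>2 * \<kappa> / 2 + Re (cnj t * \<delta>)" for t
    proof (rule LIMSEQ_le_const)
      have "(\<lambda>n. 1 / Suc n + (cmod t)\<^sup>2 * \<kappa> / 2 + Re (cnj t * (g n w - f w))) \<longlonglongrightarrow>
          0 + (cmod t)\<^sup>2 * \<kappa> / 2 + Re (cnj t * (u w - f w))"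
        by (intro tendsto_intros inv0 lim_w)
      then show "(\<lambda>n. 1 / Suc n + (cmod t)\<^sup>2 * \<kappa> / 2 + Re (cnj t * (g n w - f w))) \<longlonglongrightarrow>
          (cmod t)\<^sup>2 * \<kappa> / 2 + Re (cnj t * \<delta>)" by (simp add: \<delta>_def)
      have "0 \<le> 1 / Suc n + (cmod t)\<^sup>2 * \<kappa> / 2 + Re (cnj t * (g n w - f w))" for n
      proof -
        have "m \<le> J (\<lambda>z. g n z + t * ker w z, l n + t * cnj (f w))"
          by (intro m_le Gr_add gl Gr_ker w)
        also have "\<dots> = ((nrm (g n))\<^sup>2 + (cmod t)\<^sup>2 * \<kappa> + 2 * Re (cnj t * g n w)) / 2
            - Re (l n) - Re (t * cnj (f w))"
          using gH w kernel_mem[OF w] unfolding J_def \<kappa>_def prod.case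
          by (subst nrm_add_square) (auto intro: scale_mem
            simp: nrm_scale[of "ker w"] ip_scale_right[of "ker w"] reproducing power_mult_distrib)
        also have "Re (t * cnj (f w)) = Re (cnj t * f w)" by simp
        finally show ?thesis using Jgl[of n] by (simp add: algebra_simps)
      qed
      then show "\<exists>N. \<forall>n\<ge>N. 0 \<le> 1 / Suc n + (cmod t)\<^sup>2 * \<kappa> / 2 + Re (cnj t * (g n w - f w))" by blast
    qed
    define s where "s = 1 / (\<kappa> + 1)"
    have \<kappa>0: "0 \<le> \<kappa>" by (simp add: \<kappa>_def)
    have s: "0 < s" "s * \<kappa> < 1" using \<kappa>0 by (auto simp: s_def field_simps)
    have cj: "cnj (- complex_of_real s * \<delta>) * \<delta> = - complex_of_real (s * (cmod \<delta>)\<^sup>2)"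
      by (simp add: mult.commute flip: complex_norm_square)
    have "0 \<le> (s * cmod \<delta>)\<^sup>2 * \<kappa> / 2 - s * (cmod \<delta>)\<^sup>2"
      using var[of "- complex_of_real s * \<delta>"] s unfolding cj by (simp add: norm_mult)
    then have "s * (cmod \<delta>)\<^sup>2 * 2 \<le> s * (cmod \<delta>)\<^sup>2 * (s * \<kappa>)"
      by (simp add: power2_eq_square algebra_simps)
    moreover have "0 < s * (cmod \<delta>)\<^sup>2" using s neq by (simp add: \<delta>_def)
    ultimately show False using s by (simp add: mult_le_cancel_left)
  qed
  have "u = f"
    using u_eq zero_outside[OF u] out by (intro ext) metis
  then show f: "f \<in> H" using u by simp
  have l_eq: "l n = ip (g n) f" for n
  proof -
    obtain F d where F: "finite F" "F \<subseteq> X" and g: "g n = (\<lambda>z. \<Sum>y\<in>F. d y * ker y z)"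
      and l: "l n = (\<Sum>y\<in>F. d y * cnj (f y))" using gl[of n] unfolding Gr_def by auto
    have "ip (g n) f = (\<Sum>y\<in>F. d y * ip (ker y) f)"
      unfolding g using F f by (subst ip_sum_left) (auto intro!: sum.cong scale_mem kernel_mem ip_scale)
    also have "\<dots> = l n"
      unfolding l
    proof (intro sum.cong refl)
      fix y assume "y \<in> F"
      then have "y \<in> X" using F by blast
      then show "d y * ip (ker y) f = d y * cnj (f y)"
        using ip_cnj[OF f kernel_mem] reproducing[OF f] by simp
    qed
    finally show ?thesis by simp
  qed
  have "(nrm f)\<^sup>2 \<le> sqrt c * nrm f"
  proof (rule LIMSEQ_le_const)
    define a where "a n = nrm (\<lambda>x. g n x - f x)" for n
    have a: "a \<longlonglongrightarrow> 0" unfolding a_def using lim by (simp add: \<open>u = f\<close>)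
    have "(\<lambda>n. a n * nrm f + sqrt c * (a n + nrm f)) \<longlonglongrightarrow> 0 * nrm f + sqrt c * (0 + nrm f)"
      by (intro tendsto_intros a)
    then show "(\<lambda>n. a n * nrm f + sqrt c * (a n + nrm f)) \<longlonglongrightarrow> sqrt c * nrm f" by simp
    have "(nrm f)\<^sup>2 \<le> a n * nrm f + sqrt c * (a n + nrm f)" for n
    proof -
      have fg: "(\<lambda>x. f x - g n x) \<in> H" "(\<lambda>x. g n x - f x) \<in> H" using f gH by (auto intro: diff_mem)
      have sw: "nrm (\<lambda>x. f x - g n x) = a n"
        unfolding a_def using nrm_scale[OF fg(1), of "-1"] by simp
      have "ip (\<lambda>x. (f x - g n x) + g n x) f = ip (\<lambda>x. f x - g n x) f + ip (g n) f"
        using fg gH f by (intro ip_add) auto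
      then have "(nrm f)\<^sup>2 = Re (ip (\<lambda>x. f x - g n x) f) + Re (ip (g n) f)"
        using arg_cong[OF ip_self[OF f], of Re] by simp
      also have "\<dots> \<le> nrm (\<lambda>x. f x - g n x) * nrm f + cmod (l n)"
        using cauchy_schwarz[OF fg(1) f] complex_Re_le_cmod[of "ip (\<lambda>x. f x - g n x) f"]
          complex_Re_le_cmod[of "l n"] l_eq[of n] by simp
      also have "cmod (l n) \<le> sqrt c * nrm (g n)" by (rule Gr_bound[OF gl])
      also have "nrm (g n) \<le> a n + nrm f"
        using nrm_triangle[OF fg(2) f] by (simp add: a_def)
      finally show ?thesis using c by (simp add: sw mult_left_mono)
    qed
    then show "\<exists>N. \<forall>n\<ge>N. (nrm f)\<^sup>2 \<le> a n * nrm f + sqrt c * (a n + nrm f)" by blast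
  qed
  then show "nrm f \<le> sqrt c"
    using nrm_nonneg[OF f] c by (cases "nrm f = 0") (auto simp: power2_eq_square)
qed

lemma multiplierD:
  assumes "\<phi> \<in> multipliers X H ip"
  shows "\<And>x. x \<notin> X \<Longrightarrow> \<phi> x = 0" "\<And>f. f \<in> H \<Longrightarrow> (\<lambda>x. \<phi> x * f x) \<in> H"
    "\<exists>B. \<forall>f\<in>H. nrm (\<lambda>x. \<phi> x * f x) \<le> B * nrm f"
  using assms by (auto simp: multipliers_def)

lemma mult_norm_bdd:
  assumes "\<phi> \<in> multipliers X H ip"
  shows "bdd_above ((\<lambda>f. nrm (\<lambda>x. \<phi> x * f x)) ` {f \<in> H. nrm f \<le> 1})"
proof -
  obtain B where B: "\<forall>f\<in>H. nrm (\<lambda>x. \<phi> x * f x) \<le> B * nrm f"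
    using multiplierD(3)[OF assms] by blast
  have "nrm (\<lambda>x. \<phi> x * f x) \<le> \<bar>B\<bar>" if "f \<in> H" "nrm f \<le> 1" for f
  proof -
    have "nrm (\<lambda>x. \<phi> x * f x) \<le> B * nrm f" using B that by blast
    also have "\<dots> \<le> \<bar>B\<bar> * 1" using that nrm_nonneg[of f] by (intro mult_mono) auto
    finally show ?thesis by simp
  qed
  then show ?thesis by (intro bdd_aboveI[of _ "\<bar>B\<bar>"]) auto
qed

lemma nrm_zero: "nrm (\<lambda>x. 0) = 0"
  using ip_zero_left[OF zero_mem] by (simp add: ip_norm_def)

lemma mult_norm_nonneg: "\<phi> \<in> multipliers X H ip \<Longrightarrow> 0 \<le> mult_norm H ip \<phi>"
  unfolding mult_norm_def using zero_mem nrm_zero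
  by (intro cSUP_upper2[OF mult_norm_bdd, of _ "\<lambda>x. 0"]) auto

lemma mult_norm_bound:
  assumes "\<phi> \<in> multipliers X H ip" "f \<in> H"
  shows "nrm (\<lambda>x. \<phi> x * f x) \<le> mult_norm H ip \<phi> * nrm f"
proof (cases "nrm f = 0")
  case True
  then have "f = (\<lambda>x. 0)" using assms ip_definite[of f] by (simp add: ip_self)
  then show ?thesis by (simp add: nrm_zero)
next
  case False
  define t where "t = nrm f"
  have t: "t > 0" using False nrm_nonneg[OF assms(2)] by (simp add: t_def)
  define g where "g = (\<lambda>x. complex_of_real (1 / t) * f x)"
  have g: "g \<in> H" "nrm g \<le> 1"
    using assms t by (auto simp: g_def nrm_scale scale_mem t_def[symmetric] simp del: of_real_divide)
  have "nrm (\<lambda>x. \<phi> x * g x) \<le> mult_norm H ip \<phi>"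
    unfolding mult_norm_def by (rule cSUP_upper[OF _ mult_norm_bdd]) (use g assms in auto)
  moreover have "nrm (\<lambda>x. \<phi> x * g x) = nrm (\<lambda>x. \<phi> x * f x) / t"
    using nrm_scale[OF multiplierD(2)[OF assms], of "complex_of_real (1 / t)"] t
    by (simp add: g_def mult.left_commute norm_divide)
  ultimately show ?thesis using t by (simp add: t_def[symmetric] divide_le_eq)
qed

lemma multiplierI:
  assumes "\<And>x. x \<notin> X \<Longrightarrow> \<phi> x = 0" "0 \<le> B" "\<And>f. f \<in> H \<Longrightarrow> (\<lambda>x. \<phi> x * f x) \<in> H"
    "\<And>f. f \<in> H \<Longrightarrow> nrm (\<lambda>x. \<phi> x * f x) \<le> B * nrm f"
  shows "\<phi> \<in> multipliers X H ip" "mult_norm H ip \<phi> \<le> B"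
proof -
  show "\<phi> \<in> multipliers X H ip" using assms by (auto simp: multipliers_def)
  show "mult_norm H ip \<phi> \<le> B"
    unfolding mult_norm_def
  proof (rule cSUP_least)
    show "{f \<in> H. nrm f \<le> 1} \<noteq> {}" using zero_mem nrm_zero by (auto intro!: exI[of _ "\<lambda>x. 0"])
    fix f assume f: "f \<in> {f \<in> H. nrm f \<le> 1}"
    then have "nrm (\<lambda>x. \<phi> x * f x) \<le> B * nrm f" using assms by blast
    also have "\<dots> \<le> B * 1" using f assms(2) by (intro mult_left_mono) auto
    finally show "nrm (\<lambda>x. \<phi> x * f x) \<le> B" by simp
  qed
qed

lemma multiplier_add:
  assumes "\<phi> \<in> multipliers X H ip" "\<psi> \<in> multipliers X H ip"
  shows "(\<lambda>x. \<phi> x + \<psi> x) \<in> multipliers X H ip"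
    "mult_norm H ip (\<lambda>x. \<phi> x + \<psi> x) \<le> mult_norm H ip \<phi> + mult_norm H ip \<psi>"
proof -
  have "(\<lambda>x. (\<phi> x + \<psi> x) * f x) \<in> H" if "f \<in> H" for f
    using add_mem[OF multiplierD(2)[OF assms(1) that] multiplierD(2)[OF assms(2) that]]
    by (simp add: distrib_right)
  moreover have "nrm (\<lambda>x. (\<phi> x + \<psi> x) * f x) \<le> (mult_norm H ip \<phi> + mult_norm H ip \<psi>) * nrm f"
    if "f \<in> H" for f
    using nrm_triangle[OF multiplierD(2)[OF assms(1) that] multiplierD(2)[OF assms(2) that]]
      mult_norm_bound[OF assms(1) that] mult_norm_bound[OF assms(2) that]
    by (simp add: distrib_right)
  ultimately show "(\<lambda>x. \<phi> x + \<psi> x) \<in> multipliers X H ip"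
    "mult_norm H ip (\<lambda>x. \<phi> x + \<psi> x) \<le> mult_norm H ip \<phi> + mult_norm H ip \<psi>"
    using multiplierI[of "\<lambda>x. \<phi> x + \<psi> x" "mult_norm H ip \<phi> + mult_norm H ip \<psi>"]
      mult_norm_nonneg assms multiplierD(1)[OF assms(1)] multiplierD(1)[OF assms(2)] by auto
qed

lemma multiplier_times:
  assumes "\<phi> \<in> multipliers X H ip" "\<psi> \<in> multipliers X H ip"
  shows "(\<lambda>x. \<phi> x * \<psi> x) \<in> multipliers X H ip"
    "mult_norm H ip (\<lambda>x. \<phi> x * \<psi> x) \<le> mult_norm H ip \<phi> * mult_norm H ip \<psi>"
proof -
  have "(\<lambda>x. \<phi> x * \<psi> x * f x) \<in> H" if "f \<in> H" for f
    using multiplierD(2)[OF assms(1) multiplierD(2)[OF assms(2) that]] by (simp add: mult.assoc)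
  moreover have "nrm (\<lambda>x. \<phi> x * \<psi> x * f x) \<le> mult_norm H ip \<phi> * mult_norm H ip \<psi> * nrm f"
    if "f \<in> H" for f
  proof -
    have "nrm (\<lambda>x. \<phi> x * (\<psi> x * f x)) \<le> mult_norm H ip \<phi> * nrm (\<lambda>x. \<psi> x * f x)"
      by (rule mult_norm_bound[OF assms(1) multiplierD(2)[OF assms(2) that]])
    also have "\<dots> \<le> mult_norm H ip \<phi> * (mult_norm H ip \<psi> * nrm f)"
      by (rule mult_left_mono[OF mult_norm_bound[OF assms(2) that] mult_norm_nonneg[OF assms(1)]])
    finally show ?thesis by (simp add: mult.assoc)
  qed
  ultimately show "(\<lambda>x. \<phi> x * \<psi> x) \<in> multipliers X H ip"
    "mult_norm H ip (\<lambda>x. \<phi> x * \<psi> x) \<le> mult_norm H ip \<phi> * mult_norm H ip \<psi>"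
    using multiplierI[of "\<lambda>x. \<phi> x * \<psi> x" "mult_norm H ip \<phi> * mult_norm H ip \<psi>"]
      mult_norm_nonneg assms multiplierD(1)[OF assms(1)] by auto
qed

lemma multiplier_const:
  "(\<lambda>x. if x \<in> X then c else 0) \<in> multipliers X H ip"
  "mult_norm H ip (\<lambda>x. if x \<in> X then c else 0) \<le> cmod c"
proof -
  have eq: "(\<lambda>x. (if x \<in> X then c else 0) * f x) = (\<lambda>x. c * f x)" if "f \<in> H" for f
    using zero_outside[OF that] by auto
  show "(\<lambda>x. if x \<in> X then c else 0) \<in> multipliers X H ip"
    "mult_norm H ip (\<lambda>x. if x \<in> X then c else 0) \<le> cmod c"
    using multiplierI[of "\<lambda>x. if x \<in> X then c else 0" "cmod c"] eq
    by (auto simp: scale_mem nrm_scale)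
qed

lemma multiplier_scale:
  assumes "\<phi> \<in> multipliers X H ip"
  shows "(\<lambda>x. c * \<phi> x) \<in> multipliers X H ip"
    "mult_norm H ip (\<lambda>x. c * \<phi> x) \<le> cmod c * mult_norm H ip \<phi>"
proof -
  have eq: "(\<lambda>x. (if x \<in> X then c else 0) * \<phi> x) = (\<lambda>x. c * \<phi> x)"
    using multiplierD(1)[OF assms] by auto
  show "(\<lambda>x. c * \<phi> x) \<in> multipliers X H ip"
    using multiplier_times(1)[OF multiplier_const(1)[of c] assms] eq by simp
  show "mult_norm H ip (\<lambda>x. c * \<phi> x) \<le> cmod c * mult_norm H ip \<phi>"
    using multiplier_times(2)[OF multiplier_const(1) assms, of c]
      mult_right_mono[OF multiplier_const(2)[of c] mult_norm_nonneg[OF assms]] eq by simp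
qed

text \<open>If \<open>f\<close> lies in the space then \<open>\<parallel>f\<parallel>\<^sup>2 K - f f\<^sup>*\<close> is positive, and
  \<open>W \<parallel>f\<parallel>\<^sup>2 K - \<phi> f (\<phi> f)\<^sup>* = \<parallel>f\<parallel>\<^sup>2 (W - \<phi> \<phi>\<^sup>*) K + \<phi> (\<parallel>f\<parallel>\<^sup>2 K - f f\<^sup>*) \<phi>\<^sup>*\<close>.\<close>

lemma multiplier_if_pos_kernel:
  assumes out: "\<And>x. x \<notin> X \<Longrightarrow> \<phi> x = 0" and W: "0 \<le> W"
    and pos: "pos_kernel X (\<lambda>x y. (complex_of_real W - \<phi> x * cnj (\<phi> y)) * K x y)"
  shows "\<phi> \<in> multipliers X H ip" "mult_norm H ip \<phi> \<le> sqrt W"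
proof -
  have main: "(\<lambda>x. \<phi> x * f x) \<in> H" "nrm (\<lambda>x. \<phi> x * f x) \<le> sqrt (W * (nrm f)\<^sup>2)" if f: "f \<in> H" for f
  proof -
    have pos_f: "0 \<le> Re (\<Sum>x\<in>F. \<Sum>y\<in>F. d x * cnj (d y) * (complex_of_real ((nrm f)\<^sup>2) * K x y - f x * cnj (f y)))"
      if F: "finite F" "F \<subseteq> X" for F d
    proof -
      define g where "g = (\<lambda>z. \<Sum>y\<in>F. cnj (d y) * ker y z)"
      have g: "g \<in> H" unfolding g_def using F by (intro sum_mem scale_mem kernel_mem) auto
      have "ip g f = (\<Sum>y\<in>F. cnj (d y) * ip (ker y) f)"
        unfolding g_def using F f by (subst ip_sum_left) (auto intro!: sum.cong scale_mem kernel_mem ip_scale)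
      also have "\<dots> = (\<Sum>y\<in>F. cnj (d y) * cnj (f y))"
      proof (intro sum.cong refl)
        fix y assume "y \<in> F"
        then have "y \<in> X" using F by blast
        then show "cnj (d y) * ip (ker y) f = cnj (d y) * cnj (f y)"
          using ip_cnj[OF f kernel_mem] reproducing[OF f] by simp
      qed
      finally have ip: "ip g f = cnj (\<Sum>y\<in>F. d y * f y)" by simp
      have "(\<Sum>x\<in>F. \<Sum>y\<in>F. d x * cnj (d y) * (complex_of_real ((nrm f)\<^sup>2) * K x y - f x * cnj (f y)))
        = complex_of_real ((nrm f)\<^sup>2) * (\<Sum>x\<in>F. \<Sum>y\<in>F. cnj (d y) * cnj (cnj (d x)) * K x y)
          - (\<Sum>x\<in>F. \<Sum>y\<in>F. (d x * f x) * cnj (d y * f y))"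
      proof -
        have "d x * cnj (d y) * (complex_of_real ((nrm f)\<^sup>2) * K x y - f x * cnj (f y)) =
            complex_of_real ((nrm f)\<^sup>2) * (cnj (d y) * cnj (cnj (d x)) * K x y)
            - (d x * f x) * cnj (d y * f y)"
          for x y by (simp add: algebra_simps)
        then show ?thesis by (simp only: sum_subtractf sum_distrib_left)
      qed
      also have "(\<Sum>x\<in>F. \<Sum>y\<in>F. cnj (d y) * cnj (cnj (d x)) * K x y) =
          (\<Sum>y\<in>F. \<Sum>x\<in>F. cnj (d y) * cnj (cnj (d x)) * K x y)"
        by (rule sum.swap)
      also have "(\<Sum>x\<in>F. \<Sum>y\<in>F. (d x * f x) * cnj (d y * f y)) = cnj (ip g f) * ip g f"
        by (simp add: ip sum_product del: complex_cnj_mult)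
      also have "cnj (ip g f) * ip g f = complex_of_real ((cmod (ip g f))\<^sup>2)"
        by (simp add: mult.commute flip: complex_norm_square)
      finally have "Re (\<Sum>x\<in>F. \<Sum>y\<in>F. d x * cnj (d y) * (complex_of_real ((nrm f)\<^sup>2) * K x y - f x * cnj (f y)))
        = (nrm f)\<^sup>2 * (nrm g)\<^sup>2 - (cmod (ip g f))\<^sup>2"
        using kernel_sum_norm[OF F, of "\<lambda>y. cnj (d y)"] by (simp add: g_def del: complex_cnj_cnj)
      moreover have "(cmod (ip g f))\<^sup>2 \<le> (nrm g * nrm f)\<^sup>2"
        by (rule power_mono[OF cauchy_schwarz[OF g f]]) simp
      ultimately show ?thesis by (simp add: power_mult_distrib mult.commute)
    qed
    have dom: "0 \<le> Re (\<Sum>x\<in>F. \<Sum>y\<in>F. d x * cnj (d y) *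
        (complex_of_real (W * (nrm f)\<^sup>2) * K x y - (\<phi> x * f x) * cnj (\<phi> y * f y)))"
      if F: "finite F" "F \<subseteq> X" for F d
    proof -
      have "(\<Sum>x\<in>F. \<Sum>y\<in>F. d x * cnj (d y) *
          (complex_of_real (W * (nrm f)\<^sup>2) * K x y - (\<phi> x * f x) * cnj (\<phi> y * f y))) =
        complex_of_real ((nrm f)\<^sup>2) * (\<Sum>x\<in>F. \<Sum>y\<in>F. d x * cnj (d y) *
          ((complex_of_real W - \<phi> x * cnj (\<phi> y)) * K x y)) +
        (\<Sum>x\<in>F. \<Sum>y\<in>F. (d x * \<phi> x) * cnj (d y * \<phi> y) *
          (complex_of_real ((nrm f)\<^sup>2) * K x y - f x * cnj (f y)))"
      proof -
        have "d x * cnj (d y) *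
            (complex_of_real (W * (nrm f)\<^sup>2) * K x y - (\<phi> x * f x) * cnj (\<phi> y * f y)) =
          complex_of_real ((nrm f)\<^sup>2) * (d x * cnj (d y) *
            ((complex_of_real W - \<phi> x * cnj (\<phi> y)) * K x y)) +
          (d x * \<phi> x) * cnj (d y * \<phi> y) *
            (complex_of_real ((nrm f)\<^sup>2) * K x y - f x * cnj (f y))" for x y
          by (simp add: algebra_simps)
        then show ?thesis by (simp only: sum.distrib sum_distrib_left)
      qed
      then show ?thesis
        using pos_kernel_quadratic_form[OF pos F, of d] pos_f[OF F, of "\<lambda>x. d x * \<phi> x"]
        by simp
    qed
    show "(\<lambda>x. \<phi> x * f x) \<in> H" "nrm (\<lambda>x. \<phi> x * f x) \<le> sqrt (W * (nrm f)\<^sup>2)"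
      by (rule mem_if_kernel_dominates[OF _ _ dom]; use W out in simp)+
  qed
  have "nrm (\<lambda>x. \<phi> x * f x) \<le> sqrt W * nrm f" if "f \<in> H" for f
    using main(2)[OF that] nrm_nonneg[OF that] W by (simp add: real_sqrt_mult)
  then show "\<phi> \<in> multipliers X H ip" "mult_norm H ip \<phi> \<le> sqrt W"
    using multiplierI[OF out _ main(1), of "sqrt W"] W by simp_all
qed

end

section \<open>Moebius functions of a coordinate as multipliers\<close>

lemma hermitian_bound: "cmod (hermitian z w) \<le> norm z * norm w"
proof -
  have "cmod (hermitian z w) \<le> (\<Sum>i\<in>UNIV. cmod (z $ i) * cmod (w $ i))"
    unfolding hermitian_def by (rule order_trans[OF norm_sum]) (simp add: norm_mult)
  also have "\<dots> \<le> norm z * norm w"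
    using L2_set_mult_ineq[of "\<lambda>i. cmod (z $ i)" "\<lambda>i. cmod (w $ i)" UNIV]
    by (simp add: norm_vec_def)
  finally show ?thesis .
qed

lemma hermitian_less_1: "norm z < 1 \<Longrightarrow> norm w \<le> 1 \<Longrightarrow> cmod (hermitian z w) < 1"
proof -
  assume "norm z < 1" "norm w \<le> 1"
  then have "norm z * norm w \<le> norm z * 1" by (intro mult_left_mono) auto
  then show ?thesis using hermitian_bound[of z w] \<open>norm z < 1\<close> by linarith
qed

lemma cnj_hermitian: "cnj (hermitian z w) = hermitian w z"
  by (simp add: hermitian_def mult.commute)

lemma hermitian_self: "hermitian z z = complex_of_real ((norm z)\<^sup>2)"
  unfolding hermitian_def norm_vec_def L2_set_def
  by (simp add: sum_nonneg complex_norm_square[symmetric] del: of_real_power)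

text \<open>The difference is the inner product of the components orthogonal to \<open>\<zeta>\<close>.\<close>

lemma pos_kernel_hermitian_diff:
  assumes "norm \<zeta> = 1"
  shows "pos_kernel X (\<lambda>z w. hermitian z w - hermitian z \<zeta> * cnj (hermitian w \<zeta>))"
proof (rule pos_kernel_cong)
  show "pos_kernel X (\<lambda>z w. \<Sum>i\<in>UNIV. (z $ i - hermitian z \<zeta> * \<zeta> $ i) * cnj (w $ i - hermitian w \<zeta> * \<zeta> $ i))"
    by (intro pos_kernel_sum pos_kernel_rank_one)
  fix z w :: "complex ^ 'a"
  have "(\<Sum>i\<in>UNIV. (z $ i - hermitian z \<zeta> * \<zeta> $ i) * cnj (w $ i - hermitian w \<zeta> * \<zeta> $ i)) =
      hermitian z w - cnj (hermitian w \<zeta>) * hermitian z \<zeta> - hermitian z \<zeta> * hermitian \<zeta> w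
        + hermitian z \<zeta> * cnj (hermitian w \<zeta>) * hermitian \<zeta> \<zeta>"
    unfolding hermitian_def[of z w] hermitian_def[of z \<zeta>] hermitian_def[of \<zeta> w] hermitian_def[of \<zeta> \<zeta>]
    unfolding sum_distrib_left sum_subtractf[symmetric] sum.distrib[symmetric]
    by (intro sum.cong refl) (simp add: algebra_simps)
  then show "(\<Sum>i\<in>UNIV. (z $ i - hermitian z \<zeta> * \<zeta> $ i) * cnj (w $ i - hermitian w \<zeta> * \<zeta> $ i)) =
      hermitian z w - hermitian z \<zeta> * cnj (hermitian w \<zeta>)"
    using assms by (simp add: cnj_hermitian hermitian_self)
qed

text \<open>\<open>h\<^sup>n\<^sup>+\<^sup>1 - t\<^sup>n\<^sup>+\<^sup>1 = h (h\<^sup>n - t\<^sup>n) + (h - t) t\<^sup>n\<close>.\<close>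

lemma pos_kernel_power_diff:
  assumes t: "pos_kernel X t" and d: "pos_kernel X (\<lambda>x y. h x y - t x y)"
  shows "pos_kernel X (\<lambda>x y. h x y ^ n - t x y ^ n)"
proof (induction n)
  case 0
  then show ?case using pos_kernel_const[of 0 X] by simp
next
  case (Suc n)
  have h: "pos_kernel X h" using pos_kernel_add[OF d t] by simp
  have "pos_kernel X (\<lambda>x y. h x y * (h x y ^ n - t x y ^ n) + (h x y - t x y) * t x y ^ n)"
    by (rule pos_kernel_add[OF pos_kernel_mult[OF h Suc] pos_kernel_mult[OF d pos_kernel_power[OF t]]])
  then show ?case by (rule pos_kernel_cong) (simp add: algebra_simps)
qed

text \<open>The difference of the logarithms is \<open>\<Sum> (h\<^sup>n - t\<^sup>n) / n\<close>. Exponentiating it, \<open>(1 - h)\<^sup>-\<^sup>a\<close> becomes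
  \<open>(1 - t)\<^sup>-\<^sup>a\<close> times a positive kernel, so that multiplier estimates in one variable \<open>t\<close> carry over to
  the ball.\<close>

lemma pos_kernel_Ln_diff:
  assumes t: "pos_kernel X t" and d: "pos_kernel X (\<lambda>x y. h x y - t x y)"
    and t1: "\<And>x y. x \<in> X \<Longrightarrow> y \<in> X \<Longrightarrow> cmod (t x y) < 1"
    and h1: "\<And>x y. x \<in> X \<Longrightarrow> y \<in> X \<Longrightarrow> cmod (h x y) < 1"
  shows "pos_kernel X (\<lambda>x y. Ln (1 - t x y) - Ln (1 - h x y))"
proof (rule pos_kernel_sums)
  fix n :: nat
  show "pos_kernel X (\<lambda>x y. complex_of_real (1 / real n) * (h x y ^ n - t x y ^ n))"
    by (rule pos_kernel_scale[OF pos_kernel_power_diff[OF t d]]) simp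
next
  fix x y assume "x \<in> X" "y \<in> X"
  then have "(\<lambda>n. - ((- (- t x y)) ^ n) / of_nat n - - ((- (- h x y)) ^ n) / of_nat n) sums
      (Ln (1 + - t x y) - Ln (1 + - h x y))"
    using t1 h1 by (intro sums_diff Ln_series') auto
  then show "(\<lambda>n. complex_of_real (1 / real n) * (h x y ^ n - t x y ^ n)) sums
      (Ln (1 - t x y) - Ln (1 - h x y))"
    by (simp add: diff_divide_distrib algebra_simps)
qed

text \<open>The Taylor coefficients of \<open>(1 - t)\<^sup>-\<^sup>a\<close>.\<close>

definition binom_coeff :: "real \<Rightarrow> nat \<Rightarrow> real" where
  "binom_coeff a j = pochhammer a j / fact j"

lemma binom_coeff_sums:
  assumes "cmod t < 1"
  shows "(\<lambda>j. complex_of_real (binom_coeff a j) * t ^ j) sums exp (- (complex_of_real a * Ln (1 - t)))"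
proof -
  have "(\<lambda>j. ((- complex_of_real a) gchoose j) * (- t) ^ j) sums (1 + - t) powr (- complex_of_real a)"
    by (rule gen_binomial_complex) (use assms in simp)
  moreover have "((- complex_of_real a) gchoose j) * (- t) ^ j = complex_of_real (binom_coeff a j) * t ^ j" for j
    by (simp add: gbinomial_pochhammer binom_coeff_def pochhammer_of_real power_minus[of t])
  moreover have "(1 + - t) powr (- complex_of_real a) = exp (- (complex_of_real a * Ln (1 - t)))"
    using assms by (auto simp: powr_def)
  ultimately show ?thesis by simp
qed

text \<open>The numbers \<open>j c\<^sub>j\<close> increase with \<open>j\<close>, because \<open>(j + 1) c\<^sub>j\<^sub>+\<^sub>1 = (a + j) c\<^sub>j\<close>. Only \<open>c\<^sub>0\<close> escapes this
  comparison; it is compared with \<open>c\<^sub>1 = a\<close>, which is where \<open>1 / a\<close> comes from.\<close>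

lemma binom_coeff_growth:
  assumes "0 < a"
  shows "binom_coeff a i \<le> real (n + 1) * max 1 (1 / a) * binom_coeff a (i + n)"
proof -
  have pos: "0 < binom_coeff a j" for j
    using assms by (simp add: binom_coeff_def pochhammer_pos)
  have step: "real (Suc j) * binom_coeff a (Suc j) = (a + real j) * binom_coeff a j" for j
    by (simp add: binom_coeff_def pochhammer_Suc mult.commute del: of_nat_Suc)
  have mono: "real i * binom_coeff a i \<le> real (i + n) * binom_coeff a (i + n)" for i n
  proof (induction n)
    case (Suc n)
    have "real (i + n) * binom_coeff a (i + n) \<le> (a + real (i + n)) * binom_coeff a (i + n)"
      using pos[of "i + n"] assms by (intro mult_right_mono) auto
    then show ?case using Suc step[of "i + n"] by simp
  qed simp
  consider "n = 0" | "n > 0" "i = 0" | "i > 0" by auto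
  then show ?thesis
  proof cases
    case 1
    then show ?thesis using pos[of i] mult_right_mono[of 1 "max 1 (1 / a)" "binom_coeff a i"] by simp
  next
    case 2
    have "a * binom_coeff a 0 = binom_coeff a 1" using step[of 0] by simp
    also have "\<dots> \<le> real n * binom_coeff a n" using mono[of 1 "n - 1"] 2 by simp
    finally have "binom_coeff a 0 \<le> real n * (1 / a) * binom_coeff a n"
      using assms by (simp add: field_simps)
    also have "\<dots> \<le> real (n + 1) * max 1 (1 / a) * binom_coeff a n"
      using assms pos[of n] by (intro mult_right_mono mult_mono) auto
    finally show ?thesis using 2 by simp
  next
    case 3
    have "i + n \<le> i * (n + 1)"
      using 3 by (cases i) auto
    then have "real (i + n) \<le> real i * real (n + 1)"
      by (simp only: of_nat_mult[symmetric] of_nat_le_iff)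
    then have "real i * binom_coeff a i \<le> real i * real (n + 1) * binom_coeff a (i + n)"
      using mono[of i n] pos[of "i + n"] by (meson less_imp_le mult_right_mono order_trans)
    then have "binom_coeff a i \<le> real (n + 1) * 1 * binom_coeff a (i + n)" using 3 by simp
    also have "\<dots> \<le> real (n + 1) * max 1 (1 / a) * binom_coeff a (i + n)"
      using pos[of "i + n"] by (intro mult_right_mono mult_left_mono) auto
    finally show ?thesis .
  qed
qed

text \<open>The Taylor coefficients in \<open>t\<close> are \<open>W c\<^sub>j - c\<^sub>j\<^sub>-\<^sub>n\<close>, nonnegative by the growth of \<open>c\<^sub>j\<close>.\<close>

lemma pos_kernel_power_gap:
  assumes a: "0 < a" and t: "pos_kernel X t" and t1: "\<And>x y. x \<in> X \<Longrightarrow> y \<in> X \<Longrightarrow> cmod (t x y) < 1"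
  shows "pos_kernel X (\<lambda>x y. (complex_of_real (real (n + 1) * max 1 (1 / a)) - t x y ^ n) *
    exp (- (complex_of_real a * Ln (1 - t x y))))"
proof (rule pos_kernel_sums)
  define W where "W = real (n + 1) * max 1 (1 / a)"
  define c where "c j = W * binom_coeff a j - (if j < n then 0 else binom_coeff a (j - n))" for j
  have c: "0 \<le> c j" for j
  proof (cases "j < n")
    case True
    then show ?thesis using a by (auto simp: c_def W_def binom_coeff_def less_max_iff_disj
      intro!: mult_nonneg_nonneg divide_nonneg_nonneg pochhammer_nonneg)
  next
    case False
    then show ?thesis using binom_coeff_growth[OF a, of "j - n" n] by (simp add: c_def W_def)
  qed
  show "pos_kernel X (\<lambda>x y. complex_of_real (c j) * t x y ^ j)" for j
    by (rule pos_kernel_scale[OF pos_kernel_power[OF t] c])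
  fix x y assume xy: "x \<in> X" "y \<in> X"
  let ?S = "exp (- (complex_of_real a * Ln (1 - t x y)))"
  have S: "(\<lambda>j. complex_of_real (binom_coeff a j) * t x y ^ j) sums ?S"
    by (rule binom_coeff_sums[OF t1[OF xy]])
  have "(\<lambda>j. complex_of_real (if j < n then 0 else binom_coeff a (j - n)) * t x y ^ j) sums (t x y ^ n * ?S)"
    using sums_mult[OF S, of "t x y ^ n"]
    by (subst sums_zero_iff_shift[of n, symmetric]) (auto simp: power_add mult_ac)
  from sums_diff[OF sums_mult[OF S, of "complex_of_real W"] this]
  show "(\<lambda>j. complex_of_real (c j) * t x y ^ j) sums
      ((complex_of_real (real (n + 1) * max 1 (1 / a)) - t x y ^ n) * ?S)"
    by (simp add: c_def W_def algebra_simps)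
qed

lemma moebius_identity:
  fixes b u v :: complex
  assumes "1 - cnj b * u \<noteq> 0" "1 - cnj b * v \<noteq> 0"
  shows "1 - (b - u) / (1 - cnj b * u) * cnj ((b - v) / (1 - cnj b * v)) =
    complex_of_real (1 - (cmod b)\<^sup>2) * (1 - u * cnj v) / ((1 - cnj b * u) * cnj (1 - cnj b * v))"
proof -
  have nz: "1 - b * cnj v \<noteq> 0"
  proof
    assume "1 - b * cnj v = 0"
    then have "cnj (1 - b * cnj v) = 0" by simp
    then show False using assms(2) by simp
  qed
  have frac: "1 - x / p * (y / q) = (p * q - x * y) / (p * q)" if "p \<noteq> 0" "q \<noteq> 0" for x y p q :: complex
    using that by (simp add: divide_simps)
  have num: "(1 - cnj b * u) * (1 - b * cnj v) - (b - u) * (cnj b - cnj v) = (1 - b * cnj b) * (1 - u * cnj v)"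
    by (simp add: algebra_simps)
  have b2: "complex_of_real (1 - (cmod b)\<^sup>2) = 1 - b * cnj b"
    by (simp add: complex_norm_square[symmetric] del: of_real_power)
  show ?thesis
    using frac[OF assms(1) nz, of "b - u" "cnj b - cnj v"] unfolding num b2 by simp
qed

lemma prod_less_1: "cmod x < 1 \<Longrightarrow> cmod y < 1 \<Longrightarrow> cmod (x * y) < 1"
  using mult_strict_mono'[of "cmod x" 1 "cmod y" 1] by (simp add: norm_mult)

lemma one_minus_nonzero: "cmod x < 1 \<Longrightarrow> 1 - x \<noteq> 0"
  by auto

lemma moebius_less_1:
  assumes "cmod b < 1" "cmod u < 1"
  shows "cmod ((b - u) / (1 - cnj b * u)) < 1"
proof -
  have nz: "1 - cnj b * u \<noteq> 0" using prod_less_1[of "cnj b" u] assms by auto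
  let ?\<theta> = "(b - u) / (1 - cnj b * u)"
  have "complex_of_real (1 - (cmod ?\<theta>)\<^sup>2) = 1 - ?\<theta> * cnj ?\<theta>"
    by (simp add: complex_norm_square[symmetric] del: of_real_power complex_cnj_divide)
  also have "\<dots> = complex_of_real (1 - (cmod b)\<^sup>2) * (1 - u * cnj u) / ((1 - cnj b * u) * cnj (1 - cnj b * u))"
    by (rule moebius_identity[OF nz nz])
  also have "\<dots> = complex_of_real ((1 - (cmod b)\<^sup>2) * (1 - (cmod u)\<^sup>2) / (cmod (1 - cnj b * u))\<^sup>2)"
    by (simp add: complex_norm_square[symmetric] del: of_real_power complex_cnj_diff)
  finally have "1 - (cmod ?\<theta>)\<^sup>2 = (1 - (cmod b)\<^sup>2) * (1 - (cmod u)\<^sup>2) / (cmod (1 - cnj b * u))\<^sup>2"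
    by (simp only: of_real_eq_iff)
  also have "\<dots> > 0"
    using assms nz by (intro divide_pos_pos mult_pos_pos) (auto simp: abs_square_less_1)
  finally show ?thesis by (simp add: abs_square_less_1)
qed

lemma Im_Ln_one_minus: "cmod q < 1 \<Longrightarrow> \<bar>Im (Ln (1 - q))\<bar> < pi / 2"
  using Re_Ln_pos_lt[of "1 - q"] complex_Re_le_cmod[of q] by (cases "q = 1") auto

text \<open>The imaginary parts of the logarithms on the right add up to less than \<open>3\<pi>/2\<close>, and \<open>1 - \<theta>\<theta>\<^sup>*\<close>
  lies in the right half plane, so no multiple of \<open>2\<pi>i\<close> enters.\<close>

lemma Ln_moebius:
  assumes b: "cmod b < 1" and u: "cmod u < 1" and v: "cmod v < 1"
  shows "Ln (1 - (b - u) / (1 - cnj b * u) * cnj ((b - v) / (1 - cnj b * v))) =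
    complex_of_real (ln (1 - (cmod b)\<^sup>2)) + Ln (1 - u * cnj v) - Ln (1 - cnj b * u) - cnj (Ln (1 - cnj b * v))"
    (is "Ln ?P = ?R")
proof -
  have small: "cmod (cnj b * u) < 1" "cmod (cnj b * v) < 1" "cmod (u * cnj v) < 1"
    using prod_less_1[of "cnj b" u] prod_less_1[of "cnj b" v] prod_less_1[of u "cnj v"] b u v by auto
  have nz: "1 - cnj b * u \<noteq> 0" "1 - cnj b * v \<noteq> 0" "1 - u * cnj v \<noteq> 0"
    using small by (intro one_minus_nonzero; simp)+
  have b2: "0 < 1 - (cmod b)\<^sup>2" using b by (simp add: abs_square_less_1)
  have "exp ?R = exp (complex_of_real (ln (1 - (cmod b)\<^sup>2))) * exp (Ln (1 - u * cnj v)) /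
      (exp (Ln (1 - cnj b * u)) * cnj (exp (Ln (1 - cnj b * v))))"
    by (simp add: exp_diff exp_add exp_cnj)
  also have "exp (complex_of_real (ln (1 - (cmod b)\<^sup>2))) = complex_of_real (1 - (cmod b)\<^sup>2)"
    using b2 by (simp only: exp_of_real exp_ln)
  finally have expR: "exp ?R = ?P"
    by (simp only: exp_Ln[OF nz(1)] exp_Ln[OF nz(2)] exp_Ln[OF nz(3)] moebius_identity[OF nz(1,2)])
  have "cmod ((b - u) / (1 - cnj b * u) * cnj ((b - v) / (1 - cnj b * v))) < 1"
    by (rule prod_less_1) (use moebius_less_1[OF b u] moebius_less_1[OF b v] in \<open>auto simp only: complex_mod_cnj\<close>)
  then have "0 < Re ?P"
    using complex_Re_le_cmod[of "(b - u) / (1 - cnj b * u) * cnj ((b - v) / (1 - cnj b * v))"] by simp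
  then have "0 < exp (Re ?R) * cos (Im ?R)"
    using expR by (metis Re_exp)
  then have cos: "0 < cos (Im ?R)" by (simp add: zero_less_mult_iff)
  have "Im ?R = Im (Ln (1 - u * cnj v)) - Im (Ln (1 - cnj b * u)) + Im (Ln (1 - cnj b * v))"
    by simp
  then have bound: "\<bar>Im ?R\<bar> < 3 * pi / 2"
    using Im_Ln_one_minus[OF small(1)] Im_Ln_one_minus[OF small(2)] Im_Ln_one_minus[OF small(3)]
    by linarith
  have "\<bar>Im ?R\<bar> < pi"
  proof (rule ccontr)
    assume "\<not> \<bar>Im ?R\<bar> < pi"
    then have "0 \<le> cos (\<bar>Im ?R\<bar> - pi)"
      using bound by (intro cos_ge_zero) auto
    then show False using cos by (simp add: cos_diff)
  qed
  then show ?thesis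
    using expR by (intro Ln_unique) auto
qed

lemma D_kernel_exp:
  assumes "cmod (hermitian z w) < 1"
  shows "D_kernel a z w = exp (- (complex_of_real a * Ln (1 - hermitian z w)))"
  using one_minus_nonzero[OF assms] by (simp add: D_kernel_def powr_def exp_minus divide_inverse)

text \<open>The disc automorphism that exchanges \<open>0\<close> and \<open>b\<close>, evaluated at \<open>s \<langle>z, \<zeta>\<rangle>\<close>. A factor \<open>s < 1\<close> allows zeros
  at points \<open>\<langle>z, \<zeta>\<rangle> = u\<close> on the unit circle, with \<open>b = s u\<close> still inside the disc.\<close>

definition disc_moebius :: "complex \<Rightarrow> real \<Rightarrow> complex ^ 'd \<Rightarrow> complex ^ 'd \<Rightarrow> complex" where
  "disc_moebius b s \<zeta> z = (b - of_real s * hermitian z \<zeta>) / (1 - cnj b * (of_real s * hermitian z \<zeta>))"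

text \<open>With \<open>\<theta>\<close> the Moebius function and \<open>u = s \<langle>z, \<zeta>\<rangle>\<close>, the kernel splits as
  \<open>(1 - \<theta>\<theta>\<^sup>*)\<^sup>-\<^sup>a\<close> times a rank one kernel times \<open>((1 - u u\<^sup>*) / (1 - \<langle>z, w\<rangle>))\<^sup>a\<close>, and the last factor is
  positive because \<open>\<langle>z, w\<rangle> - u u\<^sup>*\<close> is. The gap between \<open>W\<close> and \<open>(\<theta>\<theta>\<^sup>*)\<^sup>n\<close> is absorbed by the first factor.\<close>

lemma pos_kernel_moebius:
  fixes \<zeta> :: "complex ^ 'd"
  assumes a: "0 < a" and \<zeta>: "norm \<zeta> = 1" and b: "cmod b < 1" and s: "0 \<le> s" "s \<le> 1"
  shows "pos_kernel (ball 0 1) (\<lambda>z w. (complex_of_real (real (n + 1) * max 1 (1 / a)) -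
    disc_moebius b s \<zeta> z ^ n * cnj (disc_moebius b s \<zeta> w ^ n)) * D_kernel a z w)"
proof -
  let ?X = "ball 0 1 :: (complex ^ 'd) set"
  define u where "u z = complex_of_real s * hermitian z \<zeta>" for z
  define \<theta> where "\<theta> z = (b - u z) / (1 - cnj b * u z)" for z
  have moebius_eq: "disc_moebius b s \<zeta> z = \<theta> z" for z
    by (simp add: disc_moebius_def \<theta>_def u_def)
  have u1: "cmod (u z) < 1" if "z \<in> ?X" for z
  proof -
    have "cmod (u z) \<le> 1 * cmod (hermitian z \<zeta>)"
      unfolding u_def norm_mult using s by (intro mult_right_mono) auto
    then show ?thesis using hermitian_less_1[of z \<zeta>] that \<zeta> by auto
  qed
  have h1: "cmod (hermitian z w) < 1" if "z \<in> ?X" "w \<in> ?X" for z w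
    using that by (intro hermitian_less_1) auto
  have \<theta>1: "cmod (\<theta> z) < 1" if "z \<in> ?X" for z
    unfolding \<theta>_def by (rule moebius_less_1[OF b u1[OF that]])
  have A: "pos_kernel ?X (\<lambda>z w. (complex_of_real (real (n + 1) * max 1 (1 / a)) - (\<theta> z * cnj (\<theta> w)) ^ n) *
      exp (- (complex_of_real a * Ln (1 - \<theta> z * cnj (\<theta> w)))))"
    using \<theta>1 by (intro pos_kernel_power_gap[OF a pos_kernel_rank_one] prod_less_1) auto
  have "pos_kernel ?X (\<lambda>z w. (hermitian z w - hermitian z \<zeta> * cnj (hermitian w \<zeta>)) +
      complex_of_real (1 - s\<^sup>2) * (hermitian z \<zeta> * cnj (hermitian w \<zeta>)))"
    using s by (intro pos_kernel_add pos_kernel_hermitian_diff \<zeta> pos_kernel_scale pos_kernel_rank_one)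
      (simp add: abs_square_le_1)
  then have "pos_kernel ?X (\<lambda>z w. hermitian z w - u z * cnj (u w))"
    by (rule pos_kernel_cong) (simp add: u_def algebra_simps power2_eq_square)
  then have "pos_kernel ?X (\<lambda>z w. Ln (1 - u z * cnj (u w)) - Ln (1 - hermitian z w))"
    using u1 h1 by (intro pos_kernel_Ln_diff[OF pos_kernel_rank_one] prod_less_1) auto
  then have B: "pos_kernel ?X (\<lambda>z w. exp (complex_of_real a * (Ln (1 - u z * cnj (u w)) - Ln (1 - hermitian z w))))"
    using a by (intro pos_kernel_exp pos_kernel_scale) auto
  define G where "G z = exp (- (complex_of_real a * Ln (1 - cnj b * u z)))" for z
  define E where "E z w = complex_of_real (exp (a * ln (1 - (cmod b)\<^sup>2))) * ((G z * cnj (G w)) *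
      exp (complex_of_real a * (Ln (1 - u z * cnj (u w)) - Ln (1 - hermitian z w))))" for z w
  have E: "pos_kernel ?X E"
    unfolding E_def by (intro pos_kernel_scale pos_kernel_mult pos_kernel_rank_one B) simp
  have K: "D_kernel a z w = exp (- (complex_of_real a * Ln (1 - \<theta> z * cnj (\<theta> w)))) * E z w"
    if zw: "z \<in> ?X" "w \<in> ?X" for z w
  proof -
    have Ln: "Ln (1 - \<theta> z * cnj (\<theta> w)) = complex_of_real (ln (1 - (cmod b)\<^sup>2)) + Ln (1 - u z * cnj (u w))
        - Ln (1 - cnj b * u z) - cnj (Ln (1 - cnj b * u w))"
      unfolding \<theta>_def by (rule Ln_moebius[OF b u1[OF zw(1)] u1[OF zw(2)]])
    show ?thesis
      unfolding D_kernel_exp[OF h1[OF zw]] Ln E_def G_def exp_of_real[symmetric] exp_cnj exp_add[symmetric]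
      by (rule arg_cong[where f = exp]) (simp add: algebra_simps)
  qed
  show ?thesis
    by (rule pos_kernel_cong[OF pos_kernel_mult[OF A E]])
       (simp add: K moebius_eq mult.assoc power_mult_distrib)
qed

text \<open>The bound depends neither on the zero \<open>b\<close> nor on \<open>s\<close>. For \<open>b = 0\<close> and \<open>s = 1\<close> it says that the powers of a
  coordinate grow at most like \<open>\<surd>n\<close>.\<close>

lemma moebius_multiplier:
  fixes H :: "(complex ^ 'd \<Rightarrow> complex) set" and \<zeta> :: "complex ^ 'd"
  assumes H: "rkhs (ball 0 1) (D_kernel a) H ip"
    and a: "0 < a" and \<zeta>: "norm \<zeta> = 1" and b: "cmod b < 1" and s: "0 \<le> s" "s \<le> 1"
  shows "(\<lambda>z. if z \<in> ball 0 1 then disc_moebius b s \<zeta> z ^ n else 0) \<in> multipliers (ball 0 1) H ip"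
    "mult_norm H ip (\<lambda>z. if z \<in> ball 0 1 then disc_moebius b s \<zeta> z ^ n else 0)
      \<le> sqrt (real (n + 1) * max 1 (1 / a))"
proof -
  interpret rkhs "ball 0 1" "D_kernel a" H ip by (rule H)
  have pos: "pos_kernel (ball 0 1) (\<lambda>z w. (complex_of_real (real (n + 1) * max 1 (1 / a)) -
      (if z \<in> ball 0 1 then disc_moebius b s \<zeta> z ^ n else 0) *
      cnj (if w \<in> ball 0 1 then disc_moebius b s \<zeta> w ^ n else 0)) * D_kernel a z w)"
    by (rule pos_kernel_cong[OF pos_kernel_moebius[OF a \<zeta> b s, of n]]) simp
  show "(\<lambda>z. if z \<in> ball 0 1 then disc_moebius b s \<zeta> z ^ n else 0) \<in> multipliers (ball 0 1) H ip"
    "mult_norm H ip (\<lambda>z. if z \<in> ball 0 1 then disc_moebius b s \<zeta> z ^ n else 0)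
      \<le> sqrt (real (n + 1) * max 1 (1 / a))"
    by (rule multiplier_if_pos_kernel[OF _ _ pos]; use a in simp)+
qed

section \<open>The two algebras contain the Cauchy kernels\<close>

definition on_ball :: "(complex ^ 'd \<Rightarrow> complex) \<Rightarrow> complex ^ 'd \<Rightarrow> complex" where
  "on_ball f = (\<lambda>z. if z \<in> ball 0 1 then f z else 0)"

lemma on_ball_add: "on_ball f z + on_ball g z = on_ball (\<lambda>z. f z + g z) z"
  and on_ball_diff: "on_ball f z - on_ball g z = on_ball (\<lambda>z. f z - g z) z"
  and on_ball_mult: "on_ball f z * on_ball g z = on_ball (\<lambda>z. f z * g z) z"
  and on_ball_scale: "c * on_ball f z = on_ball (\<lambda>z. c * f z) z"
  by (auto simp: on_ball_def)

lemma on_ball_cong: "(\<And>z. norm z < 1 \<Longrightarrow> f z = g z) \<Longrightarrow> on_ball f = on_ball g"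
  by (auto simp: on_ball_def)

abbreviation unit_ball :: "(complex ^ 'd) set" where
  "unit_ball \<equiv> ball 0 1"

text \<open>The exponents \<open>\<alpha> i\<close> need not be distinct; equal ones are collected.\<close>

lemma polynomialI:
  assumes "finite I"
  shows "on_ball (\<lambda>z. \<Sum>i\<in>I. c i * (\<Prod>j\<in>UNIV. (z $ j) ^ \<alpha> i j)) \<in> polynomials_on unit_ball"
proof -
  have "(\<Sum>i\<in>I. c i * (\<Prod>j\<in>UNIV. (z $ j) ^ \<alpha> i j)) =
      (\<Sum>\<beta>\<in>\<alpha> ` I. (\<Sum>i\<in>{i\<in>I. \<alpha> i = \<beta>}. c i) * (\<Prod>j\<in>UNIV. (z $ j) ^ \<beta> j))" for z
    unfolding sum.image_gen[OF assms, of "\<lambda>i. c i * (\<Prod>j\<in>UNIV. (z $ j) ^ \<alpha> i j)" \<alpha>]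
      sum_distrib_right
    by (intro sum.cong refl) simp
  then show ?thesis
    unfolding polynomials_on_def on_ball_def using assms
    by (auto intro!: exI[of _ "\<alpha> ` I"] exI[of _ "\<lambda>\<beta>. \<Sum>i\<in>{i\<in>I. \<alpha> i = \<beta>}. c i"])
qed

lemma polynomialE:
  assumes "p \<in> polynomials_on unit_ball"
  obtains S and c :: "('d::finite \<Rightarrow> nat) \<Rightarrow> complex"
  where "finite S" "p = on_ball (\<lambda>z. \<Sum>\<alpha>\<in>S. c \<alpha> * (\<Prod>j\<in>UNIV. (z $ j) ^ \<alpha> j))"
  using assms unfolding polynomials_on_def on_ball_def by blast

lemma polynomial_const: "on_ball (\<lambda>z. c) \<in> polynomials_on unit_ball"
  using polynomialI[of "{()}" "\<lambda>_. c" "\<lambda>_ _. 0"] by simp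

lemma polynomial_coord: "on_ball (\<lambda>z. z $ i) \<in> polynomials_on unit_ball"
proof -
  have "(\<Prod>j\<in>UNIV. (z $ j) ^ (if j = i then 1 else 0)) = z $ i" for z :: "complex ^ 'a"
    by (subst prod.remove[of _ i]) auto
  then show ?thesis
    using polynomialI[of "{()}" "\<lambda>_. 1" "\<lambda>_ j. if j = i then 1 else 0"] by simp
qed

lemma polynomial_add:
  assumes "p \<in> polynomials_on unit_ball" "q \<in> polynomials_on unit_ball"
  shows "(\<lambda>z. p z + q z) \<in> polynomials_on unit_ball"
proof -
  obtain S c where S: "finite S" "p = on_ball (\<lambda>z. \<Sum>\<alpha>\<in>S. c \<alpha> * (\<Prod>j\<in>UNIV. (z $ j) ^ \<alpha> j))"
    using assms(1) by (rule polynomialE)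
  obtain T d where T: "finite T" "q = on_ball (\<lambda>z. \<Sum>\<alpha>\<in>T. d \<alpha> * (\<Prod>j\<in>UNIV. (z $ j) ^ \<alpha> j))"
    using assms(2) by (rule polynomialE)
  have "on_ball (\<lambda>z. \<Sum>i\<in>S <+> T. case_sum c d i * (\<Prod>j\<in>UNIV. (z $ j) ^ case_sum (\<lambda>\<alpha>. \<alpha>) (\<lambda>\<alpha>. \<alpha>) i j))
      \<in> polynomials_on unit_ball"
    using S T by (intro polynomialI) auto
  then show ?thesis
    unfolding S T on_ball_add by (simp add: sum.Plus S T)
qed

lemma polynomial_mult:
  assumes "p \<in> polynomials_on unit_ball" "q \<in> polynomials_on unit_ball"
  shows "(\<lambda>z. p z * q z) \<in> polynomials_on unit_ball"
proof -
  obtain S c where S: "finite S" "p = on_ball (\<lambda>z. \<Sum>\<alpha>\<in>S. c \<alpha> * (\<Prod>j\<in>UNIV. (z $ j) ^ \<alpha> j))"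
    using assms(1) by (rule polynomialE)
  obtain T d where T: "finite T" "q = on_ball (\<lambda>z. \<Sum>\<alpha>\<in>T. d \<alpha> * (\<Prod>j\<in>UNIV. (z $ j) ^ \<alpha> j))"
    using assms(2) by (rule polynomialE)
  have "on_ball (\<lambda>z. \<Sum>i\<in>S \<times> T. (c (fst i) * d (snd i)) * (\<Prod>j\<in>UNIV. (z $ j) ^ (fst i j + snd i j)))
      \<in> polynomials_on unit_ball"
    using S T by (intro polynomialI) auto
  then show ?thesis
    unfolding S T on_ball_mult
    by (simp add: sum_product sum.cartesian_product power_add prod.distrib mult_ac split_beta)
qed

lemma polynomial_scale: "p \<in> polynomials_on unit_ball \<Longrightarrow> (\<lambda>z. c * p z) \<in> polynomials_on unit_ball"
proof -
  assume "p \<in> polynomials_on unit_ball"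
  then have "(\<lambda>z. on_ball (\<lambda>z. c) z * p z) \<in> polynomials_on unit_ball"
    by (rule polynomial_mult[OF polynomial_const])
  also have "(\<lambda>z. on_ball (\<lambda>z. c) z * p z) = (\<lambda>z. c * p z)"
    using \<open>p \<in> _\<close> by (auto simp: polynomials_on_def on_ball_def)
  finally show ?thesis .
qed

lemma polynomial_sum:
  assumes "\<And>i. i \<in> I \<Longrightarrow> on_ball (p i) \<in> polynomials_on unit_ball"
  shows "on_ball (\<lambda>z. \<Sum>i\<in>I. p i z) \<in> polynomials_on unit_ball"
  using assms
proof (induction I rule: infinite_finite_induct)
  case (insert i I)
  then show ?case
    using polynomial_add[of "on_ball (p i)" "on_ball (\<lambda>z. \<Sum>i\<in>I. p i z)"] by (simp add: on_ball_add)
qed (auto intro: polynomial_const)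

lemma polynomial_power:
  assumes "on_ball p \<in> polynomials_on unit_ball"
  shows "on_ball (\<lambda>z. p z ^ n) \<in> polynomials_on unit_ball"
proof (induction n)
  case (Suc n)
  then show ?case using polynomial_mult[OF assms Suc] by (simp add: on_ball_mult)
qed (simp add: polynomial_const)

lemma polynomial_hermitian: "on_ball (\<lambda>z. hermitian z \<zeta>) \<in> polynomials_on unit_ball"
  unfolding hermitian_def
proof (rule polynomial_sum)
  fix i show "on_ball (\<lambda>z. z $ i * cnj (\<zeta> $ i)) \<in> polynomials_on unit_ball"
    using polynomial_mult[OF polynomial_coord polynomial_const, of i "cnj (\<zeta> $ i)"]
    by (simp add: on_ball_mult)
qed

locale D_space = rkhs "ball 0 1 :: (complex ^ 'd) set" "D_kernel a" H ip
  for a :: real and H :: "(complex ^ 'd \<Rightarrow> complex) set" and ip +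
  assumes a_pos: "0 < a"
begin

abbreviation mults :: "(complex ^ 'd \<Rightarrow> complex) set" where
  "mults \<equiv> multipliers (ball 0 1) H ip"

abbreviation mnorm :: "(complex ^ 'd \<Rightarrow> complex) \<Rightarrow> real" where
  "mnorm \<equiv> mult_norm H ip"

text \<open>The constant in the norm estimate for Moebius functions: the squared norm of an \<open>n\<close>-th power is at most
  \<open>(n + 1) M\<close>.\<close>

definition M :: real where
  "M = max 1 (1 / a)"

lemma M_ge_1: "1 \<le> M"
  by (simp add: M_def)

lemma moebius_power_mults:
  assumes "norm \<zeta> = 1" "cmod b < 1" "0 \<le> s" "s \<le> 1"
  shows "on_ball (\<lambda>z. disc_moebius b s \<zeta> z ^ n) \<in> mults"
    "mnorm (on_ball (\<lambda>z. disc_moebius b s \<zeta> z ^ n)) \<le> sqrt (real (n + 1) * M)"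
  using moebius_multiplier[OF rkhs_axioms a_pos assms, of n] by (simp_all add: on_ball_def M_def)

lemma moebius_mults:
  assumes "norm \<zeta> = 1" "cmod b < 1" "0 \<le> s" "s \<le> 1"
  shows "on_ball (disc_moebius b s \<zeta>) \<in> mults" "mnorm (on_ball (disc_moebius b s \<zeta>)) \<le> sqrt (2 * M)"
  using moebius_power_mults[OF assms, of 1] by simp_all

lemma const_mults: "on_ball (\<lambda>z. c) \<in> mults" "mnorm (on_ball (\<lambda>z. c)) \<le> cmod c"
  using multiplier_const[of c] by (simp_all add: on_ball_def)

lemma hermitian_power_mults:
  assumes "norm \<zeta> = 1"
  shows "on_ball (\<lambda>z. hermitian z \<zeta> ^ n) \<in> mults"
    "mnorm (on_ball (\<lambda>z. hermitian z \<zeta> ^ n)) \<le> sqrt (real (n + 1) * M)"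
proof -
  have eq: "(\<lambda>z. (-1) ^ n * on_ball (\<lambda>z. disc_moebius 0 1 \<zeta> z ^ n) z) = on_ball (\<lambda>z. hermitian z \<zeta> ^ n)"
    unfolding on_ball_scale
    by (rule on_ball_cong) (simp add: disc_moebius_def power_mult_distrib[symmetric])
  note m = moebius_power_mults[OF assms, of 0 1 n]
  show "on_ball (\<lambda>z. hermitian z \<zeta> ^ n) \<in> mults"
    using multiplier_scale(1)[OF m(1), of "(-1) ^ n"] eq by simp
  have "mnorm (on_ball (\<lambda>z. hermitian z \<zeta> ^ n)) \<le> mnorm (on_ball (\<lambda>z. disc_moebius 0 1 \<zeta> z ^ n))"
    using multiplier_scale(2)[OF m(1), of "(-1) ^ n"] eq by (simp add: norm_power)
  then show "mnorm (on_ball (\<lambda>z. hermitian z \<zeta> ^ n)) \<le> sqrt (real (n + 1) * M)"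
    using m(2) by simp
qed

definition cauchy :: "complex \<Rightarrow> complex ^ 'd \<Rightarrow> complex ^ 'd \<Rightarrow> complex" where
  "cauchy c \<zeta> = on_ball (\<lambda>z. 1 / (1 - c * hermitian z \<zeta>))"

lemma cauchy_denominator: "norm z < 1 \<Longrightarrow> norm \<zeta> = 1 \<Longrightarrow> cmod c \<le> 1 \<Longrightarrow> 1 - c * hermitian z \<zeta> \<noteq> 0"
proof (rule one_minus_nonzero)
  assume "norm z < 1" "norm \<zeta> = 1" "cmod c \<le> 1"
  then have "cmod c * cmod (hermitian z \<zeta>) \<le> 1 * cmod (hermitian z \<zeta>)"
    by (intro mult_right_mono) auto
  then show "cmod (c * hermitian z \<zeta>) < 1"
    using hermitian_less_1[of z \<zeta>] \<open>norm z < 1\<close> \<open>norm \<zeta> = 1\<close> by (simp add: norm_mult)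
qed

text \<open>\<open>1 - c \<theta> = (1 - |c|\<^sup>2) / (1 - c \<langle>z, \<zeta>\<rangle>)\<close> for the Moebius function \<open>\<theta>\<close> with parameter \<open>c\<^sup>*\<close>.\<close>

lemma cauchy_mults:
  assumes \<zeta>: "norm \<zeta> = 1" and c: "cmod c < 1"
  shows "cauchy c \<zeta> \<in> mults"
proof -
  define r where "r = 1 / (1 - complex_of_real ((cmod c)\<^sup>2))"
  have c2: "(cmod c)\<^sup>2 < 1" using c by (simp add: abs_square_less_1)
  have r: "1 - c * cnj c \<noteq> 0" "r = 1 / (1 - c * cnj c)"
  proof -
    have "1 - c * cnj c = complex_of_real (1 - (cmod c)\<^sup>2)"
      by (simp add: complex_norm_square[symmetric] del: of_real_power)
    also have "\<dots> \<noteq> 0" using c2 by (simp only: of_real_eq_0_iff)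
    finally show "1 - c * cnj c \<noteq> 0" .
    show "r = 1 / (1 - c * cnj c)"
      by (simp add: r_def complex_norm_square[symmetric] del: of_real_power)
  qed
  note m = moebius_mults(1)[OF \<zeta>, of "cnj c" 1]
  have "(\<lambda>z. on_ball (\<lambda>z. r) z + (- r * c) * on_ball (disc_moebius (cnj c) 1 \<zeta>) z) \<in> mults"
    using c by (intro multiplier_add(1) multiplier_scale(1) const_mults(1) m) auto
  also have "(\<lambda>z. on_ball (\<lambda>z. r) z + (- r * c) * on_ball (disc_moebius (cnj c) 1 \<zeta>) z) = cauchy c \<zeta>"
    unfolding on_ball_scale on_ball_add cauchy_def
  proof (rule on_ball_cong)
    fix z :: "complex ^ 'd" assume "norm z < 1"
    then have nz: "1 - c * hermitian z \<zeta> \<noteq> 0" using \<zeta> c by (intro cauchy_denominator) auto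
    have "1 - c * disc_moebius (cnj c) 1 \<zeta> z = (1 - c * cnj c) / (1 - c * hermitian z \<zeta>)"
      using nz by (simp add: disc_moebius_def field_simps)
    moreover have "r + - r * c * disc_moebius (cnj c) 1 \<zeta> z = r * (1 - c * disc_moebius (cnj c) 1 \<zeta> z)"
      by (simp add: algebra_simps)
    ultimately show "r + - r * c * disc_moebius (cnj c) 1 \<zeta> z = 1 / (1 - c * hermitian z \<zeta>)"
      using r(1) unfolding r(2) by simp
  qed
  finally show ?thesis .
qed

lemma multiplier_diff: "\<phi> \<in> mults \<Longrightarrow> \<psi> \<in> mults \<Longrightarrow> (\<lambda>z. \<phi> z - \<psi> z) \<in> mults"
  using multiplier_add(1)[OF _ multiplier_scale(1), of \<phi> \<psi> "-1"] by simp

lemma multiplier_sum: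
  assumes "\<And>i. i \<in> I \<Longrightarrow> on_ball (f i) \<in> mults"
  shows "on_ball (\<lambda>z. \<Sum>i\<in>I. f i z) \<in> mults"
  using assms
proof (induction I rule: infinite_finite_induct)
  case (insert i I)
  then show ?case
    using multiplier_add(1)[of "on_ball (f i)" "on_ball (\<lambda>z. \<Sum>i\<in>I. f i z)"] by (simp add: on_ball_add)
qed (auto intro: const_mults)

definition A_carrier :: "(complex ^ 'd \<Rightarrow> complex) set" where
  "A_carrier = {\<phi> \<in> mults. \<forall>e>0. \<exists>p \<in> polynomials_on unit_ball \<inter> mults. mnorm (\<lambda>x. \<phi> x - p x) < e}"

lemma mnorm_zero: "mnorm (\<lambda>z. 0) = 0"
  using const_mults[of 0] mult_norm_nonneg[OF const_mults(1), of 0] by (simp add: on_ball_def)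

lemma A_carrier_polynomial: "p \<in> polynomials_on unit_ball \<Longrightarrow> p \<in> mults \<Longrightarrow> p \<in> A_carrier"
  unfolding A_carrier_def by (auto intro!: bexI[of _ p] simp: mnorm_zero)

lemma A_carrier_add:
  assumes "\<phi> \<in> A_carrier" "\<psi> \<in> A_carrier"
  shows "(\<lambda>z. \<phi> z + \<psi> z) \<in> A_carrier"
  unfolding A_carrier_def
proof (intro CollectI conjI allI impI)
  have m: "\<phi> \<in> mults" "\<psi> \<in> mults" using assms by (auto simp: A_carrier_def)
  then show "(\<lambda>z. \<phi> z + \<psi> z) \<in> mults" by (rule multiplier_add)
  fix e :: real assume "0 < e"
  then have "0 < e / 2" by simp
  then obtain p q where p: "p \<in> polynomials_on unit_ball \<inter> mults" "mnorm (\<lambda>x. \<phi> x - p x) < e / 2"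
    and q: "q \<in> polynomials_on unit_ball \<inter> mults" "mnorm (\<lambda>x. \<psi> x - q x) < e / 2"
    using assms unfolding A_carrier_def by blast
  have "mnorm (\<lambda>x. (\<phi> x - p x) + (\<psi> x - q x)) \<le> mnorm (\<lambda>x. \<phi> x - p x) + mnorm (\<lambda>x. \<psi> x - q x)"
    using m p q by (intro multiplier_add(2) multiplier_diff) auto
  then have "mnorm (\<lambda>x. \<phi> x + \<psi> x - (p x + q x)) < e"
    using p q by (simp add: algebra_simps)
  then show "\<exists>p\<in>polynomials_on unit_ball \<inter> mults. mnorm (\<lambda>x. \<phi> x + \<psi> x - p x) < e"
    using p q by (intro bexI[of _ "\<lambda>x. p x + q x"]) (auto intro: polynomial_add multiplier_add)
qed

lemma A_carrier_mult:
  assumes "\<phi> \<in> A_carrier" "\<psi> \<in> A_carrier"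
  shows "(\<lambda>z. \<phi> z * \<psi> z) \<in> A_carrier"
  unfolding A_carrier_def
proof (intro CollectI conjI allI impI)
  have m: "\<phi> \<in> mults" "\<psi> \<in> mults" using assms by (auto simp: A_carrier_def)
  then show "(\<lambda>z. \<phi> z * \<psi> z) \<in> mults" by (rule multiplier_times)
  fix e :: real assume e: "0 < e"
  have n\<psi>: "0 \<le> mnorm \<psi>" by (rule mult_norm_nonneg[OF m(2)])
  obtain p where p: "p \<in> polynomials_on unit_ball" "p \<in> mults"
    and pn: "mnorm (\<lambda>x. \<phi> x - p x) < e / 2 / (mnorm \<psi> + 1)"
    using assms(1) e n\<psi> unfolding A_carrier_def
    by (force dest: spec[of _ "e / 2 / (mnorm \<psi> + 1)"])
  have np: "0 \<le> mnorm p" by (rule mult_norm_nonneg[OF p(2)])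
  obtain q where q: "q \<in> polynomials_on unit_ball" "q \<in> mults"
    and qn: "mnorm (\<lambda>x. \<psi> x - q x) < e / 2 / (mnorm p + 1)"
    using assms(2) e np unfolding A_carrier_def
    by (force dest: spec[of _ "e / 2 / (mnorm p + 1)"])
  have d: "(\<lambda>x. \<phi> x - p x) \<in> mults" "(\<lambda>x. \<psi> x - q x) \<in> mults"
    using m p q by (auto intro: multiplier_diff)
  have eq: "(\<lambda>x. \<phi> x * \<psi> x - p x * q x) = (\<lambda>x. (\<phi> x - p x) * \<psi> x + p x * (\<psi> x - q x))"
    by (simp add: algebra_simps)
  have "mnorm (\<lambda>x. \<phi> x * \<psi> x - p x * q x) \<le>
      mnorm (\<lambda>x. (\<phi> x - p x) * \<psi> x) + mnorm (\<lambda>x. p x * (\<psi> x - q x))"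
    unfolding eq using d m p by (intro multiplier_add(2) multiplier_times(1))
  also have "mnorm (\<lambda>x. (\<phi> x - p x) * \<psi> x) \<le> mnorm (\<lambda>x. \<phi> x - p x) * mnorm \<psi>"
    by (rule multiplier_times(2)[OF d(1) m(2)])
  also have "mnorm (\<lambda>x. p x * (\<psi> x - q x)) \<le> mnorm p * mnorm (\<lambda>x. \<psi> x - q x)"
    by (rule multiplier_times(2)[OF p(2) d(2)])
  also have "mnorm (\<lambda>x. \<phi> x - p x) * mnorm \<psi> \<le> e / 2 / (mnorm \<psi> + 1) * mnorm \<psi>"
    using pn n\<psi> by (intro mult_right_mono) auto
  also have "e / 2 / (mnorm \<psi> + 1) * mnorm \<psi> < e / 2"
    using e n\<psi> by (simp add: field_simps)
  also have "mnorm p * mnorm (\<lambda>x. \<psi> x - q x) \<le> mnorm p * (e / 2 / (mnorm p + 1))"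
    using qn np by (intro mult_left_mono) auto
  also have "mnorm p * (e / 2 / (mnorm p + 1)) \<le> e / 2"
    using e np by (simp add: field_simps)
  finally have "mnorm (\<lambda>x. \<phi> x * \<psi> x - p x * q x) < e" by simp
  then show "\<exists>p\<in>polynomials_on unit_ball \<inter> mults. mnorm (\<lambda>x. \<phi> x * \<psi> x - p x) < e"
    using p q by (intro bexI[of _ "\<lambda>x. p x * q x"]) (auto intro: polynomial_mult multiplier_times)
qed

lemma A_carrier_const: "on_ball (\<lambda>z. c) \<in> A_carrier"
  by (rule A_carrier_polynomial[OF polynomial_const const_mults(1)])

lemma A_carrier_scale: "\<phi> \<in> A_carrier \<Longrightarrow> (\<lambda>z. c * \<phi> z) \<in> A_carrier"
proof -
  assume \<phi>: "\<phi> \<in> A_carrier"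
  then have "(\<lambda>z. on_ball (\<lambda>z. c) z * \<phi> z) \<in> A_carrier"
    by (rule A_carrier_mult[OF A_carrier_const])
  also have "(\<lambda>z. on_ball (\<lambda>z. c) z * \<phi> z) = (\<lambda>z. c * \<phi> z)"
    using \<phi> multiplierD(1)[of \<phi>] by (auto simp: A_carrier_def on_ball_def)
  finally show ?thesis .
qed

lemma A_carrier_hermitian: "norm \<zeta> = 1 \<Longrightarrow> on_ball (\<lambda>z. hermitian z \<zeta>) \<in> A_carrier"
  using hermitian_power_mults(1)[of \<zeta> 1] by (intro A_carrier_polynomial polynomial_hermitian) simp

text \<open>The geometric series of a Cauchy kernel converges in the multiplier norm because the norms of
  the powers of a coordinate grow only like \<open>\<surd>n\<close>.\<close>

lemma A_carrier_cauchy: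
  assumes \<zeta>: "norm \<zeta> = 1" and c: "cmod c < 1"
  shows "cauchy c \<zeta> \<in> A_carrier"
  unfolding A_carrier_def
proof (intro CollectI conjI allI impI)
  show cm: "cauchy c \<zeta> \<in> mults" by (rule cauchy_mults[OF assms])
  fix e :: real assume e: "0 < e"
  define B where "B = mnorm (cauchy c \<zeta>)"
  have B: "0 \<le> B" unfolding B_def by (rule mult_norm_nonneg[OF cm])
  define p where "p n = on_ball (\<lambda>z. \<Sum>m<n. c ^ m * hermitian z \<zeta> ^ m)" for n
  have pp: "p n \<in> polynomials_on unit_ball" for n
    unfolding p_def using polynomial_scale[OF polynomial_power[OF polynomial_hermitian]]
    by (intro polynomial_sum) (simp add: on_ball_scale)
  have pm: "p n \<in> mults" for n
    unfolding p_def using multiplier_scale(1)[OF hermitian_power_mults(1)[OF \<zeta>]]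
    by (intro multiplier_sum) (simp add: on_ball_scale)
  have tail: "mnorm (\<lambda>z. cauchy c \<zeta> z - p n z) \<le> cmod c ^ n * (real (n + 1) * M) * B" for n
  proof -
    have "(\<lambda>z. cauchy c \<zeta> z - p n z) = (\<lambda>z. c ^ n * (on_ball (\<lambda>z. hermitian z \<zeta> ^ n) z * cauchy c \<zeta> z))"
      unfolding cauchy_def p_def on_ball_mult on_ball_diff unfolding on_ball_scale
    proof (rule on_ball_cong)
      fix z :: "complex ^ 'd" assume "norm z < 1"
      then have nz: "1 - c * hermitian z \<zeta> \<noteq> 0" using \<zeta> c by (intro cauchy_denominator) auto
      have "(\<Sum>m<n. c ^ m * hermitian z \<zeta> ^ m) = (1 - (c * hermitian z \<zeta>) ^ n) / (1 - c * hermitian z \<zeta>)"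
        using nz by (subst power_mult_distrib[symmetric], subst sum_gp_strict) auto
      then show "1 / (1 - c * hermitian z \<zeta>) - (\<Sum>m<n. c ^ m * hermitian z \<zeta> ^ m) =
          c ^ n * (hermitian z \<zeta> ^ n * (1 / (1 - c * hermitian z \<zeta>)))"
        by (simp add: diff_divide_distrib power_mult_distrib)
    qed
    then have "mnorm (\<lambda>z. cauchy c \<zeta> z - p n z) \<le>
        cmod (c ^ n) * mnorm (\<lambda>z. on_ball (\<lambda>z. hermitian z \<zeta> ^ n) z * cauchy c \<zeta> z)"
      using multiplier_scale(2)[OF multiplier_times(1)[OF hermitian_power_mults(1)[OF \<zeta>, of n] cm], of "c ^ n"]
      by simp
    also have "\<dots> \<le> cmod (c ^ n) * (mnorm (on_ball (\<lambda>z. hermitian z \<zeta> ^ n)) * B)"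
      unfolding B_def
      by (intro mult_left_mono multiplier_times(2) hermitian_power_mults(1) \<zeta> cm) simp
    also have "\<dots> \<le> cmod (c ^ n) * ((real (n + 1) * M) * B)"
    proof (intro mult_left_mono mult_right_mono B)
      have "1 * 1 \<le> real (n + 1) * M" using M_ge_1 by (intro mult_mono) auto
      then have "sqrt (real (n + 1) * M) \<le> real (n + 1) * M"
        by (intro real_le_lsqrt) (auto simp: power2_eq_square mult_le_cancel_left1)
      then show "mnorm (on_ball (\<lambda>z. hermitian z \<zeta> ^ n)) \<le> real (n + 1) * M"
        using hermitian_power_mults(2)[OF \<zeta>, of n] by linarith
    qed simp
    finally show ?thesis by (simp add: norm_power mult.assoc)
  qed
  have "(\<lambda>n. (real n * cmod c ^ n + cmod c ^ n) * (M * B)) \<longlonglongrightarrow> (0 + 0) * (M * B)"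
    using c powser_times_n_limit_0[of "cmod c"]
    by (intro tendsto_intros LIMSEQ_power_zero) auto
  then have "(\<lambda>n. cmod c ^ n * (real (n + 1) * M) * B) \<longlonglongrightarrow> 0"
    by (simp add: algebra_simps)
  then have "\<forall>\<^sub>F n in sequentially. cmod c ^ n * (real (n + 1) * M) * B < e"
    using e by (auto dest: order_tendstoD)
  then obtain n where "cmod c ^ n * (real (n + 1) * M) * B < e"
    by (auto simp: eventually_sequentially)
  then have "mnorm (\<lambda>z. cauchy c \<zeta> z - p n z) < e" using tail[of n] by linarith
  then show "\<exists>p\<in>polynomials_on unit_ball \<inter> mults. mnorm (\<lambda>x. cauchy c \<zeta> x - p x) < e"
    using pp pm by (intro bexI[of _ "p n"]) auto
qed

end

section \<open>Annihilating products for matrices\<close>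

lemma vec_l2_norm_nonneg: "0 \<le> vec_l2_norm v"
  by (simp add: vec_l2_norm_def L2_set_nonneg)

lemma vec_l2_norm_add:
  assumes "v \<in> carrier_vec k" "w \<in> carrier_vec k"
  shows "vec_l2_norm (v + w) \<le> vec_l2_norm v + vec_l2_norm w"
proof -
  have "vec_l2_norm (v + w) \<le> L2_set (\<lambda>i. cmod (vec_index v i) + cmod (vec_index w i)) {..<k}"
    unfolding vec_l2_norm_def using assms by (auto intro!: L2_set_mono norm_triangle_ineq)
  also have "\<dots> \<le> vec_l2_norm v + vec_l2_norm w"
    unfolding vec_l2_norm_def using assms L2_set_triangle_ineq by (metis carrier_vecD)
  finally show ?thesis .
qed

lemma vec_l2_norm_smult: "vec_l2_norm (c \<cdot>\<^sub>v v) = cmod c * vec_l2_norm v"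
proof -
  have "L2_set (\<lambda>i. cmod (vec_index (c \<cdot>\<^sub>v v) i)) {..<dim_vec v} =
      L2_set (\<lambda>i. cmod c * cmod (vec_index v i)) {..<dim_vec v}"
    by (intro L2_set_cong) (auto simp: norm_mult)
  then show ?thesis by (simp add: vec_l2_norm_def L2_set_right_distrib)
qed

lemma vec_l2_norm_zero: "vec_l2_norm (0\<^sub>v k) = 0"
  by (simp add: vec_l2_norm_def L2_set_def)

lemma vec_l2_norm_eq_0:
  assumes "v \<in> carrier_vec k" "vec_l2_norm v = 0"
  shows "v = 0\<^sub>v k"
  using assms by (intro eq_vecI) (auto simp: vec_l2_norm_def L2_set_eq_0_iff)

lemma mat_vec_bound:
  assumes A: "A \<in> carrier_mat k k" and v: "v \<in> carrier_vec k"
  shows "vec_l2_norm (A *\<^sub>v v) \<le> (\<Sum>i<k. \<Sum>j<k. cmod (A $$ (i, j))) * vec_l2_norm v"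
proof -
  have coord: "cmod (vec_index v j) \<le> vec_l2_norm v" if "j < k" for j
    unfolding vec_l2_norm_def using that v by (intro member_le_L2_set) auto
  have "vec_l2_norm (A *\<^sub>v v) \<le> (\<Sum>i<k. cmod (vec_index (A *\<^sub>v v) i))"
  proof -
    have "dim_vec (A *\<^sub>v v) = k" using A by simp
    then show ?thesis unfolding vec_l2_norm_def by (simp only:) (rule L2_set_le_sum, simp)
  qed
  also have "\<dots> \<le> (\<Sum>i<k. \<Sum>j<k. cmod (A $$ (i, j)) * vec_l2_norm v)"
  proof (intro sum_mono)
    fix i assume i: "i \<in> {..<k}"
    have "vec_index (A *\<^sub>v v) i = (\<Sum>j<k. A $$ (i, j) * vec_index v j)"
      using A v i by (auto simp: scalar_prod_def lessThan_atLeast0 intro!: sum.cong)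
    also have "cmod \<dots> \<le> (\<Sum>j<k. cmod (A $$ (i, j)) * cmod (vec_index v j))"
      by (rule order_trans[OF norm_sum]) (simp add: norm_mult)
    also have "\<dots> \<le> (\<Sum>j<k. cmod (A $$ (i, j)) * vec_l2_norm v)"
      using coord by (intro sum_mono mult_left_mono) auto
    finally show "cmod (vec_index (A *\<^sub>v v) i) \<le> (\<Sum>j<k. cmod (A $$ (i, j)) * vec_l2_norm v)" .
  qed
  finally show ?thesis by (simp add: sum_distrib_right)
qed

lemma mat_op_norm_bound:
  assumes A: "A \<in> carrier_mat k k" and v: "v \<in> carrier_vec k"
  shows "vec_l2_norm (A *\<^sub>v v) \<le> mat_op_norm A * vec_l2_norm v"
proof (cases "vec_l2_norm v = 0")
  case True
  then have "vec_l2_norm (A *\<^sub>v v) \<le> 0" using mat_vec_bound[OF assms] by simp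
  then show ?thesis using True by simp
next
  case False
  define t where "t = vec_l2_norm v"
  have t: "0 < t" using False vec_l2_norm_nonneg[of v] by (simp add: t_def)
  define w where "w = complex_of_real (1 / t) \<cdot>\<^sub>v v"
  have w: "w \<in> carrier_vec k" "vec_l2_norm w \<le> 1"
    using t v by (auto simp: w_def vec_l2_norm_smult t_def[symmetric] norm_divide)
  define B where "B = (\<Sum>i<k. \<Sum>j<k. cmod (A $$ (i, j)))"
  have B: "0 \<le> B" unfolding B_def by (intro sum_nonneg) auto
  have "vec_l2_norm (A *\<^sub>v w) \<le> mat_op_norm A"
    unfolding mat_op_norm_def
  proof (rule cSUP_upper)
    show "w \<in> {v \<in> carrier_vec (dim_col A). vec_l2_norm v \<le> 1}" using w A by auto
    have "vec_l2_norm (A *\<^sub>v x) \<le> B" if "x \<in> carrier_vec k" "vec_l2_norm x \<le> 1" for x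
    proof -
      have "vec_l2_norm (A *\<^sub>v x) \<le> B * vec_l2_norm x"
        unfolding B_def by (rule mat_vec_bound[OF A that(1)])
      also have "\<dots> \<le> B * 1" using B that by (intro mult_left_mono) auto
      finally show ?thesis by simp
    qed
    then show "bdd_above ((\<lambda>v. vec_l2_norm (A *\<^sub>v v)) ` {v \<in> carrier_vec (dim_col A). vec_l2_norm v \<le> 1})"
      using A by (intro bdd_aboveI[of _ B]) auto
  qed
  also have "A *\<^sub>v w = complex_of_real (1 / t) \<cdot>\<^sub>v (A *\<^sub>v v)"
    unfolding w_def using A v by (intro mult_mat_vec) auto
  finally show ?thesis
    using t by (simp add: vec_l2_norm_smult norm_divide t_def[symmetric] divide_le_eq)
qed

lemma mat_op_norm_least:
  assumes A: "A \<in> carrier_mat k k" and B: "0 \<le> B"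
    and bound: "\<And>v. v \<in> carrier_vec k \<Longrightarrow> vec_l2_norm (A *\<^sub>v v) \<le> B * vec_l2_norm v"
  shows "mat_op_norm A \<le> B"
  unfolding mat_op_norm_def
proof (rule cSUP_least)
  show "{v \<in> carrier_vec (dim_col A). vec_l2_norm v \<le> 1} \<noteq> {}"
    using vec_l2_norm_zero[of k] A by (auto intro!: exI[of _ "0\<^sub>v k"])
  fix v assume v: "v \<in> {v \<in> carrier_vec (dim_col A). vec_l2_norm v \<le> 1}"
  then have "vec_l2_norm (A *\<^sub>v v) \<le> B * vec_l2_norm v" using bound A by auto
  also have "\<dots> \<le> B * 1" using v B by (intro mult_left_mono) auto
  finally show "vec_l2_norm (A *\<^sub>v v) \<le> B" by simp
qed

text \<open>The product of the matrices \<open>A - u\<close>, applied to a vector.\<close>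

fun ann :: "complex mat \<Rightarrow> complex list \<Rightarrow> complex Matrix.vec \<Rightarrow> complex Matrix.vec" where
  "ann A [] v = v"
| "ann A (u # us) v = ann A us (A *\<^sub>v v + (- u) \<cdot>\<^sub>v v)"

text \<open>Each factor removes the last coordinate that may still be nonzero.\<close>

lemma ann_upper_triangular:
  assumes B: "B \<in> carrier_mat k k" "upper_triangular B" and m: "m \<le> k"
    and w: "w \<in> carrier_vec k" "\<And>i. m \<le> i \<Longrightarrow> i < k \<Longrightarrow> vec_index w i = 0"
  shows "ann B (rev (take m (diag_mat B))) w = 0\<^sub>v k"
  using m w
proof (induction m arbitrary: w)
  case 0
  then show ?case by (intro eq_vecI) auto
next
  case (Suc m)
  define e where "e = B $$ (m, m)"
  define w' where "w' = B *\<^sub>v w + (- e) \<cdot>\<^sub>v w"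
  have take: "take (Suc m) (diag_mat B) = take m (diag_mat B) @ [e]"
    using Suc.prems(1) B(1) by (subst take_Suc_conv_app_nth) (auto simp: diag_mat_def e_def)
  have w': "w' \<in> carrier_vec k" using B Suc.prems by (auto simp: w'_def)
  have "vec_index w' i = 0" if i: "m \<le> i" "i < k" for i
  proof -
    have "vec_index w' i = (\<Sum>j<k. B $$ (i, j) * vec_index w j) - e * vec_index w i"
      using B(1) Suc.prems i by (auto simp: w'_def scalar_prod_def lessThan_atLeast0 intro!: sum.cong)
    also have "(\<Sum>j<k. B $$ (i, j) * vec_index w j) = (\<Sum>j<k. if j = i then e * vec_index w i else 0)"
    proof (intro sum.cong refl)
      fix j assume j: "j \<in> {..<k}"
      consider "j < i" | "j = i" "i = m" | "j = i" "m < i" | "i < j" using i by linarith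
      then show "B $$ (i, j) * vec_index w j = (if j = i then e * vec_index w i else 0)"
      proof cases
        case 1
        then show ?thesis using B i by (auto simp: upper_triangular_def)
      qed (use Suc.prems i j in \<open>auto simp: e_def\<close>)
    qed
    also have "\<dots> = e * vec_index w i" using i by simp
    finally show ?thesis by simp
  qed
  then have "ann B (rev (take m (diag_mat B))) w' = 0\<^sub>v k"
    using Suc.prems(1) w' by (intro Suc.IH) auto
  then show ?case by (simp add: take w'_def)
qed

lemma ann_similar:
  assumes A: "A \<in> carrier_mat k k" and B: "B \<in> carrier_mat k k" and P: "P \<in> carrier_mat k k"
    and AP: "A * P = P * B" and w: "w \<in> carrier_vec k"
  shows "ann A us (P *\<^sub>v w) = P *\<^sub>v ann B us w"
  using w
proof (induction us arbitrary: w)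
  case (Cons u us)
  have "A *\<^sub>v (P *\<^sub>v w) = P *\<^sub>v (B *\<^sub>v w)"
    using A B P AP Cons.prems by (metis assoc_mult_mat_vec)
  then have "A *\<^sub>v (P *\<^sub>v w) + (- u) \<cdot>\<^sub>v (P *\<^sub>v w) = P *\<^sub>v (B *\<^sub>v w + (- u) \<cdot>\<^sub>v w)"
    using B P Cons.prems by (subst mult_add_distrib_mat_vec) (auto simp: mult_mat_vec)
  then show ?case using Cons B by auto
qed simp

text \<open>The Cayley--Hamilton theorem, read off from the Schur form.\<close>

lemma annihilating_eigenvalues:
  assumes A: "A \<in> carrier_mat k k"
  obtains us where "length us = k" "\<And>v. v \<in> carrier_vec k \<Longrightarrow> ann A us v = 0\<^sub>v k"
    "\<And>u. u \<in> set us \<Longrightarrow> \<exists>v \<in> carrier_vec k. v \<noteq> 0\<^sub>v k \<and> A *\<^sub>v v = u \<cdot>\<^sub>v v"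
proof -
  obtain es where es: "char_poly A = (\<Prod>a\<leftarrow>es. [:- a, 1:])" "length es = k"
    using char_poly_factorized[OF A] by blast
  obtain B P Q where schur: "schur_decomposition A es = (B, P, Q)" by (metis prod_cases3)
  have sim: "similar_mat_wit A B P Q" and tri: "upper_triangular B" and diag: "diag_mat B = es"
    using schur_decomposition[OF A es(1) schur] by auto
  have B: "B \<in> carrier_mat k k" and P: "P \<in> carrier_mat k k" and Q: "Q \<in> carrier_mat k k"
    and PQ: "P * Q = 1\<^sub>m k" and QP: "Q * P = 1\<^sub>m k" and APBQ: "A = P * B * Q"
    using similar_mat_witD2[OF A sim] by auto
  have AP: "A * P = P * B"
    unfolding APBQ using B P Q QP by (simp add: assoc_mult_mat[of _ k k _ k _ k])
  show thesis
  proof (rule that[of "rev es"])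
    show "length (rev es) = k" using es by simp
    fix v :: "complex Matrix.vec" assume v: "v \<in> carrier_vec k"
    have "v = P *\<^sub>v (Q *\<^sub>v v)"
      using P Q PQ v by (simp flip: assoc_mult_mat_vec[of P k k Q k v])
    also have "ann A (rev es) \<dots> = P *\<^sub>v ann B (rev (take k (diag_mat B))) (Q *\<^sub>v v)"
      using es diag Q v by (subst ann_similar[OF A B P AP]) auto
    also have "\<dots> = 0\<^sub>v k"
      using P Q v by (subst ann_upper_triangular[OF B tri]) auto
    finally show "ann A (rev es) v = 0\<^sub>v k" .
  next
    fix u assume "u \<in> set (rev es)"
    then have "poly (char_poly A) u = 0"
      unfolding es(1) by (auto simp: poly_prod_list prod_list_zero_iff)
    then show "\<exists>v \<in> carrier_vec k. v \<noteq> 0\<^sub>v k \<and> A *\<^sub>v v = u \<cdot>\<^sub>v v"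
      using eigenvalue_root_char_poly[OF A] A by (auto simp: eigenvalue_def eigenvector_def)
  qed
qed

lemma ann_eigenvector:
  assumes "A \<in> carrier_mat k k" "v \<in> carrier_vec k" "A *\<^sub>v v = u \<cdot>\<^sub>v v"
  shows "ann A us v = (\<Prod>x\<leftarrow>us. u - x) \<cdot>\<^sub>v v"
  using assms
proof (induction us arbitrary: v)
  case (Cons x us)
  define v' where "v' = A *\<^sub>v v + (- x) \<cdot>\<^sub>v v"
  have v': "v' = (u - x) \<cdot>\<^sub>v v"
    unfolding v'_def Cons.prems(3) using Cons.prems(2) by (intro eq_vecI) (auto simp: algebra_simps)
  have "ann A us v' = (\<Prod>x\<leftarrow>us. u - x) \<cdot>\<^sub>v v'"
  proof (rule Cons.IH)
    show "A *\<^sub>v v' = u \<cdot>\<^sub>v v'"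
      unfolding v' using Cons.prems by (simp add: mult_mat_vec smult_smult_assoc mult.commute)
  qed (use Cons.prems v' in auto)
  then show ?case unfolding v'_def[symmetric] ann.simps by (simp add: v' smult_smult_assoc mult.commute)
qed simp

lemma eigenvalue_in_annihilator:
  assumes "A \<in> carrier_mat k k" "v \<in> carrier_vec k" "v \<noteq> 0\<^sub>v k" "A *\<^sub>v v = u \<cdot>\<^sub>v v" "ann A us v = 0\<^sub>v k"
  shows "u \<in> set us"
proof (rule ccontr)
  assume "u \<notin> set us"
  then have "(\<Prod>x\<leftarrow>us. u - x) \<noteq> 0" by (auto simp: prod_list_zero_iff)
  moreover have "(\<Prod>x\<leftarrow>us. u - x) \<cdot>\<^sub>v v = 0\<^sub>v k"
    using ann_eigenvector[OF assms(1,2,4)] assms(5) by simp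
  ultimately have "vec_l2_norm v = 0"
    by (metis mult_eq_0_iff norm_eq_zero vec_l2_norm_smult vec_l2_norm_zero)
  then show False using vec_l2_norm_eq_0 assms by blast
qed

text \<open>The new eigenvector is a polynomial in \<open>A\<close> applied to \<open>v\<close>, hence remains an eigenvector of
  everything that commutes with \<open>A\<close>.\<close>

lemma common_eigenvector_step:
  assumes A: "A \<in> carrier_mat k k" and v: "v \<in> carrier_vec k" "v \<noteq> 0\<^sub>v k" and ann: "ann A us v = 0\<^sub>v k"
  shows "\<exists>w u. w \<in> carrier_vec k \<and> w \<noteq> 0\<^sub>v k \<and> A *\<^sub>v w = u \<cdot>\<^sub>v w \<and>
    (\<forall>B \<in> carrier_mat k k. \<forall>c. A * B = B * A \<longrightarrow> B *\<^sub>v v = c \<cdot>\<^sub>v v \<longrightarrow> B *\<^sub>v w = c \<cdot>\<^sub>v w)"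
  using v ann
proof (induction us arbitrary: v)
  case (Cons x us)
  define v' where "v' = A *\<^sub>v v + (- x) \<cdot>\<^sub>v v"
  have v': "v' \<in> carrier_vec k" using A Cons.prems by (auto simp: v'_def)
  have inherit: "B *\<^sub>v v' = c \<cdot>\<^sub>v v'"
    if B: "B \<in> carrier_mat k k" and comm: "A * B = B * A" and ev: "B *\<^sub>v v = c \<cdot>\<^sub>v v" for B c
  proof -
    have "B *\<^sub>v (A *\<^sub>v v) = A *\<^sub>v (B *\<^sub>v v)"
      using A B comm Cons.prems(1) by (metis assoc_mult_mat_vec)
    also have "\<dots> = c \<cdot>\<^sub>v (A *\<^sub>v v)"
      unfolding ev using A Cons.prems(1) by (rule mult_mat_vec)
    finally have BA: "B *\<^sub>v (A *\<^sub>v v) = c \<cdot>\<^sub>v (A *\<^sub>v v)" .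
    have "B *\<^sub>v v' = B *\<^sub>v (A *\<^sub>v v) + (- x) \<cdot>\<^sub>v (B *\<^sub>v v)"
      unfolding v'_def using A B Cons.prems(1)
      by (subst mult_add_distrib_mat_vec[OF B]) (auto simp: mult_mat_vec)
    also have "\<dots> = c \<cdot>\<^sub>v v'"
      unfolding BA ev v'_def using A Cons.prems(1) by (intro eq_vecI) (auto simp: algebra_simps)
    finally show ?thesis .
  qed
  show ?case
  proof (cases "v' = 0\<^sub>v k")
    case True
    have "A *\<^sub>v v = x \<cdot>\<^sub>v v"
    proof (rule eq_vecI)
      fix i assume i: "i < dim_vec (x \<cdot>\<^sub>v v)"
      have "vec_index v' i = vec_index (A *\<^sub>v v) i - x * vec_index v i"
        unfolding v'_def using A Cons.prems(1) i by auto
      then show "vec_index (A *\<^sub>v v) i = vec_index (x \<cdot>\<^sub>v v) i"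
        using True Cons.prems(1) i by auto
    qed (use A Cons.prems in auto)
    then show ?thesis using Cons.prems by blast
  next
    case False
    have "ann A us v' = 0\<^sub>v k" using Cons.prems(3) by (simp add: v'_def)
    then obtain w u where "w \<in> carrier_vec k" "w \<noteq> 0\<^sub>v k" "A *\<^sub>v w = u \<cdot>\<^sub>v w"
      "\<forall>B \<in> carrier_mat k k. \<forall>c. A * B = B * A \<longrightarrow> B *\<^sub>v v' = c \<cdot>\<^sub>v v' \<longrightarrow> B *\<^sub>v w = c \<cdot>\<^sub>v w"
      using Cons.IH[OF v' False] by blast
    then show ?thesis using inherit by blast
  qed
qed simp

section \<open>Finite-dimensional representations see only the joint spectrum\<close>

text \<open>The sum is at most its number of terms times its largest term.\<close>

lemma sum_power_le:
  fixes y :: "'i \<Rightarrow> real"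
  assumes "finite A" "\<And>i. i \<in> A \<Longrightarrow> 0 \<le> y i" "0 < p"
  shows "(\<Sum>i\<in>A. y i) ^ p \<le> real (card A) ^ p * (\<Sum>i\<in>A. y i ^ p)"
proof (cases "A = {}")
  case True
  then show ?thesis using assms(3) by (simp add: power_0_left)
next
  case False
  define m where "m = Max (y ` A)"
  have "m \<in> y ` A"
    unfolding m_def using assms(1) False by (intro Max_in) auto
  then obtain j where j: "j \<in> A" "m = y j" by auto
  have "(\<Sum>i\<in>A. y i) \<le> (\<Sum>i\<in>A. m)"
    unfolding m_def using assms(1) by (intro sum_mono) simp
  then have "(\<Sum>i\<in>A. y i) ^ p \<le> (real (card A) * m) ^ p"
    using assms(2) by (intro power_mono) (auto intro: sum_nonneg)
  also have "\<dots> = real (card A) ^ p * y j ^ p" by (simp add: power_mult_distrib j(2))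
  also have "\<dots> \<le> real (card A) ^ p * (\<Sum>i\<in>A. y i ^ p)"
    using assms j by (intro mult_left_mono member_le_sum) auto
  finally show ?thesis .
qed

lemma small_factor: "0 < s \<Longrightarrow> s < 1 \<Longrightarrow> cmod u \<le> 1 \<Longrightarrow> cmod (complex_of_real s * u) < 1"
proof -
  assume "0 < s" "s < 1" "cmod u \<le> 1"
  then have "s * cmod u \<le> s * 1" by (intro mult_left_mono) auto
  then have "s * cmod u < 1" using \<open>s < 1\<close> by linarith
  then show ?thesis using \<open>0 < s\<close> by (simp add: norm_mult)
qed

text \<open>The closure properties and the functions that both algebras share.\<close>

locale D_algebra = D_space a H ip
  for a :: real and H :: "(complex ^ 'd \<Rightarrow> complex) set" and ip +
  fixes \<C> :: "(complex ^ 'd \<Rightarrow> complex) set"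
  assumes sub: "\<C> \<subseteq> mults"
    and const_C: "on_ball (\<lambda>z. c) \<in> \<C>"
    and add_C: "f \<in> \<C> \<Longrightarrow> g \<in> \<C> \<Longrightarrow> (\<lambda>z. f z + g z) \<in> \<C>"
    and mult_C: "f \<in> \<C> \<Longrightarrow> g \<in> \<C> \<Longrightarrow> (\<lambda>z. f z * g z) \<in> \<C>"
    and scale_C: "f \<in> \<C> \<Longrightarrow> (\<lambda>z. c * f z) \<in> \<C>"
    and hermitian_C: "norm \<zeta> = 1 \<Longrightarrow> on_ball (\<lambda>z. hermitian z \<zeta>) \<in> \<C>"
    and cauchy_C: "norm \<zeta> = 1 \<Longrightarrow> cmod c < 1 \<Longrightarrow> cauchy c \<zeta> \<in> \<C>"
begin

lemma power_C: "on_ball f \<in> \<C> \<Longrightarrow> on_ball (\<lambda>z. f z ^ n) \<in> \<C>"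
proof (induction n)
  case (Suc n)
  then show ?case using mult_C[of "on_ball f" "on_ball (\<lambda>z. f z ^ n)"] by (simp add: on_ball_mult)
qed (simp add: const_C)

lemma sum_C: "(\<And>i. i \<in> I \<Longrightarrow> on_ball (f i) \<in> \<C>) \<Longrightarrow> on_ball (\<lambda>z. \<Sum>i\<in>I. f i z) \<in> \<C>"
proof (induction I rule: infinite_finite_induct)
  case (insert i I)
  then show ?case
    using add_C[of "on_ball (f i)" "on_ball (\<lambda>z. \<Sum>i\<in>I. f i z)"] by (simp add: on_ball_add)
qed (auto simp: const_C)

text \<open>Powers of Cauchy kernels; with \<open>r = 1 - t\<close> each base has size about \<open>1\<close> at \<open>r \<zeta>\<close>.\<close>

definition test_function :: "'i set \<Rightarrow> ('i \<Rightarrow> complex) \<Rightarrow> ('i \<Rightarrow> complex ^ 'd) \<Rightarrow> real \<Rightarrow> real \<Rightarrow> nat \<Rightarrow> complex ^ 'd \<Rightarrow> complex" where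
  "test_function I e \<zeta> t r p =
     on_ball (\<lambda>z. \<Sum>i\<in>I. e i * (of_real t / (1 - of_real r * hermitian z (\<zeta> i))) ^ p)"

lemma kernel_function_C:
  assumes "norm \<zeta> = 1" "0 < r" "r < 1"
  shows "on_ball (\<lambda>z. of_real t / (1 - of_real r * hermitian z \<zeta>)) \<in> \<C>"
proof -
  have "on_ball (\<lambda>z. of_real t / (1 - of_real r * hermitian z \<zeta>)) = (\<lambda>z. of_real t * cauchy (of_real r) \<zeta> z)"
    unfolding cauchy_def on_ball_scale by simp
  then show ?thesis using scale_C[OF cauchy_C[OF assms(1), of "of_real r"]] assms by simp
qed

lemma test_function_C:
  assumes "\<And>i. i \<in> I \<Longrightarrow> norm (\<zeta> i) = 1" "0 < r" "r < 1"
  shows "test_function I e \<zeta> t r p \<in> \<C>"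
  unfolding test_function_def
proof (rule sum_C)
  fix i assume "i \<in> I"
  then have "on_ball (\<lambda>z. (of_real t / (1 - of_real r * hermitian z (\<zeta> i))) ^ p) \<in> \<C>"
    using assms by (intro power_C kernel_function_C)
  from scale_C[OF this, of "e i"]
  show "on_ball (\<lambda>z. e i * (of_real t / (1 - of_real r * hermitian z (\<zeta> i))) ^ p) \<in> \<C>"
    by (simp add: on_ball_scale)
qed

end

locale D_rep = D_algebra a H ip \<C>
  for a :: real and H :: "(complex ^ 'd \<Rightarrow> complex) set" and ip and \<C> +
  fixes \<pi> :: "(complex ^ 'd \<Rightarrow> complex) \<Rightarrow> complex mat" and k :: nat and C :: real
  assumes pi_carrier: "f \<in> \<C> \<Longrightarrow> \<pi> f \<in> carrier_mat k k"
    and pi_add: "f \<in> \<C> \<Longrightarrow> g \<in> \<C> \<Longrightarrow> \<pi> (\<lambda>z. f z + g z) = \<pi> f + \<pi> g"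
    and pi_mult: "f \<in> \<C> \<Longrightarrow> g \<in> \<C> \<Longrightarrow> \<pi> (\<lambda>z. f z * g z) = \<pi> f * \<pi> g"
    and pi_scale: "f \<in> \<C> \<Longrightarrow> \<pi> (\<lambda>z. c * f z) = c \<cdot>\<^sub>m \<pi> f"
    and pi_one: "\<pi> (on_ball (\<lambda>z. 1)) = 1\<^sub>m k"
    and C_nonneg: "0 \<le> C"
    and pi_bound: "f \<in> \<C> \<Longrightarrow> mat_op_norm (\<pi> f) \<le> C * mnorm f"
begin

definition act :: "(complex ^ 'd \<Rightarrow> complex) \<Rightarrow> complex Matrix.vec \<Rightarrow> complex Matrix.vec" where
  "act f v = \<pi> f *\<^sub>v v"

abbreviation V :: "complex Matrix.vec set" where
  "V \<equiv> carrier_vec k"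

lemma act_V [simp]: "f \<in> \<C> \<Longrightarrow> v \<in> V \<Longrightarrow> act f v \<in> V"
  using pi_carrier[of f] by (auto simp: act_def)

lemma act_mult: "f \<in> \<C> \<Longrightarrow> g \<in> \<C> \<Longrightarrow> v \<in> V \<Longrightarrow> act (\<lambda>z. f z * g z) v = act f (act g v)"
  unfolding act_def pi_mult by (rule assoc_mult_mat_vec[OF pi_carrier pi_carrier])

lemma act_add: "f \<in> \<C> \<Longrightarrow> g \<in> \<C> \<Longrightarrow> v \<in> V \<Longrightarrow> act (\<lambda>z. f z + g z) v = act f v + act g v"
  unfolding act_def pi_add by (rule add_mult_distrib_mat_vec[OF pi_carrier pi_carrier])

lemma act_scale: "f \<in> \<C> \<Longrightarrow> v \<in> V \<Longrightarrow> act (\<lambda>z. c * f z) v = c \<cdot>\<^sub>v act f v"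
  unfolding act_def pi_scale using pi_carrier[of f] by (intro eq_vecI) (auto simp: smult_scalar_prod_distrib)

lemma act_one: "v \<in> V \<Longrightarrow> act (on_ball (\<lambda>z. 1)) v = v"
  by (simp add: act_def pi_one)

lemma act_vec_scale: "f \<in> \<C> \<Longrightarrow> v \<in> V \<Longrightarrow> act f (c \<cdot>\<^sub>v v) = c \<cdot>\<^sub>v act f v"
  unfolding act_def by (rule mult_mat_vec[OF pi_carrier])

lemma act_bound: "f \<in> \<C> \<Longrightarrow> v \<in> V \<Longrightarrow> vec_l2_norm (act f v) \<le> C * mnorm f * vec_l2_norm v"
  unfolding act_def
  using mat_op_norm_bound[OF pi_carrier, of f v] mult_right_mono[OF pi_bound vec_l2_norm_nonneg, of f v]
  by linarith

lemma pi_commute: "f \<in> \<C> \<Longrightarrow> g \<in> \<C> \<Longrightarrow> \<pi> f * \<pi> g = \<pi> g * \<pi> f"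
  using pi_mult[of f g] pi_mult[of g f] by (simp add: mult.commute)

lemma act_zero: "v \<in> V \<Longrightarrow> act (on_ball (\<lambda>z. 0)) v = 0\<^sub>v k"
  using act_scale[OF const_C[of 1], of v 0] by (simp add: on_ball_scale act_one) auto

lemma act_sum_bound:
  assumes "\<And>i. i \<in> I \<Longrightarrow> on_ball (f i) \<in> \<C>" "v \<in> V"
    and "\<And>i. i \<in> I \<Longrightarrow> vec_l2_norm (act (on_ball (f i)) v) \<le> B i"
  shows "vec_l2_norm (act (on_ball (\<lambda>z. \<Sum>i\<in>I. f i z)) v) \<le> (\<Sum>i\<in>I. B i)"
  using assms
proof (induction I rule: infinite_finite_induct)
  case (insert i I)
  have C: "on_ball (\<lambda>z. \<Sum>i\<in>I. f i z) \<in> \<C>"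
    by (rule sum_C) (use insert.prems in auto)
  have Ci: "on_ball (f i) \<in> \<C>" using insert.prems by auto
  have "act (on_ball (\<lambda>z. \<Sum>i\<in>insert i I. f i z)) v =
      act (on_ball (f i)) v + act (on_ball (\<lambda>z. \<Sum>i\<in>I. f i z)) v"
    using act_add[OF Ci C insert.prems(2)] insert.hyps by (simp add: on_ball_add)
  also have "vec_l2_norm \<dots> \<le> vec_l2_norm (act (on_ball (f i)) v) + vec_l2_norm (act (on_ball (\<lambda>z. \<Sum>i\<in>I. f i z)) v)"
    using C Ci insert.prems by (intro vec_l2_norm_add[of _ k]) auto
  also have "vec_l2_norm (act (on_ball (f i)) v) \<le> B i" using insert.prems by auto
  also have "vec_l2_norm (act (on_ball (\<lambda>z. \<Sum>i\<in>I. f i z)) v) \<le> (\<Sum>i\<in>I. B i)"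
    using insert.prems by (intro insert.IH) auto
  finally show ?case using insert.hyps by simp
qed (auto simp: act_zero vec_l2_norm_zero)

lemma act_power_bound:
  assumes f: "on_ball f \<in> \<C>" and B: "0 \<le> B" "\<And>v. v \<in> V \<Longrightarrow> vec_l2_norm (act (on_ball f) v) \<le> B * vec_l2_norm v"
    and v: "v \<in> V"
  shows "vec_l2_norm (act (on_ball (\<lambda>z. f z ^ n)) v) \<le> B ^ n * vec_l2_norm v"
  using v
proof (induction n)
  case (Suc n)
  have "act (on_ball (\<lambda>z. f z ^ Suc n)) v = act (on_ball f) (act (on_ball (\<lambda>z. f z ^ n)) v)"
    using act_mult[OF f power_C[OF f, of n] Suc.prems] by (simp add: on_ball_mult)
  also have "vec_l2_norm \<dots> \<le> B * vec_l2_norm (act (on_ball (\<lambda>z. f z ^ n)) v)"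
    using f power_C Suc.prems by (intro B(2)) auto
  also have "\<dots> \<le> B * (B ^ n * vec_l2_norm v)"
    using Suc B(1) by (intro mult_left_mono) auto
  finally show ?case by (simp add: mult.assoc)
qed (simp add: act_one)

definition S :: "complex ^ 'd \<Rightarrow> complex mat" where
  "S \<zeta> = \<pi> (on_ball (\<lambda>z. hermitian z \<zeta>))"

lemma S_carrier: "norm \<zeta> = 1 \<Longrightarrow> S \<zeta> \<in> carrier_mat k k"
  unfolding S_def by (rule pi_carrier[OF hermitian_C])

text \<open>The powers of \<open>S \<zeta>\<close> have norm \<open>O(\<surd>n)\<close>, so no eigenvalue can lie outside the closed unit disc.\<close>

lemma eigenvalue_bound:
  assumes \<zeta>: "norm \<zeta> = 1" and v: "v \<in> V" "v \<noteq> 0\<^sub>v k" and ev: "S \<zeta> *\<^sub>v v = u \<cdot>\<^sub>v v"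
  shows "cmod u \<le> 1"
proof (rule ccontr)
  assume "\<not> cmod u \<le> 1"
  then have u: "1 < cmod u" by simp
  have vpos: "0 < vec_l2_norm v"
    using v vec_l2_norm_eq_0[of v k] vec_l2_norm_nonneg[of v] by (cases "vec_l2_norm v = 0") auto
  have pow: "act (on_ball (\<lambda>z. hermitian z \<zeta> ^ n)) v = u ^ n \<cdot>\<^sub>v v" for n
  proof (induction n)
    case (Suc n)
    have "act (on_ball (\<lambda>z. hermitian z \<zeta> ^ Suc n)) v =
        act (on_ball (\<lambda>z. hermitian z \<zeta>)) (act (on_ball (\<lambda>z. hermitian z \<zeta> ^ n)) v)"
      using act_mult[OF hermitian_C[OF \<zeta>] power_C[OF hermitian_C[OF \<zeta>], of n] v(1)]
      by (simp add: on_ball_mult)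
    also have "\<dots> = u ^ n \<cdot>\<^sub>v (u \<cdot>\<^sub>v v)"
      unfolding Suc using act_vec_scale[OF hermitian_C[OF \<zeta>] v(1)] ev by (simp add: act_def S_def)
    finally show ?case by (simp add: smult_smult_assoc mult.commute)
  qed (use v in \<open>simp add: act_one\<close>)
  define x where "x = 1 / cmod u"
  have x: "0 < x" "x < 1" using u by (auto simp: x_def divide_less_eq)
  have "1 \<le> C * M * (real n * x ^ n + x ^ n)" for n
  proof -
    have "cmod u ^ n * vec_l2_norm v \<le> C * mnorm (on_ball (\<lambda>z. hermitian z \<zeta> ^ n)) * vec_l2_norm v"
      using act_bound[OF power_C[OF hermitian_C[OF \<zeta>], of n] v(1)]
      unfolding pow vec_l2_norm_smult by (simp add: norm_power)
    then have "cmod u ^ n \<le> C * mnorm (on_ball (\<lambda>z. hermitian z \<zeta> ^ n))"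
      using vpos by simp
    also have "\<dots> \<le> C * (real (n + 1) * M)"
    proof (rule mult_left_mono[OF _ C_nonneg])
      have "1 * 1 \<le> real (n + 1) * M" using M_ge_1 by (intro mult_mono) auto
      then have "sqrt (real (n + 1) * M) \<le> real (n + 1) * M"
        by (intro real_le_lsqrt) (auto simp: power2_eq_square mult_le_cancel_left1)
      then show "mnorm (on_ball (\<lambda>z. hermitian z \<zeta> ^ n)) \<le> real (n + 1) * M"
        using hermitian_power_mults(2)[OF \<zeta>, of n] by linarith
    qed
    finally have "cmod u ^ n * x ^ n \<le> C * (real (n + 1) * M) * x ^ n"
      using x by (intro mult_right_mono) auto
    moreover have "cmod u ^ n * x ^ n = 1"
    proof -
      have "cmod u \<noteq> 0" using u by linarith
      then have "cmod u * x = 1" by (simp add: x_def)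
      then show ?thesis by (metis power_mult_distrib power_one)
    qed
    ultimately show ?thesis by (simp add: algebra_simps)
  qed
  moreover have "(\<lambda>n. C * M * (real n * x ^ n + x ^ n)) \<longlonglongrightarrow> C * M * (0 + 0)"
    using x powser_times_n_limit_0[of x] by (intro tendsto_intros LIMSEQ_power_zero) auto
  ultimately have "1 \<le> C * M * (0 + 0)"
    by (intro LIMSEQ_le_const) auto
  then show False by simp
qed

lemma hermitian_axis: "hermitian z (axis i 1) = z $ i"
proof -
  have "hermitian z (axis i 1) = (\<Sum>j\<in>UNIV. if j = i then z $ i else 0)"
    unfolding hermitian_def by (intro sum.cong refl) (auto simp: axis_def)
  then show ?thesis by simp
qed

lemma coord_C: "on_ball (\<lambda>z. z $ i) \<in> \<C>"
  using hermitian_C[of "axis i 1"] by (simp add: hermitian_axis)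

definition joint_spectrum :: "(complex ^ 'd) set" where
  "joint_spectrum = {\<mu>. \<exists>v \<in> V. v \<noteq> 0\<^sub>v k \<and> (\<forall>i. act (on_ball (\<lambda>z. z $ i)) v = \<mu> $ i \<cdot>\<^sub>v v)}"

lemma joint_eigenvector:
  assumes v: "v \<in> V" and ev: "\<And>i. act (on_ball (\<lambda>z. z $ i)) v = \<mu> $ i \<cdot>\<^sub>v v"
  shows "act (on_ball (\<lambda>z. hermitian z \<zeta>)) v = hermitian \<mu> \<zeta> \<cdot>\<^sub>v v"
proof -
  have term_C: "on_ball (\<lambda>z. z $ i * cnj (\<zeta> $ i)) \<in> \<C>" for i
    using scale_C[OF coord_C, of "cnj (\<zeta> $ i)" i] by (simp add: on_ball_scale mult.commute)
  have "act (on_ball (\<lambda>z. \<Sum>i\<in>J. z $ i * cnj (\<zeta> $ i))) v = (\<Sum>i\<in>J. \<mu> $ i * cnj (\<zeta> $ i)) \<cdot>\<^sub>v v"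
    if "finite J" for J
    using that
  proof (induction J rule: finite_induct)
    case empty
    then show ?case using v by (simp add: act_zero) auto
  next
    case (insert i J)
    have "act (on_ball (\<lambda>z. z $ i * cnj (\<zeta> $ i))) v = (\<mu> $ i * cnj (\<zeta> $ i)) \<cdot>\<^sub>v v"
      using act_scale[OF coord_C v, of "cnj (\<zeta> $ i)" i] ev[of i]
      by (simp add: on_ball_scale mult.commute smult_smult_assoc)
    moreover have "on_ball (\<lambda>z. \<Sum>i\<in>J. z $ i * cnj (\<zeta> $ i)) \<in> \<C>" by (rule sum_C[OF term_C])
    ultimately show ?case
      using act_add[OF term_C _ v, of "on_ball (\<lambda>z. \<Sum>i\<in>J. z $ i * cnj (\<zeta> $ i))" i] insert v
      by (simp add: on_ball_add add_smult_distrib_vec)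
  qed
  then show ?thesis by (simp add: hermitian_def)
qed

text \<open>In the direction \<open>\<zeta> = \<mu> / |\<mu>|\<close> the number \<open>\<langle>\<mu>, \<zeta>\<rangle> = |\<mu>|\<close> is an eigenvalue.\<close>

lemma joint_spectrum_in_ball:
  assumes "\<mu> \<in> joint_spectrum"
  shows "norm \<mu> \<le> 1"
proof (cases "\<mu> = 0")
  case False
  obtain v where v: "v \<in> V" "v \<noteq> 0\<^sub>v k" and ev: "\<And>i. act (on_ball (\<lambda>z. z $ i)) v = \<mu> $ i \<cdot>\<^sub>v v"
    using assms unfolding joint_spectrum_def by blast
  define \<zeta> where "\<zeta> = (1 / norm \<mu>) *\<^sub>R \<mu>"
  have \<zeta>: "norm \<zeta> = 1" using False by (simp add: \<zeta>_def)
  have "hermitian \<mu> \<zeta> = complex_of_real (1 / norm \<mu>) * hermitian \<mu> \<mu>"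
    unfolding hermitian_def \<zeta>_def sum_distrib_left by (intro sum.cong refl) (simp only: vector_scaleR_component, simp add: scaleR_conv_of_real)
  also have "\<dots> = complex_of_real (norm \<mu>)"
    using False by (simp add: hermitian_self power2_eq_square)
  finally have h: "hermitian \<mu> \<zeta> = complex_of_real (norm \<mu>)" .
  have "S \<zeta> *\<^sub>v v = hermitian \<mu> \<zeta> \<cdot>\<^sub>v v"
    using joint_eigenvector[OF v(1) ev, of \<zeta>] by (simp add: act_def S_def)
  then have "cmod (hermitian \<mu> \<zeta>) \<le> 1" by (rule eigenvalue_bound[OF \<zeta> v])
  then show ?thesis by (simp add: h)
qed simp

text \<open>Starting from an eigenvector of \<open>S \<zeta>\<close>, the coordinates are diagonalised on it one after another.\<close>

lemma eigenvalue_from_joint_spectrum: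
  assumes \<zeta>: "norm \<zeta> = 1" and v: "v \<in> V" "v \<noteq> 0\<^sub>v k" and ev: "S \<zeta> *\<^sub>v v = u \<cdot>\<^sub>v v"
  shows "\<exists>\<mu> \<in> joint_spectrum. u = hermitian \<mu> \<zeta>"
proof -
  have "\<exists>w \<in> V. w \<noteq> 0\<^sub>v k \<and> S \<zeta> *\<^sub>v w = u \<cdot>\<^sub>v w \<and> (\<forall>i\<in>J. \<exists>c. act (on_ball (\<lambda>z. z $ i)) w = c \<cdot>\<^sub>v w)"
    if "finite J" for J
    using that
  proof (induction J rule: finite_induct)
    case empty
    then show ?case using v ev by auto
  next
    case (insert i J)
    then obtain w where w: "w \<in> V" "w \<noteq> 0\<^sub>v k" "S \<zeta> *\<^sub>v w = u \<cdot>\<^sub>v w"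
      "\<forall>i\<in>J. \<exists>c. act (on_ball (\<lambda>z. z $ i)) w = c \<cdot>\<^sub>v w" by blast
    let ?T = "\<pi> (on_ball (\<lambda>z. z $ i))"
    have T: "?T \<in> carrier_mat k k" by (rule pi_carrier[OF coord_C])
    obtain us where "ann ?T us w = 0\<^sub>v k" using annihilating_eigenvalues[OF T] w(1) by metis
    from common_eigenvector_step[OF T w(1,2) this]
    obtain w' u' where w': "w' \<in> V" "w' \<noteq> 0\<^sub>v k" "?T *\<^sub>v w' = u' \<cdot>\<^sub>v w'"
      and inherit: "\<And>B c. B \<in> carrier_mat k k \<Longrightarrow> ?T * B = B * ?T \<Longrightarrow> B *\<^sub>v w = c \<cdot>\<^sub>v w \<Longrightarrow> B *\<^sub>v w' = c \<cdot>\<^sub>v w'"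
      by metis
    have "S \<zeta> *\<^sub>v w' = u \<cdot>\<^sub>v w'"
      using pi_commute[OF coord_C hermitian_C[OF \<zeta>], of i]
      by (intro inherit S_carrier[OF \<zeta>] w(3)) (simp add: S_def)
    moreover have "\<exists>c. act (on_ball (\<lambda>z. z $ j)) w' = c \<cdot>\<^sub>v w'" if j: "j \<in> insert i J" for j
    proof (cases "j = i")
      case True
      then show ?thesis using w'(3) by (auto simp: act_def)
    next
      case False
      then obtain c where "\<pi> (on_ball (\<lambda>z. z $ j)) *\<^sub>v w = c \<cdot>\<^sub>v w"
        using w(4) j by (auto simp: act_def)
      then have "\<pi> (on_ball (\<lambda>z. z $ j)) *\<^sub>v w' = c \<cdot>\<^sub>v w'"
        by (intro inherit pi_carrier[OF coord_C] pi_commute[OF coord_C coord_C])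
      then show ?thesis by (auto simp: act_def)
    qed
    ultimately show ?case using w' by blast
  qed
  from this[OF finite_class.finite_UNIV]
  obtain w where w: "w \<in> V" "w \<noteq> 0\<^sub>v k" "S \<zeta> *\<^sub>v w = u \<cdot>\<^sub>v w"
    "\<forall>i. \<exists>c. act (on_ball (\<lambda>z. z $ i)) w = c \<cdot>\<^sub>v w" by auto
  then obtain c where c: "\<And>i. act (on_ball (\<lambda>z. z $ i)) w = c i \<cdot>\<^sub>v w" by metis
  define \<mu> where "\<mu> = (\<chi> i. c i)"
  have ev': "act (on_ball (\<lambda>z. z $ i)) w = \<mu> $ i \<cdot>\<^sub>v w" for i by (simp add: \<mu>_def c)
  have "\<mu> \<in> joint_spectrum" unfolding joint_spectrum_def using w ev' by blast
  moreover have "u = hermitian \<mu> \<zeta>"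
  proof -
    have eq: "u \<cdot>\<^sub>v w = hermitian \<mu> \<zeta> \<cdot>\<^sub>v w"
      using joint_eigenvector[OF w(1) ev', of \<zeta>] w(3) by (simp add: act_def S_def)
    have "vec_l2_norm ((u - hermitian \<mu> \<zeta>) \<cdot>\<^sub>v w) = 0"
    proof -
      have "(u - hermitian \<mu> \<zeta>) \<cdot>\<^sub>v w = u \<cdot>\<^sub>v w + (- hermitian \<mu> \<zeta>) \<cdot>\<^sub>v w"
        by (intro eq_vecI) (auto simp: algebra_simps)
      also have "\<dots> = 0\<^sub>v k" unfolding eq using w(1) by (intro eq_vecI) auto
      finally show ?thesis by (simp add: vec_l2_norm_zero)
    qed
    then have "cmod (u - hermitian \<mu> \<zeta>) * vec_l2_norm w = 0" by (simp add: vec_l2_norm_smult)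
    then show ?thesis using vec_l2_norm_eq_0[OF w(1)] w(2) by auto
  qed
  ultimately show ?thesis by blast
qed

text \<open>Every component of a joint eigenvalue is one of the \<open>k\<close> eigenvalues of that coordinate.\<close>

lemma joint_spectrum_finite: "finite joint_spectrum" "card joint_spectrum \<le> k ^ CARD('d)"
proof -
  have "\<forall>i. \<exists>us. length us = k \<and> (\<forall>v\<in>V. ann (\<pi> (on_ball (\<lambda>z. z $ i))) us v = 0\<^sub>v k)"
    using annihilating_eigenvalues[OF pi_carrier[OF coord_C]] by metis
  then obtain us where us: "\<And>i. length (us i) = k"
    "\<And>i v. v \<in> V \<Longrightarrow> ann (\<pi> (on_ball (\<lambda>z. z $ i))) (us i) v = 0\<^sub>v k" by metis
  let ?P = "PiE UNIV (\<lambda>i. set (us i))"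
  have sub: "joint_spectrum \<subseteq> vec_lambda ` ?P"
  proof
    fix \<mu> assume "\<mu> \<in> joint_spectrum"
    then obtain v where v: "v \<in> V" "v \<noteq> 0\<^sub>v k" "\<And>i. act (on_ball (\<lambda>z. z $ i)) v = \<mu> $ i \<cdot>\<^sub>v v"
      unfolding joint_spectrum_def by blast
    have "\<mu> $ i \<in> set (us i)" for i
      using eigenvalue_in_annihilator[OF pi_carrier[OF coord_C] v(1,2) _ us(2)[OF v(1)]] v(3)
      by (simp add: act_def)
    then have "vec_nth \<mu> \<in> ?P" by auto
    then show "\<mu> \<in> vec_lambda ` ?P" by (metis imageI vec_nth_inverse)
  qed
  have fin: "finite ?P" by (intro finite_PiE) auto
  show "finite joint_spectrum" by (rule finite_subset[OF sub finite_imageI[OF fin]])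
  have "card joint_spectrum \<le> card (vec_lambda ` ?P)"
    by (rule card_mono[OF finite_imageI[OF fin] sub])
  also have "\<dots> \<le> card ?P" by (rule card_image_le[OF fin])
  also have "\<dots> = (\<Prod>i\<in>UNIV. card (set (us i)))" by (rule card_PiE) simp
  also have "\<dots> \<le> (\<Prod>i\<in>(UNIV :: 'd set). k)"
  proof (intro prod_mono conjI)
    show "card (set (us i)) \<le> k" for i using card_length[of "us i"] us(1)[of i] by simp
  qed simp
  finally show "card joint_spectrum \<le> k ^ CARD('d)" by simp
qed

text \<open>A bound for the images of all Moebius functions of the coordinates under \<open>\<pi>\<close>.\<close>

definition L :: real where
  "L = C * sqrt (2 * M)"

lemma L_nonneg: "0 \<le> L"
  using C_nonneg M_ge_1 by (simp add: L_def)

text \<open>One step of the Takenaka--Malmquist expansion of the Cauchy kernel.\<close>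

lemma cauchy_step:
  assumes \<zeta>: "norm \<zeta> = 1" and s: "0 < s" "s < 1" and u: "cmod u \<le> 1"
  defines "b \<equiv> complex_of_real s * u"
  shows "cauchy (of_real (s\<^sup>2)) \<zeta> =
    (\<lambda>z. (1 / (1 - of_real (s\<^sup>2) * u)) * (on_ball (\<lambda>z. 1) z + (- cnj b) * on_ball (disc_moebius b s \<zeta>) z) +
      cnj ((b - of_real s) / (1 - cnj b * of_real s)) *
        (cauchy (of_real (s\<^sup>2)) \<zeta> z * on_ball (disc_moebius b s \<zeta>) z))"
proof -
  have b: "cmod b < 1"
    unfolding b_def by (rule small_factor[OF s u])
  show ?thesis
    unfolding cauchy_def on_ball_mult unfolding on_ball_scale unfolding on_ball_add
    unfolding on_ball_scale unfolding on_ball_add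
  proof (rule on_ball_cong)
    fix z :: "complex ^ 'd" assume z: "norm z < 1"
    define q where "q = complex_of_real s * hermitian z \<zeta>"
    define \<theta> where "\<theta> = (b - q) / (1 - cnj b * q)"
    define \<omega> where "\<omega> = cnj ((b - of_real s) / (1 - cnj b * of_real s))"
    have h: "cmod (hermitian z \<zeta>) < 1" using hermitian_less_1[OF z] \<zeta> by simp
    have q: "cmod q < 1" unfolding q_def using s h by (intro prod_less_1) auto
    have nz1: "1 - cnj b * q \<noteq> 0" using prod_less_1[of "cnj b" q] b q by auto
    have nz2: "1 - cnj b * of_real s \<noteq> 0" using prod_less_1[of "cnj b" "of_real s"] b s by auto
    have nz3: "1 - q * of_real s \<noteq> 0" using prod_less_1[of q "of_real s"] q s by auto
    have nz4: "1 - b * of_real s \<noteq> 0" using prod_less_1[of b "of_real s"] b s by auto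
    have nzb: "1 - b * cnj b \<noteq> 0" using prod_less_1[of b "cnj b"] b by auto
    have b2: "complex_of_real (1 - (cmod b)\<^sup>2) = 1 - b * cnj b"
      by (simp add: complex_norm_square[symmetric] del: of_real_power)
    have id: "1 - \<theta> * \<omega> = (1 - b * cnj b) * (1 - q * of_real s) / ((1 - cnj b * q) * (1 - b * of_real s))"
      using moebius_identity[OF nz1 nz2] unfolding b2 \<theta>_def \<omega>_def by simp
    have id2: "1 - cnj b * \<theta> = (1 - b * cnj b) / (1 - cnj b * q)"
      unfolding \<theta>_def using nz1 by (simp add: field_simps)
    have "(1 - \<theta> * \<omega>) / (1 - q * of_real s) = (1 - cnj b * \<theta>) / (1 - b * of_real s)"
      unfolding id id2 using nz3 by simp
    then have main: "1 / (1 - q * of_real s) =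
        (1 / (1 - b * of_real s)) * (1 + - cnj b * \<theta>) + \<omega> * (1 / (1 - q * of_real s) * \<theta>)"
      by (simp add: diff_divide_distrib algebra_simps)
    have eqs: "q * of_real s = of_real (s\<^sup>2) * hermitian z \<zeta>" "b * of_real s = of_real (s\<^sup>2) * u"
      "\<theta> = disc_moebius b s \<zeta> z"
      by (simp_all add: q_def b_def \<theta>_def disc_moebius_def power2_eq_square)
    show "1 / (1 - complex_of_real (s\<^sup>2) * hermitian z \<zeta>) =
        1 / (1 - complex_of_real (s\<^sup>2) * u) * (1 + - cnj b * disc_moebius b s \<zeta> z) +
        cnj ((b - complex_of_real s) / (1 - cnj b * complex_of_real s)) *
          (1 / (1 - complex_of_real (s\<^sup>2) * hermitian z \<zeta>) * disc_moebius b s \<zeta> z)"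
      using main unfolding eqs \<omega>_def .
  qed
qed

text \<open>The Moebius function vanishes where \<open>\<langle>z, \<zeta>\<rangle> = u\<close>, with a cofactor in the algebra.\<close>

lemma moebius_factor:
  assumes \<zeta>: "norm \<zeta> = 1" and s: "0 < s" "s < 1" and u: "cmod u \<le> 1"
  defines "b \<equiv> complex_of_real s * u"
  shows "on_ball (disc_moebius b s \<zeta>) =
    (\<lambda>z. (- of_real s) * ((on_ball (\<lambda>z. hermitian z \<zeta>) z + (- u) * on_ball (\<lambda>z. 1) z) * cauchy (cnj b * of_real s) \<zeta> z))"
proof
  fix z
  have "b - of_real s * hermitian z \<zeta> = (- of_real s) * (hermitian z \<zeta> + (- u) * 1)"
    by (simp add: b_def algebra_simps)
  then show "on_ball (disc_moebius b s \<zeta>) z = (- of_real s) *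
      ((on_ball (\<lambda>z. hermitian z \<zeta>) z + (- u) * on_ball (\<lambda>z. 1) z) * cauchy (cnj b * of_real s) \<zeta> z)"
    by (simp add: on_ball_def cauchy_def disc_moebius_def mult.assoc)
qed

lemma moebius_C:
  assumes "norm \<zeta> = 1" "0 < s" "s < 1" "cmod u \<le> 1"
  shows "on_ball (disc_moebius (complex_of_real s * u) s \<zeta>) \<in> \<C>"
proof -
  have "cmod (cnj (complex_of_real s * u) * of_real s) < 1"
  proof (rule prod_less_1)
    show "cmod (cnj (complex_of_real s * u)) < 1"
      unfolding complex_mod_cnj using assms by (intro small_factor) auto
  qed (use assms in simp)
  then show ?thesis
    unfolding moebius_factor[OF assms]
    using assms by (intro scale_C mult_C add_C hermitian_C const_C cauchy_C) auto
qed

text \<open>The finite Blaschke product with zeros at the eigenvalues, applied to a vector.\<close>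

fun moebius_fold :: "complex ^ 'd \<Rightarrow> real \<Rightarrow> complex list \<Rightarrow> complex Matrix.vec \<Rightarrow> complex Matrix.vec" where
  "moebius_fold \<zeta> s [] v = v"
| "moebius_fold \<zeta> s (u # us) v =
    moebius_fold \<zeta> s us (act (on_ball (disc_moebius (complex_of_real s * u) s \<zeta>)) v)"

text \<open>Up to a commuting factor the Blaschke product is the characteristic polynomial of \<open>S \<zeta>\<close>.\<close>

lemma moebius_fold_ann:
  assumes \<zeta>: "norm \<zeta> = 1" and s: "0 < s" "s < 1" and us: "\<And>u. u \<in> set us \<Longrightarrow> cmod u \<le> 1" and v: "v \<in> V"
  shows "\<exists>g \<in> \<C>. moebius_fold \<zeta> s us v = ann (S \<zeta>) us (act g v)"
  using us v
proof (induction us arbitrary: v)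
  case Nil
  then show ?case using act_one const_C by (auto intro!: bexI[of _ "on_ball (\<lambda>z. 1)"])
next
  case (Cons u us)
  define b where "b = complex_of_real s * u"
  have u: "cmod u \<le> 1" using Cons.prems by simp
  have \<psi>: "on_ball (disc_moebius b s \<zeta>) \<in> \<C>" unfolding b_def by (rule moebius_C[OF \<zeta> s u])
  then obtain g where g: "g \<in> \<C>" and fold: "moebius_fold \<zeta> s (u # us) v =
      ann (S \<zeta>) us (act g (act (on_ball (disc_moebius b s \<zeta>)) v))"
    using Cons.IH[of "act (on_ball (disc_moebius b s \<zeta>)) v"] Cons.prems by (auto simp: b_def)
  define c where "c = cauchy (cnj b * of_real s) \<zeta>"
  have "cmod (cnj b * of_real s) < 1"
  proof (rule prod_less_1)
    show "cmod (cnj b) < 1" unfolding complex_mod_cnj b_def by (rule small_factor[OF s u])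
  qed (use s in simp)
  then have c: "c \<in> \<C>" unfolding c_def by (rule cauchy_C[OF \<zeta>])
  define h where "h = (\<lambda>z. (- of_real s) * (g z * c z))"
  have h: "h \<in> \<C>" unfolding h_def by (intro scale_C mult_C g c)
  have g0: "g z = 0" if "z \<notin> ball 0 1" for z using multiplierD(1)[of g] g sub that by blast
  have "(\<lambda>z. g z * on_ball (disc_moebius b s \<zeta>) z) =
      (\<lambda>z. on_ball (\<lambda>z. hermitian z \<zeta>) z * h z + (- u) * h z)"
    unfolding b_def moebius_factor[OF \<zeta> s u] unfolding b_def[symmetric] c_def[symmetric] h_def
    using g0 by (auto simp: on_ball_def algebra_simps)
  then have "act g (act (on_ball (disc_moebius b s \<zeta>)) v) =
      act (\<lambda>z. on_ball (\<lambda>z. hermitian z \<zeta>) z * h z + (- u) * h z) v"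
    using act_mult[OF g \<psi>, of v] Cons.prems by simp
  also have "\<dots> = act (on_ball (\<lambda>z. hermitian z \<zeta>)) (act h v) + (- u) \<cdot>\<^sub>v act h v"
    using Cons.prems h hermitian_C[OF \<zeta>]
    by (subst act_add) (auto simp: act_mult act_scale[of h v "- u", simplified] intro: mult_C scale_C[of h "- u", simplified])
  finally have "moebius_fold \<zeta> s (u # us) v = ann (S \<zeta>) (u # us) (act h v)"
    unfolding fold by (simp add: act_def S_def)
  then show ?case using h by blast
qed

text \<open>The expansion breaks off once the Blaschke product kills the vector. Its coefficients are
  \<open>1 / (1 - r u)\<close> times values of Blaschke products, which are at most \<open>1\<close>.\<close>

lemma cauchy_bound_fold:
  assumes \<zeta>: "norm \<zeta> = 1" and s: "0 < s" "s < 1" and us: "\<And>u. u \<in> set us \<Longrightarrow> cmod u \<le> 1" and v: "v \<in> V"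
    and fold: "moebius_fold \<zeta> s us v = 0\<^sub>v k"
  shows "vec_l2_norm (act (cauchy (of_real (s\<^sup>2)) \<zeta>) v) \<le>
    (1 + L) ^ length us * (\<Sum>u\<leftarrow>us. 1 / cmod (1 - of_real (s\<^sup>2) * u)) * vec_l2_norm v"
  using us v fold
proof (induction us arbitrary: v)
  have G: "cauchy (of_real (s\<^sup>2)) \<zeta> \<in> \<C>"
    using s by (intro cauchy_C \<zeta>) (simp add: norm_power power_less_one_iff)
  {
    case Nil
    then show ?case using act_bound[OF G Nil.prems(2)] by (simp add: vec_l2_norm_zero)
  next
    case (Cons u us)
    define b where "b = complex_of_real s * u"
    define \<psi> where "\<psi> = on_ball (disc_moebius b s \<zeta>)"
    define \<alpha> where "\<alpha> = 1 / (1 - of_real (s\<^sup>2) * u)"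
    define \<beta> where "\<beta> = cnj ((b - of_real s) / (1 - cnj b * of_real s))"
    have u: "cmod u \<le> 1" using Cons.prems by simp
    have b: "cmod b < 1" unfolding b_def by (rule small_factor[OF s u])
    have \<psi>: "\<psi> \<in> \<C>" unfolding \<psi>_def b_def by (rule moebius_C[OF \<zeta> s u])
    have \<beta>: "cmod \<beta> \<le> 1"
      unfolding \<beta>_def complex_mod_cnj using moebius_less_1[OF b, of "of_real s"] s by simp
    let ?v' = "act \<psi> v"
    have v': "?v' \<in> V" using \<psi> Cons.prems by simp
    have n\<psi>: "vec_l2_norm ?v' \<le> L * vec_l2_norm v"
    proof -
      have "vec_l2_norm ?v' \<le> C * mnorm \<psi> * vec_l2_norm v" by (rule act_bound[OF \<psi> Cons.prems(2)])
      also have "\<dots> \<le> C * sqrt (2 * M) * vec_l2_norm v"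
        unfolding \<psi>_def using moebius_mults(2)[OF \<zeta> b, of s] s C_nonneg vec_l2_norm_nonneg
        by (intro mult_right_mono mult_left_mono) auto
      finally show ?thesis by (simp add: L_def)
    qed
    have "act (cauchy (of_real (s\<^sup>2)) \<zeta>) v =
        \<alpha> \<cdot>\<^sub>v (v + (- cnj b) \<cdot>\<^sub>v ?v') + \<beta> \<cdot>\<^sub>v act (cauchy (of_real (s\<^sup>2)) \<zeta>) ?v'"
    proof -
      have m1: "(\<lambda>z. (- cnj b) * \<psi> z) \<in> \<C>" by (rule scale_C[OF \<psi>])
      have m2: "(\<lambda>z. on_ball (\<lambda>z. 1) z + (- cnj b) * \<psi> z) \<in> \<C>" by (rule add_C[OF const_C m1])
      have m3: "(\<lambda>z. cauchy (of_real (s\<^sup>2)) \<zeta> z * \<psi> z) \<in> \<C>" by (rule mult_C[OF G \<psi>])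
      have "act (cauchy (of_real (s\<^sup>2)) \<zeta>) v =
          act (\<lambda>z. \<alpha> * (on_ball (\<lambda>z. 1) z + (- cnj b) * \<psi> z) + \<beta> * (cauchy (of_real (s\<^sup>2)) \<zeta> z * \<psi> z)) v"
        using cauchy_step[OF \<zeta> s u] unfolding \<alpha>_def \<beta>_def \<psi>_def b_def by (rule arg_cong[where f = "\<lambda>f. act f v"])
      then show ?thesis
        unfolding act_add[OF scale_C[OF m2] scale_C[OF m3] Cons.prems(2)] act_scale[OF m2 Cons.prems(2)]
          act_scale[OF m3 Cons.prems(2)] act_add[OF const_C m1 Cons.prems(2)] act_scale[OF \<psi> Cons.prems(2)]
          act_mult[OF G \<psi> Cons.prems(2)] act_one[OF Cons.prems(2)] .
    qed
    also have "vec_l2_norm \<dots> \<le> vec_l2_norm (\<alpha> \<cdot>\<^sub>v (v + (- cnj b) \<cdot>\<^sub>v ?v')) +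
        vec_l2_norm (\<beta> \<cdot>\<^sub>v act (cauchy (of_real (s\<^sup>2)) \<zeta>) ?v')"
      using G v' Cons.prems by (intro vec_l2_norm_add[of _ k]) auto
    also have "vec_l2_norm (\<alpha> \<cdot>\<^sub>v (v + (- cnj b) \<cdot>\<^sub>v ?v')) \<le> cmod \<alpha> * ((1 + L) * vec_l2_norm v)"
      unfolding vec_l2_norm_smult
    proof (rule mult_left_mono)
      have "vec_l2_norm (v + (- cnj b) \<cdot>\<^sub>v ?v') \<le> vec_l2_norm v + cmod b * vec_l2_norm ?v'"
        using vec_l2_norm_add[of v k "(- cnj b) \<cdot>\<^sub>v ?v'"] v' Cons.prems by (simp add: vec_l2_norm_smult)
      also have "cmod b * vec_l2_norm ?v' \<le> 1 * (L * vec_l2_norm v)"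
        using b n\<psi> vec_l2_norm_nonneg by (intro mult_mono) auto
      finally show "vec_l2_norm (v + (- cnj b) \<cdot>\<^sub>v ?v') \<le> (1 + L) * vec_l2_norm v"
        by (simp add: algebra_simps)
    qed simp
    also have "vec_l2_norm (\<beta> \<cdot>\<^sub>v act (cauchy (of_real (s\<^sup>2)) \<zeta>) ?v') \<le>
        1 * ((1 + L) ^ length us * (\<Sum>u\<leftarrow>us. 1 / cmod (1 - of_real (s\<^sup>2) * u)) * vec_l2_norm ?v')"
      unfolding vec_l2_norm_smult using \<beta> vec_l2_norm_nonneg Cons.prems v'
      by (intro mult_mono Cons.IH) (auto simp: \<psi>_def b_def)
    also have "\<dots> \<le> (1 + L) ^ length us * (\<Sum>u\<leftarrow>us. 1 / cmod (1 - of_real (s\<^sup>2) * u)) * ((1 + L) * vec_l2_norm v)"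
    proof -
      have "vec_l2_norm ?v' \<le> (1 + L) * vec_l2_norm v"
        using n\<psi> vec_l2_norm_nonneg[of v] by (simp add: algebra_simps)
      moreover have "0 \<le> (\<Sum>u\<leftarrow>us. 1 / cmod (1 - of_real (s\<^sup>2) * u))"
        by (intro sum_list_nonneg) auto
      ultimately show ?thesis
        using L_nonneg by (simp only: mult_1_left) (intro mult_left_mono mult_nonneg_nonneg; simp)
    qed
    also have "cmod \<alpha> * ((1 + L) * vec_l2_norm v) \<le> (1 + L) ^ length us * cmod \<alpha> * ((1 + L) * vec_l2_norm v)"
    proof -
      have "1 \<le> (1 + L) ^ length us" using L_nonneg by (simp add: one_le_power)
      then have "1 * (cmod \<alpha> * ((1 + L) * vec_l2_norm v)) \<le> (1 + L) ^ length us * (cmod \<alpha> * ((1 + L) * vec_l2_norm v))"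
        using L_nonneg vec_l2_norm_nonneg[of v] by (intro mult_right_mono) auto
      then show ?thesis by (simp add: mult.assoc)
    qed
    finally have "vec_l2_norm (act (cauchy (of_real (s\<^sup>2)) \<zeta>) v) \<le>
        (1 + L) ^ length us * cmod \<alpha> * ((1 + L) * vec_l2_norm v) +
        (1 + L) ^ length us * (\<Sum>u\<leftarrow>us. 1 / cmod (1 - of_real (s\<^sup>2) * u)) * ((1 + L) * vec_l2_norm v)"
      by simp
    moreover have "cmod \<alpha> = 1 / cmod (1 - of_real (s\<^sup>2) * u)" by (simp add: \<alpha>_def norm_divide)
    ultimately show ?case
      unfolding list.map sum_list.Cons length_Cons by (simp only: power_Suc distrib_left distrib_right mult_ac)
  }
qed

text \<open>The norm of the resolvent is controlled by its eigenvalues alone, although the matrices need not be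
  normal; boundedness on Moebius functions replaces normality.\<close>

lemma cauchy_bound:
  assumes \<zeta>: "norm \<zeta> = 1" and r: "0 < r" "r < 1" and v: "v \<in> V"
  shows "vec_l2_norm (act (cauchy (of_real r) \<zeta>) v) \<le>
    (real k * (1 + L) ^ k * (\<Sum>\<mu>\<in>joint_spectrum. 1 / cmod (1 - of_real r * hermitian \<mu> \<zeta>))) * vec_l2_norm v"
proof -
  \<comment> \<open>In the disc variable \<open>s \<langle>z, \<zeta>\<rangle>\<close> the eigenvalues become interior points, and the Cauchy kernel sits at \<open>s\<close>, as \<open>r = s * s\<close>.\<close>
  define s where "s = sqrt r"
  have s: "0 < s" "s < 1" "s\<^sup>2 = r" using r by (auto simp: s_def)
  obtain us where us: "length us = k" "\<And>v. v \<in> V \<Longrightarrow> ann (S \<zeta>) us v = 0\<^sub>v k"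
    and ev: "\<And>u. u \<in> set us \<Longrightarrow> \<exists>v \<in> V. v \<noteq> 0\<^sub>v k \<and> S \<zeta> *\<^sub>v v = u \<cdot>\<^sub>v v"
    using annihilating_eigenvalues[OF S_carrier[OF \<zeta>]] by blast
  have u1: "cmod u \<le> 1" if "u \<in> set us" for u
    using ev[OF that] eigenvalue_bound[OF \<zeta>] by blast
  define \<Sigma> where "\<Sigma> = (\<Sum>\<mu>\<in>joint_spectrum. 1 / cmod (1 - of_real r * hermitian \<mu> \<zeta>))"
  have le: "1 / cmod (1 - of_real r * u) \<le> \<Sigma>" if u: "u \<in> set us" for u
  proof -
    obtain \<mu> where "\<mu> \<in> joint_spectrum" "u = hermitian \<mu> \<zeta>"
      using ev[OF u] eigenvalue_from_joint_spectrum[OF \<zeta>] by blast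
    then show ?thesis unfolding \<Sigma>_def
      using member_le_sum[of \<mu> joint_spectrum "\<lambda>\<mu>. 1 / cmod (1 - of_real r * hermitian \<mu> \<zeta>)"]
        joint_spectrum_finite(1) by simp
  qed
  have sum: "(\<Sum>u\<leftarrow>us'. 1 / cmod (1 - of_real r * u)) \<le> real (length us') * \<Sigma>" if "set us' \<subseteq> set us" for us'
    using that le by (induction us') (auto simp: algebra_simps intro: add_mono)
  obtain g where "g \<in> \<C>" "moebius_fold \<zeta> s us v = ann (S \<zeta>) us (act g v)"
    using moebius_fold_ann[OF \<zeta> s(1,2) u1 v] by blast
  then have "moebius_fold \<zeta> s us v = 0\<^sub>v k" using us(2) v by simp
  from cauchy_bound_fold[OF \<zeta> s(1,2) u1 v this]
  have "vec_l2_norm (act (cauchy (of_real r) \<zeta>) v) \<le>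
      (1 + L) ^ k * (\<Sum>u\<leftarrow>us. 1 / cmod (1 - of_real r * u)) * vec_l2_norm v"
    by (simp add: s(3) us(1) flip: of_real_power)
  also have "\<dots> \<le> (1 + L) ^ k * (real k * \<Sigma>) * vec_l2_norm v"
    using sum[of us] us(1) L_nonneg vec_l2_norm_nonneg by (intro mult_right_mono mult_left_mono) auto
  finally show ?thesis by (simp add: \<Sigma>_def mult_ac)
qed

text \<open>The bound involves only the absolute values of the kernels at points of the closed ball: all
  cancellation in the sum is invisible to representations of bounded size and norm.\<close>

lemma test_function_bound:
  fixes \<zeta> :: "'i \<Rightarrow> complex ^ 'd" and e :: "'i \<Rightarrow> complex"
  assumes I: "finite I" and \<zeta>: "\<And>i. i \<in> I \<Longrightarrow> norm (\<zeta> i) = 1" and e: "\<And>i. i \<in> I \<Longrightarrow> cmod (e i) \<le> 1"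
    and r: "0 < r" "r < 1" and t: "0 \<le> t" and p: "0 < p" and kN: "k \<le> N"
    and G: "\<And>\<mu>. norm \<mu> \<le> 1 \<Longrightarrow> (\<Sum>i\<in>I. (t / cmod (1 - of_real r * hermitian \<mu> (\<zeta> i))) ^ p) \<le> G"
    and G0: "0 \<le> G"
  defines "f \<equiv> test_function I e \<zeta> t r p"
  shows "mat_op_norm (\<pi> f) \<le> (real N * (1 + L) ^ N * real (N ^ CARD('d))) ^ p * real (N ^ CARD('d)) * G"
proof -
  define D where "D = real k * (1 + L) ^ k"
  define \<sigma> where "\<sigma> i \<mu> = t / cmod (1 - of_real r * hermitian \<mu> (\<zeta> i))" for i \<mu>
  have D0: "0 \<le> D" using L_nonneg by (simp add: D_def)
  have \<sigma>0: "0 \<le> \<sigma> i \<mu>" for i \<mu> using t by (simp add: \<sigma>_def)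
  define g where "g i z = of_real t / (1 - of_real r * hermitian z (\<zeta> i))" for i z
  have g_eq: "on_ball (g i) = (\<lambda>z. of_real t * cauchy (of_real r) (\<zeta> i) z)" for i
    unfolding cauchy_def on_ball_scale by (rule on_ball_cong) (simp add: g_def)
  have c: "cauchy (of_real r) (\<zeta> i) \<in> \<C>" if "i \<in> I" for i
    using that r by (intro cauchy_C \<zeta>) auto
  have g: "on_ball (g i) \<in> \<C>" if "i \<in> I" for i
    unfolding g_eq by (rule scale_C[OF c[OF that]])
  have gp: "on_ball (\<lambda>z. e i * g i z ^ p) \<in> \<C>" if "i \<in> I" for i
    using scale_C[OF power_C[OF g[OF that], of p], of "e i"] by (simp add: on_ball_scale)
  have f: "f \<in> \<C>" unfolding f_def by (rule test_function_C[OF \<zeta> r])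
  have gb: "vec_l2_norm (act (on_ball (g i)) v) \<le> (D * (\<Sum>\<mu>\<in>joint_spectrum. \<sigma> i \<mu>)) * vec_l2_norm v"
    if "i \<in> I" "v \<in> V" for i v
  proof -
    have "vec_l2_norm (act (on_ball (g i)) v) = t * vec_l2_norm (act (cauchy (of_real r) (\<zeta> i)) v)"
      unfolding g_eq act_scale[OF c[OF that(1)] that(2)] vec_l2_norm_smult using t by simp
    also have "\<dots> \<le> t * ((D * (\<Sum>\<mu>\<in>joint_spectrum. 1 / cmod (1 - of_real r * hermitian \<mu> (\<zeta> i)))) * vec_l2_norm v)"
      unfolding D_def by (rule mult_left_mono[OF cauchy_bound[OF \<zeta>[OF that(1)] r that(2)] t])
    finally show ?thesis by (simp add: \<sigma>_def sum_distrib_left mult_ac)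
  qed
  define c where "c = real (card joint_spectrum)"
  have bound: "vec_l2_norm (act f v) \<le> ((D * c) ^ p * c * G) * vec_l2_norm v" if v: "v \<in> V" for v
  proof -
    have "vec_l2_norm (act f v) \<le> (\<Sum>i\<in>I. (D * (\<Sum>\<mu>\<in>joint_spectrum. \<sigma> i \<mu>)) ^ p * vec_l2_norm v)"
      unfolding f_def test_function_def g_def[symmetric]
    proof (rule act_sum_bound[OF gp v])
      fix i assume i: "i \<in> I"
      have "vec_l2_norm (act (on_ball (\<lambda>z. e i * g i z ^ p)) v) =
          cmod (e i) * vec_l2_norm (act (on_ball (\<lambda>z. g i z ^ p)) v)"
        using act_scale[OF power_C[OF g[OF i], of p] v, of "e i"] by (simp add: on_ball_scale vec_l2_norm_smult)
      also have "\<dots> \<le> 1 * vec_l2_norm (act (on_ball (\<lambda>z. g i z ^ p)) v)"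
        by (rule mult_right_mono[OF e[OF i] vec_l2_norm_nonneg])
      also have "\<dots> \<le> (D * (\<Sum>\<mu>\<in>joint_spectrum. \<sigma> i \<mu>)) ^ p * vec_l2_norm v"
        unfolding mult_1_left
        using D0 \<sigma>0 by (intro act_power_bound g i gb v) (auto intro!: mult_nonneg_nonneg sum_nonneg)
      finally show "vec_l2_norm (act (on_ball (\<lambda>z. e i * g i z ^ p)) v) \<le>
          (D * (\<Sum>\<mu>\<in>joint_spectrum. \<sigma> i \<mu>)) ^ p * vec_l2_norm v" .
    qed
    also have "\<dots> \<le> (\<Sum>i\<in>I. (D ^ p * (c ^ p * (\<Sum>\<mu>\<in>joint_spectrum. \<sigma> i \<mu> ^ p))) * vec_l2_norm v)"
      unfolding power_mult_distrib c_def using D0 \<sigma>0 p vec_l2_norm_nonneg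
      by (intro sum_mono mult_right_mono mult_left_mono sum_power_le joint_spectrum_finite) auto
    also have "\<dots> = D ^ p * c ^ p * (\<Sum>\<mu>\<in>joint_spectrum. \<Sum>i\<in>I. \<sigma> i \<mu> ^ p) * vec_l2_norm v"
      by (subst sum.swap) (simp add: sum_distrib_left sum_distrib_right mult_ac)
    also have "\<dots> \<le> D ^ p * c ^ p * (\<Sum>\<mu>\<in>joint_spectrum. G) * vec_l2_norm v"
      using D0 vec_l2_norm_nonneg G joint_spectrum_in_ball unfolding \<sigma>_def
      by (intro mult_right_mono mult_left_mono sum_mono) (auto simp: c_def)
    finally show ?thesis by (simp add: c_def power_mult_distrib mult_ac)
  qed
  have "mat_op_norm (\<pi> f) \<le> (D * c) ^ p * c * G"
    using bound G0 D0 by (intro mat_op_norm_least[OF pi_carrier[OF f]]) (auto simp: act_def c_def)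
  also have "\<dots> \<le> (real N * (1 + L) ^ N * real (N ^ CARD('d))) ^ p * real (N ^ CARD('d)) * G"
  proof -
    have cN: "c \<le> real (N ^ CARD('d))"
      unfolding c_def of_nat_le_iff
      using joint_spectrum_finite(2) power_mono[OF kN, of "CARD('d)"] by linarith
    have "D \<le> real N * (1 + L) ^ N"
      unfolding D_def using kN L_nonneg by (intro mult_mono power_increasing) auto
    then have "D * c \<le> real N * (1 + L) ^ N * real (N ^ CARD('d))"
      using cN D0 L_nonneg by (intro mult_mono) (auto simp: c_def)
    then have "(D * c) ^ p \<le> (real N * (1 + L) ^ N * real (N ^ CARD('d))) ^ p"
      using D0 by (intro power_mono) (auto simp: c_def)
    then have "(D * c) ^ p * c \<le> (real N * (1 + L) ^ N * real (N ^ CARD('d))) ^ p * real (N ^ CARD('d))"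
      by (rule mult_mono[OF _ cN]) (use L_nonneg in \<open>auto simp: c_def\<close>)
    then show ?thesis by (rule mult_right_mono[OF _ G0])
  qed
  finally show "mat_op_norm (\<pi> f) \<le> (real N * (1 + L) ^ N * real (N ^ CARD('d))) ^ p * real (N ^ CARD('d)) * G" .
qed

end

section \<open>Well separated points on the sphere\<close>

lemma root_of_unity_orthogonality:
  assumes "i < n" "j < n" "i \<noteq> j"
  shows "(\<Sum>k<n. cis (2 * pi * real k / real n) ^ i * cnj (cis (2 * pi * real k / real n) ^ j)) = 0"
proof -
  define g where "g = cis (2 * pi * (real i - real j) / real n)"
  have powers: "cis (2 * pi * real k / real n) ^ i * cnj (cis (2 * pi * real k / real n) ^ j) = g ^ k" for k
    unfolding g_def by (simp add: Complex.DeMoivre cis_cnj cis_mult diff_divide_distrib algebra_simps)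
  have "g \<noteq> 1"
  proof
    assume "g = 1"
    then have "cos (2 * pi * (real i - real j) / real n) = 1" by (simp add: g_def complex_eq_iff)
    then obtain m :: int where "2 * pi * (real i - real j) / real n = real_of_int m * 2 * pi"
      using cos_one_2pi_int by blast
    then have "(2 * pi) * (real i - real j - real_of_int m * real n) = 0"
      using assms by (simp add: field_simps)
    then have "real i - real j = real_of_int m * real n" by simp
    then have eq: "int i - int j = m * int n"
      by (metis of_int_diff of_int_eq_iff of_int_mult of_int_of_nat_eq)
    have "m = 0"
    proof (rule ccontr)
      assume "m \<noteq> 0"
      then have "1 * int n \<le> \<bar>m\<bar> * int n" by (intro mult_right_mono) auto
      also have "\<dots> = \<bar>int i - int j\<bar>" unfolding eq by (simp add: abs_mult)
      finally show False using assms by linarith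
    qed
    then show False using eq assms by simp
  qed
  moreover have "g ^ n = 1"
  proof -
    have "real n * (2 * pi * (real i - real j) / real n) = 2 * pi * of_int (int i - int j)"
      using assms by simp
    then show ?thesis
      unfolding g_def Complex.DeMoivre by (simp only: cis_multiple_2pi Ints_of_int)
  qed
  ultimately show ?thesis
    unfolding powers by (simp add: sum_gp_strict)
qed

lemma parseval_roots_of_unity:
  "(\<Sum>k<n. (cmod (\<Sum>i<n. (cis (2 * pi * real k / real n) * y) ^ i))\<^sup>2) = real n * (\<Sum>i<n. (cmod y) ^ (2 * i))"
proof -
  let ?w = "\<lambda>k. cis (2 * pi * real k / real n)"
  have "complex_of_real (\<Sum>k<n. (cmod (\<Sum>i<n. (?w k * y) ^ i))\<^sup>2) =
      (\<Sum>k<n. (\<Sum>i<n. (?w k * y) ^ i) * cnj (\<Sum>j<n. (?w k * y) ^ j))"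
    by (simp only: of_real_sum complex_norm_square)
  also have "\<dots> = (\<Sum>k<n. \<Sum>i<n. \<Sum>j<n. y ^ i * cnj (y ^ j) * (?w k ^ i * cnj (?w k ^ j)))"
    by (simp only: cnj_sum sum_product) (simp add: power_mult_distrib mult_ac)
  also have "\<dots> = (\<Sum>i<n. \<Sum>k<n. \<Sum>j<n. y ^ i * cnj (y ^ j) * (?w k ^ i * cnj (?w k ^ j)))"
    by (rule sum.swap)
  also have "\<dots> = (\<Sum>i<n. \<Sum>j<n. \<Sum>k<n. y ^ i * cnj (y ^ j) * (?w k ^ i * cnj (?w k ^ j)))"
    by (intro sum.cong refl sum.swap)
  also have "\<dots> = (\<Sum>i<n. \<Sum>j<n. if j = i then complex_of_real (real n * cmod y ^ (2 * i)) else 0)"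
  proof (intro sum.cong refl)
    fix i j assume ij: "i \<in> {..<n}" "j \<in> {..<n}"
    show "(\<Sum>k<n. y ^ i * cnj (y ^ j) * (?w k ^ i * cnj (?w k ^ j))) =
        (if j = i then complex_of_real (real n * cmod y ^ (2 * i)) else 0)"
    proof (cases "j = i")
      case True
      have "?w k ^ i * cnj (?w k ^ i) = 1" for k
        by (simp add: complex_norm_square[symmetric] norm_power del: of_real_power complex_cnj_power)
      moreover have "y ^ i * cnj (y ^ i) = complex_of_real (cmod y ^ (2 * i))"
        by (simp add: complex_norm_square[symmetric] norm_power power_even_eq del: of_real_power complex_cnj_power)
      ultimately show ?thesis using True by simp
    next
      case False
      then show ?thesis
        using root_of_unity_orthogonality[of i n j] ij by (simp add: sum_distrib_left[symmetric] del: complex_cnj_power)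
    qed
  qed
  also have "\<dots> = complex_of_real (real n * (\<Sum>i<n. (cmod y) ^ (2 * i)))"
    by (simp add: sum_distrib_left)
  finally show ?thesis by (simp only: of_real_eq_iff)
qed

lemma one_minus_inverse_power: "0 < n \<Longrightarrow> (1 - 1 / real n) ^ n \<le> 1 / 2"
proof -
  assume n: "0 < n"
  have "(1 - 1 / real n) ^ n \<le> exp (- 1 / real n) ^ n"
    using n exp_ge_add_one_self[of "- 1 / real n"] by (intro power_mono) auto
  also have "\<dots> = exp (- 1)" using n by (simp flip: exp_of_nat_mult)
  also have "\<dots> \<le> 1 / 2"
    using exp_ge_add_one_self[of 1] by (simp add: exp_minus field_simps)
  finally show ?thesis .
qed

text \<open>Writing \<open>1 / (1 - w y)\<close> as a geometric sum of length \<open>n\<close> over \<open>1 - y\<^sup>n\<close> reduces the sum over the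
  \<open>n\<close>-th roots of unity \<open>w\<close> to the finite Parseval identity.\<close>

lemma sum_over_rotations:
  assumes n: "0 < n" and y: "cmod y \<le> 1 - 1 / real n"
  shows "(\<Sum>k<n. ((1 / real n) / cmod (1 - cis (2 * pi * real k / real n) * y)) ^ (q + 2)) \<le>
    4 * (1 / (real n * (1 - cmod y))) ^ (q + 1)"
proof -
  let ?w = "\<lambda>k. cis (2 * pi * real k / real n)"
  define \<tau> where "\<tau> = 1 / (real n * (1 - cmod y))"
  have "0 < 1 / real n" using n by simp
  then have y1: "0 < 1 - cmod y" using y by linarith
  have \<tau>: "0 \<le> \<tau>" using y1 by (simp add: \<tau>_def)
  have wn: "?w k ^ n = 1" for k
  proof -
    have "real n * (2 * pi * real k / real n) = 2 * pi * of_int (int k)" using n by simp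
    then show ?thesis unfolding Complex.DeMoivre by (simp only: cis_multiple_2pi Ints_of_int)
  qed
  have lower: "1 - cmod y \<le> cmod (1 - ?w k * y)" for k
    using norm_triangle_ineq2[of 1 "?w k * y"] by (simp add: norm_mult)
  have yn: "1 / 2 \<le> cmod (1 - y ^ n)"
  proof -
    have "cmod (y ^ n) \<le> (1 - 1 / real n) ^ n" using y by (simp add: norm_power power_mono)
    then show ?thesis using one_minus_inverse_power[OF n] norm_triangle_ineq2[of 1 "y ^ n"] by simp
  qed
  have inv: "1 / cmod (1 - ?w k * y) = cmod (\<Sum>i<n. (?w k * y) ^ i) / cmod (1 - y ^ n)" for k
  proof -
    have nz: "1 - ?w k * y \<noteq> 0" using lower[of k] y1 by auto
    then have "(\<Sum>i<n. (?w k * y) ^ i) = (1 - y ^ n) / (1 - ?w k * y)"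
      by (subst sum_gp_strict) (auto simp: power_mult_distrib wn)
    then show ?thesis using yn nz by (auto simp: norm_divide)
  qed
  have sq: "(\<Sum>k<n. (1 / cmod (1 - ?w k * y))\<^sup>2) \<le> 4 * (real n / (1 - cmod y))"
  proof -
    have "(1 / cmod (1 - ?w k * y))\<^sup>2 \<le> 4 * (cmod (\<Sum>i<n. (?w k * y) ^ i))\<^sup>2" for k
    proof -
      have "cmod (\<Sum>i<n. (?w k * y) ^ i) / cmod (1 - y ^ n) \<le> cmod (\<Sum>i<n. (?w k * y) ^ i) / (1 / 2)"
        using yn by (intro divide_left_mono) auto
      then have "(1 / cmod (1 - ?w k * y))\<^sup>2 \<le> (2 * cmod (\<Sum>i<n. (?w k * y) ^ i))\<^sup>2"
        unfolding inv by (intro power_mono) auto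
      then show ?thesis by (simp add: power_mult_distrib)
    qed
    then have "(\<Sum>k<n. (1 / cmod (1 - ?w k * y))\<^sup>2) \<le> 4 * (\<Sum>k<n. (cmod (\<Sum>i<n. (?w k * y) ^ i))\<^sup>2)"
      unfolding sum_distrib_left by (intro sum_mono)
    also have "\<dots> = 4 * (real n * (\<Sum>i<n. (cmod y) ^ (2 * i)))"
      by (simp only: parseval_roots_of_unity)
    also have "\<dots> \<le> 4 * (real n * (1 / (1 - cmod y)))"
    proof (intro mult_left_mono)
      have "(\<Sum>i<n. (cmod y) ^ (2 * i)) \<le> (\<Sum>i<n. (cmod y) ^ i)"
        using y1 by (intro sum_mono power_decreasing) auto
      also have "\<dots> \<le> 1 / (1 - cmod y)"
        using y1 by (subst sum_gp_strict) (auto simp: divide_right_mono)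
      finally show "(\<Sum>i<n. (cmod y) ^ (2 * i)) \<le> 1 / (1 - cmod y)" .
    qed auto
    finally show ?thesis by simp
  qed
  have "(\<Sum>k<n. ((1 / real n) / cmod (1 - ?w k * y)) ^ (q + 2)) \<le>
      (\<Sum>k<n. \<tau> ^ q * ((1 / real n)\<^sup>2 * (1 / cmod (1 - ?w k * y))\<^sup>2))"
  proof (intro sum_mono)
    fix k
    have "(1 / real n) / cmod (1 - ?w k * y) \<le> (1 / real n) / (1 - cmod y)"
    proof (rule divide_left_mono[OF lower])
      show "0 < cmod (1 - ?w k * y) * (1 - cmod y)"
        using lower[of k] y1 by (intro mult_pos_pos) linarith+
    qed simp
    then have "((1 / real n) / cmod (1 - ?w k * y)) ^ q \<le> \<tau> ^ q"
      unfolding \<tau>_def by (intro power_mono) auto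
    then have "((1 / real n) / cmod (1 - ?w k * y)) ^ q * ((1 / real n) / cmod (1 - ?w k * y))\<^sup>2 \<le>
        \<tau> ^ q * ((1 / real n) / cmod (1 - ?w k * y))\<^sup>2"
      by (rule mult_right_mono) simp
    then show "((1 / real n) / cmod (1 - ?w k * y)) ^ (q + 2) \<le>
        \<tau> ^ q * ((1 / real n)\<^sup>2 * (1 / cmod (1 - ?w k * y))\<^sup>2)"
      by (simp only: power_add) (simp add: power_divide power_mult_distrib)
  qed
  also have "\<dots> = \<tau> ^ q * (1 / real n)\<^sup>2 * (\<Sum>k<n. (1 / cmod (1 - ?w k * y))\<^sup>2)"
    by (simp add: sum_distrib_left mult.assoc)
  also have "\<dots> \<le> \<tau> ^ q * (1 / real n)\<^sup>2 * (4 * (real n / (1 - cmod y)))"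
    using \<tau> by (intro mult_left_mono sq) auto
  also have "\<dots> = 4 * \<tau> ^ (q + 1)"
    using n by (simp add: \<tau>_def power2_eq_square)
  finally show ?thesis by (simp add: \<tau>_def)
qed

text \<open>On each side of \<open>x\<close> the integer parts of the distances to \<open>x\<close> are distinct.\<close>

lemma lattice_sum_bound:
  "\<exists>B\<ge>1. \<forall>(l::nat) x. (\<Sum>p<l. 1 / (1 + (real p - x)\<^sup>2 / 64)) \<le> B"
proof -
  define f where "f k = 64 / (1 + (real k)\<^sup>2)" for k :: nat
  have "summable (\<lambda>k. 64 * inverse (real k ^ 2))"
    by (intro summable_mult inverse_power_summable) auto
  then have sf: "summable f"
  proof (rule summable_comparison_test'[where N = 1])
    fix k :: nat assume "1 \<le> k"
    then show "norm (f k) \<le> 64 * inverse (real k ^ 2)"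
      by (auto simp: f_def divide_inverse intro!: le_imp_inverse_le)
  qed
  have f0: "0 \<le> f k" for k by (simp add: f_def add_pos_nonneg)
  have compare: "1 / (1 + x\<^sup>2 / 64) \<le> f k" if "real k \<le> \<bar>x\<bar>" for x k
  proof -
    have "(real k)\<^sup>2 \<le> x\<^sup>2" using that by (metis abs_of_nat power2_abs power_mono of_nat_0_le_iff)
    then have "(1 + (real k)\<^sup>2) / 64 \<le> 1 + x\<^sup>2 / 64" by (simp add: add_divide_distrib)
    then have "1 / (1 + x\<^sup>2 / 64) \<le> 1 / ((1 + (real k)\<^sup>2) / 64)"
      by (intro divide_left_mono) (auto simp: add_pos_nonneg)
    then show ?thesis by (simp add: f_def)
  qed
  have part: "(\<Sum>p\<in>A. 1 / (1 + (real p - x)\<^sup>2 / 64)) \<le> suminf f"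
    if A: "finite A" and inj: "inj_on g A" and g: "\<And>p. p \<in> A \<Longrightarrow> real (g p) \<le> \<bar>real p - x\<bar>"
    for A and g :: "nat \<Rightarrow> nat" and x
  proof -
    have "(\<Sum>p\<in>A. 1 / (1 + (real p - x)\<^sup>2 / 64)) \<le> (\<Sum>p\<in>A. f (g p))"
      by (intro sum_mono compare g)
    also have "\<dots> = (\<Sum>k\<in>g ` A. f k)" using inj by (simp add: sum.reindex)
    also have "\<dots> \<le> suminf f" using A f0 by (intro sum_le_suminf sf) auto
    finally show ?thesis .
  qed
  have "(\<Sum>p<l. 1 / (1 + (real p - x)\<^sup>2 / 64)) \<le> 1 + 2 * suminf f" for l x
  proof -
    let ?A = "{p. p < l \<and> x \<le> real p}" and ?B = "{p. p < l \<and> real p < x}"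
    have "(\<Sum>p<l. 1 / (1 + (real p - x)\<^sup>2 / 64)) =
        (\<Sum>p\<in>?A. 1 / (1 + (real p - x)\<^sup>2 / 64)) + (\<Sum>p\<in>?B. 1 / (1 + (real p - x)\<^sup>2 / 64))"
      by (subst sum.union_disjoint[symmetric]) (auto intro!: sum.cong)
    moreover have "(\<Sum>p\<in>?A. 1 / (1 + (real p - x)\<^sup>2 / 64)) \<le> suminf f"
      by (rule part[where g = "\<lambda>p. nat (int p - \<lceil>x\<rceil>)"]) (auto simp: inj_on_def, linarith+)
    moreover have "(\<Sum>p\<in>?B. 1 / (1 + (real p - x)\<^sup>2 / 64)) \<le> suminf f"
      by (rule part[where g = "\<lambda>p. nat (\<lfloor>x\<rfloor> - int p)"]) (auto simp: inj_on_def, linarith+)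
    ultimately show ?thesis by simp
  qed
  moreover have "1 \<le> 1 + 2 * suminf f" using suminf_nonneg[OF sf f0] by simp
  ultimately show ?thesis by blast
qed

text \<open>Lagrange's identity, with its nonnegative remainder dropped.\<close>

lemma affine_distance:
  fixes \<alpha> :: complex and \<beta> x :: "'i \<Rightarrow> complex"
  assumes "finite J"
  shows "(\<Sum>i\<in>J. (cmod (\<beta> i - \<alpha> * x i))\<^sup>2) + (cmod (\<alpha> + (\<Sum>i\<in>J. \<beta> i * cnj (x i))))\<^sup>2 \<le>
    (1 + (\<Sum>i\<in>J. (cmod (x i))\<^sup>2)) * ((cmod \<alpha>)\<^sup>2 + (\<Sum>i\<in>J. (cmod (\<beta> i))\<^sup>2))"
proof -
  define s where "s = (\<Sum>i\<in>J. \<beta> i * cnj (x i))"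
  define X where "X = (\<Sum>i\<in>J. (cmod (x i))\<^sup>2)"
  define B where "B = (\<Sum>i\<in>J. (cmod (\<beta> i))\<^sup>2)"
  have sq: "(cmod (u - v))\<^sup>2 = (cmod u)\<^sup>2 + (cmod v)\<^sup>2 - 2 * Re (cnj v * u)" for u v :: complex
    unfolding cmod_power2 by (simp add: power2_eq_square algebra_simps)
  have "(\<Sum>i\<in>J. (cmod (\<beta> i - \<alpha> * x i))\<^sup>2) =
      (\<Sum>i\<in>J. (cmod (\<beta> i))\<^sup>2 + (cmod \<alpha>)\<^sup>2 * (cmod (x i))\<^sup>2 - 2 * Re (cnj \<alpha> * (\<beta> i * cnj (x i))))"
    by (intro sum.cong refl) (simp add: sq norm_mult power_mult_distrib mult_ac)
  also have "\<dots> = B + (cmod \<alpha>)\<^sup>2 * X - 2 * Re (cnj \<alpha> * s)"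
    by (simp add: B_def X_def s_def sum.distrib sum_subtractf sum_distrib_left Re_sum del: times_complex.simps)
  finally have 1: "(\<Sum>i\<in>J. (cmod (\<beta> i - \<alpha> * x i))\<^sup>2) = B + (cmod \<alpha>)\<^sup>2 * X - 2 * Re (cnj \<alpha> * s)" .
  have 2: "(cmod (\<alpha> + s))\<^sup>2 = (cmod \<alpha>)\<^sup>2 + (cmod s)\<^sup>2 + 2 * Re (cnj \<alpha> * s)"
    unfolding cmod_power2 by (simp add: power2_eq_square algebra_simps)
  have "cmod s \<le> (\<Sum>i\<in>J. cmod (\<beta> i) * cmod (x i))"
    unfolding s_def by (rule order_trans[OF norm_sum]) (simp add: norm_mult)
  also have "\<dots> \<le> L2_set (\<lambda>i. cmod (\<beta> i)) J * L2_set (\<lambda>i. cmod (x i)) J"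
    using L2_set_mult_ineq[of "\<lambda>i. cmod (\<beta> i)" "\<lambda>i. cmod (x i)" J] by simp
  finally have "(cmod s)\<^sup>2 \<le> (L2_set (\<lambda>i. cmod (\<beta> i)) J * L2_set (\<lambda>i. cmod (x i)) J)\<^sup>2"
    by (intro power_mono) auto
  also have "\<dots> = B * X"
    by (simp add: L2_set_def power_mult_distrib B_def X_def sum_nonneg)
  finally show ?thesis
    unfolding 1 s_def[symmetric] 2 X_def[symmetric] B_def[symmetric] by (simp add: algebra_simps)
qed

text \<open>The unit vector in the direction of the point \<open>x\<close> of the affine chart \<open>z\<^sub>i\<^sub>0 = 1\<close>, multiplied by the phase
  \<open>c\<close>.\<close>

definition grid_vec :: "'d::finite \<Rightarrow> ('d \<Rightarrow> complex) \<Rightarrow> complex \<Rightarrow> complex ^ 'd" where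
  "grid_vec i\<^sub>0 x c = (\<chi> i. c * (if i = i\<^sub>0 then 1 else x i) /
     complex_of_real (sqrt (1 + (\<Sum>i\<in>UNIV - {i\<^sub>0}. (cmod (x i))\<^sup>2))))"

lemma norm_grid_vec:
  assumes "cmod c = 1"
  shows "norm (grid_vec i\<^sub>0 x c) = 1"
proof -
  define D where "D = 1 + (\<Sum>i\<in>UNIV - {i\<^sub>0}. (cmod (x i))\<^sup>2)"
  have D: "0 < D" unfolding D_def by (intro add_pos_nonneg sum_nonneg) auto
  have "(norm (grid_vec i\<^sub>0 x c))\<^sup>2 = (\<Sum>i\<in>UNIV. (cmod (if i = i\<^sub>0 then 1 else x i))\<^sup>2 / D)"
    unfolding norm_vec_def L2_set_def using D assms
    by (subst real_sqrt_pow2) (auto intro!: sum_nonneg sum.cong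
        simp: grid_vec_def D_def[symmetric] norm_divide norm_mult power_divide)
  also have "\<dots> = (\<Sum>i\<in>UNIV. (cmod (if i = i\<^sub>0 then 1 else x i))\<^sup>2) / D"
    by (simp only: sum_divide_distrib)
  also have "(\<Sum>i\<in>UNIV. (cmod (if i = i\<^sub>0 then 1 else x i))\<^sup>2) = D"
    by (subst sum.remove[of _ i\<^sub>0]) (auto simp: D_def intro!: sum.cong)
  finally have "(norm (grid_vec i\<^sub>0 x c))\<^sup>2 = 1\<^sup>2" using D by simp
  then show ?thesis by (rule power2_eq_imp_eq) auto
qed

lemma hermitian_grid_vec:
  "hermitian z (grid_vec i\<^sub>0 x c) = cnj c * (z $ i\<^sub>0 + (\<Sum>i\<in>UNIV - {i\<^sub>0}. z $ i * cnj (x i))) /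
     complex_of_real (sqrt (1 + (\<Sum>i\<in>UNIV - {i\<^sub>0}. (cmod (x i))\<^sup>2)))"
proof -
  define r where "r = complex_of_real (sqrt (1 + (\<Sum>i\<in>UNIV - {i\<^sub>0}. (cmod (x i))\<^sup>2)))"
  have r: "cnj r = r" by (simp add: r_def)
  have "hermitian z (grid_vec i\<^sub>0 x c) = (\<Sum>i\<in>UNIV. cnj c / r * (z $ i * cnj (if i = i\<^sub>0 then 1 else x i)))"
    unfolding hermitian_def grid_vec_def r_def[symmetric] by (intro sum.cong refl) (simp add: r)
  also have "\<dots> = cnj c / r * (\<Sum>i\<in>UNIV. z $ i * cnj (if i = i\<^sub>0 then 1 else x i))"
    by (simp only: sum_distrib_left)
  also have "(\<Sum>i\<in>UNIV. z $ i * cnj (if i = i\<^sub>0 then 1 else x i)) =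
      z $ i\<^sub>0 + (\<Sum>i\<in>UNIV - {i\<^sub>0}. z $ i * cnj (x i))"
    by (subst sum.remove[of _ i\<^sub>0]) (auto intro!: sum.cong)
  finally show ?thesis by (simp add: r_def)
qed

lemma norm_square_split:
  fixes z :: "complex ^ 'd"
  shows "(norm z)\<^sup>2 = (cmod (z $ i\<^sub>0))\<^sup>2 + (\<Sum>i\<in>UNIV - {i\<^sub>0}. (cmod (z $ i))\<^sup>2)"
proof -
  have "(norm z)\<^sup>2 = (\<Sum>i\<in>UNIV. (cmod (z $ i))\<^sup>2)"
    by (simp add: norm_vec_def L2_set_def sum_nonneg)
  then show ?thesis by (simp add: sum.remove[of UNIV i\<^sub>0])
qed

text \<open>The defect \<open>1 - |\<langle>z, \<zeta>\<rangle>|\<close> controls the squared distance in the chart \<open>z\<^sub>i\<^sub>0 = 1\<close>; it is bounded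
  below where \<open>z\<^sub>i\<^sub>0\<close> is too small for the chart to be of use.\<close>

lemma grid_defect:
  fixes z :: "complex ^ 'd"
  assumes z: "norm z \<le> 1" and c: "cmod c = 1"
    and small: "(\<Sum>i\<in>UNIV - {i\<^sub>0}. (cmod (x i))\<^sup>2) \<le> 1 / 8"
  defines "h \<equiv> cmod (hermitian z (grid_vec i\<^sub>0 x c))"
  shows "(\<Sum>i\<in>UNIV - {i\<^sub>0}. (cmod (z $ i - z $ i\<^sub>0 * x i))\<^sup>2) \<le> 4 * (1 - h)"
    and "cmod (z $ i\<^sub>0) \<le> 1 / 4 \<Longrightarrow> h \<le> 3 / 4"
proof -
  let ?J = "UNIV - {i\<^sub>0}"
  define X where "X = (\<Sum>i\<in>?J. (cmod (x i))\<^sup>2)"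
  define s where "s = (\<Sum>i\<in>?J. z $ i * cnj (x i))"
  have X: "0 \<le> X" "X \<le> 1 / 8" unfolding X_def using small by (auto intro: sum_nonneg)
  have h_eq: "h = cmod (z $ i\<^sub>0 + s) / sqrt (1 + X)"
    unfolding h_def hermitian_grid_vec X_def[symmetric] s_def[symmetric]
    using c X by (simp add: norm_divide norm_mult)
  have h0: "0 \<le> h" by (simp add: h_def)
  have h1: "h \<le> 1"
    unfolding h_def using hermitian_bound[of z "grid_vec i\<^sub>0 x c"] z norm_grid_vec[OF c, of i\<^sub>0 x] by simp
  have z2: "(norm z)\<^sup>2 \<le> 1" using z by (simp add: power_le_one)
  have "(\<Sum>i\<in>?J. (cmod (z $ i - z $ i\<^sub>0 * x i))\<^sup>2) + (cmod (z $ i\<^sub>0 + s))\<^sup>2 \<le> (1 + X) * (norm z)\<^sup>2"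
    using affine_distance[of ?J "\<lambda>i. z $ i" "z $ i\<^sub>0" x]
    unfolding norm_square_split[of z i\<^sub>0] X_def s_def by simp
  also have "\<dots> \<le> (1 + X) * 1" using X z2 by (intro mult_left_mono) auto
  also have "(cmod (z $ i\<^sub>0 + s))\<^sup>2 = h\<^sup>2 * (1 + X)"
    unfolding h_eq using X by (simp add: power_divide)
  finally have "(\<Sum>i\<in>?J. (cmod (z $ i - z $ i\<^sub>0 * x i))\<^sup>2) \<le> (1 + X) * ((1 + h) * (1 - h))"
    by (simp add: algebra_simps power2_eq_square)
  also have "\<dots> \<le> 2 * (2 * (1 - h))"
    using X h0 h1 by (intro mult_mono) auto
  finally show "(\<Sum>i\<in>?J. (cmod (z $ i - z $ i\<^sub>0 * x i))\<^sup>2) \<le> 4 * (1 - h)" by simp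
  assume small0: "cmod (z $ i\<^sub>0) \<le> 1 / 4"
  have "cmod s \<le> (\<Sum>i\<in>?J. cmod (z $ i) * cmod (x i))"
    unfolding s_def by (rule order_trans[OF norm_sum]) (simp add: norm_mult)
  also have "\<dots> \<le> L2_set (\<lambda>i. cmod (z $ i)) ?J * L2_set (\<lambda>i. cmod (x i)) ?J"
    using L2_set_mult_ineq[of "\<lambda>i. cmod (z $ i)" "\<lambda>i. cmod (x i)" ?J] by simp
  also have "\<dots> \<le> 1 * (1 / 2)"
  proof (intro mult_mono)
    have "(\<Sum>i\<in>?J. (cmod (z $ i))\<^sup>2) \<le> 1"
      using z2 norm_square_split[of z i\<^sub>0] zero_le_power2[of "cmod (z $ i\<^sub>0)"] by linarith
    then show "L2_set (\<lambda>i. cmod (z $ i)) ?J \<le> 1" by (simp add: L2_set_def)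
    have "X \<le> (1 / 2)\<^sup>2" using X by (simp add: power2_eq_square)
    then show "L2_set (\<lambda>i. cmod (x i)) ?J \<le> 1 / 2"
      unfolding L2_set_def X_def[symmetric] by (rule real_le_lsqrt[rotated]) auto
  qed (auto simp: L2_set_nonneg)
  finally have "cmod (z $ i\<^sub>0 + s) \<le> 3 / 4"
    using norm_triangle_ineq[of "z $ i\<^sub>0" s] small0 by linarith
  moreover have "h \<le> cmod (z $ i\<^sub>0 + s)"
    unfolding h_eq using divide_left_mono[of 1 "sqrt (1 + X)" "cmod (z $ i\<^sub>0 + s)"] X by simp
  ultimately show "h \<le> 3 / 4" by linarith
qed

text \<open>In the chart the points form a grid of mesh \<open>1 / m\<close> in \<open>d - 1\<close> complex directions, of side \<open>1 / (4 d)\<close>, and each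
  carries \<open>n = m\<^sup>2\<close> phases. Summing over the phases leaves \<open>T\<^sup>2\<^sup>d\<^sup>-\<^sup>1\<close> with \<open>T\<close> about
  \<open>1 / (1 + n |x - y|\<^sup>2)\<close>, where \<open>y\<close> represents \<open>z\<close> in the chart, and a product of one-dimensional factors
  dominates this power. If \<open>z\<close> is far from the chart then \<open>T = O(1 / n)\<close>, and there are at most \<open>n\<^sup>d\<^sup>-\<^sup>1\<close> grid
  points.\<close>

lemma grid_family:
  "\<exists>G\<ge>0. \<forall>l\<ge>1. \<exists>(I :: (('d::finite \<Rightarrow> nat \<times> nat) \<times> nat) set) (\<zeta> :: _ \<Rightarrow> complex ^ 'd).
    finite I \<and> l ^ (2 * CARD('d)) \<le> card I \<and> (\<forall>i\<in>I. norm (\<zeta> i) = 1) \<and>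
    (\<forall>z. norm z \<le> 1 \<longrightarrow> (\<Sum>i\<in>I. ((1 / real ((4 * CARD('d) * l)\<^sup>2)) /
      cmod (1 - complex_of_real (1 - 1 / real ((4 * CARD('d) * l)\<^sup>2)) * hermitian z (\<zeta> i))) ^ (2 * CARD('d))) \<le> G)"
proof -
  obtain B where B: "1 \<le> B" and lattice: "\<And>(l::nat) x. (\<Sum>p<l. 1 / (1 + (real p - x)\<^sup>2 / 64)) \<le> B"
    using lattice_sum_bound by blast
  define i0 :: 'd where "i0 = undefined"
  define J where "J = UNIV - {i0}"
  define P where "P = card J"
  have d: "CARD('d) = Suc P" by (simp add: P_def J_def card_Diff_singleton card_gt_0_iff)
  have finJ: "finite J" by simp
  define G where "G = 4 * (2 * B) ^ (2 * P)"
  have G0: "0 \<le> G" using B by (simp add: G_def)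
  show ?thesis
  proof (rule exI[of _ G], intro conjI G0 allI impI)
    fix l :: nat assume l: "1 \<le> l"
    define m where "m = 4 * CARD('d) * l"
    define n where "n = m\<^sup>2"
    have m: "0 < m" "l \<le> m" using l by (auto simp: m_def)
    have n: "0 < n" using m by (simp add: n_def)
    have rn: "real n = (real m)\<^sup>2" "1 \<le> real n" using n by (auto simp: n_def)
    define Q where "Q = PiE J (\<lambda>_. {..<l} \<times> {..<l})"
    have finQ: "finite Q" unfolding Q_def by (intro finite_PiE) auto
    have cardQ: "card Q = (l * l) ^ P" by (simp add: Q_def card_PiE P_def)
    define x where "x g i = (of_nat (fst (g i)) + \<i> * of_nat (snd (g i))) / complex_of_real (real m)"
      for g :: "'d \<Rightarrow> nat \<times> nat" and i
    define I where "I = Q \<times> {..<n}"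
    define \<zeta> where "\<zeta> gk = grid_vec i0 (x (fst gk)) (cis (- (2 * pi * real (snd gk) / real n)))"
      for gk :: "('d \<Rightarrow> nat \<times> nat) \<times> nat"
    have small: "(\<Sum>i\<in>J. (cmod (x g i))\<^sup>2) \<le> 1 / 8" if g: "g \<in> Q" for g
    proof -
      have "(cmod (x g i))\<^sup>2 \<le> 1 / (8 * (real CARD('d))\<^sup>2)" if "i \<in> J" for i
      proof -
        have "fst (g i) < l" "snd (g i) < l" using g that by (auto simp: Q_def PiE_iff)
        then have "(real (fst (g i)))\<^sup>2 \<le> (real l)\<^sup>2" "(real (snd (g i)))\<^sup>2 \<le> (real l)\<^sup>2"
          by (auto intro!: power_mono)
        then have "(real (fst (g i)))\<^sup>2 + (real (snd (g i)))\<^sup>2 \<le> 2 * (real l)\<^sup>2" by linarith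
        moreover have "(cmod (x g i))\<^sup>2 = ((real (fst (g i)))\<^sup>2 + (real (snd (g i)))\<^sup>2) / (real m)\<^sup>2"
          unfolding x_def by (simp add: norm_divide power_divide cmod_power2)
        ultimately have "(cmod (x g i))\<^sup>2 \<le> 2 * (real l)\<^sup>2 / (real m)\<^sup>2"
          by (simp add: divide_right_mono)
        also have "\<dots> = 1 / (8 * (real CARD('d))\<^sup>2)"
          using l by (simp add: m_def power_mult_distrib)
        finally show ?thesis .
      qed
      then have "(\<Sum>i\<in>J. (cmod (x g i))\<^sup>2) \<le> (\<Sum>i\<in>J. 1 / (8 * (real CARD('d))\<^sup>2))" by (rule sum_mono)
      also have "\<dots> = real P / (8 * (real CARD('d))\<^sup>2)" by (simp add: P_def)
      also have "\<dots> \<le> (real CARD('d))\<^sup>2 / (8 * (real CARD('d))\<^sup>2)"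
        using self_le_power[of "real CARD('d)" 2] unfolding d by (intro divide_right_mono) auto
      also have "\<dots> = 1 / 8" by simp
      finally show ?thesis .
    qed
    have norm_\<zeta>: "norm (\<zeta> i) = 1" for i unfolding \<zeta>_def by (rule norm_grid_vec) simp
    have "l ^ (2 * CARD('d)) \<le> card I"
    proof -
      have "l ^ (2 * CARD('d)) = (l * l) ^ P * (l * l)"
        unfolding d by (simp add: power_mult power2_eq_square)
      also have "\<dots> \<le> (l * l) ^ P * n"
        using m unfolding n_def power2_eq_square by (intro mult_left_mono mult_mono) auto
      finally show ?thesis by (simp add: I_def card_cartesian_product cardQ)
    qed
    moreover have "(\<Sum>i\<in>I. ((1 / real n) / cmod (1 - complex_of_real (1 - 1 / real n) * hermitian z (\<zeta> i))) ^ (2 * CARD('d))) \<le> G"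
      if z: "norm z \<le> 1" for z :: "complex ^ 'd"
    proof -
      define r where "r = 1 - 1 / real n"
      have r: "0 \<le> r" using rn(2) by (simp add: r_def divide_le_eq)
      define h where "h g = cmod (hermitian z (grid_vec i0 (x g) 1))" for g
      have h: "0 \<le> h g" "h g \<le> 1" for g
        using hermitian_bound[of z "grid_vec i0 (x g) 1"] z norm_grid_vec[of 1 i0 "x g"] by (auto simp: h_def)
      define T where "T g = 1 / (real n * (1 - r * h g))" for g
      have den: "real n * (1 - r * h g) = real n * (1 - h g) + h g" for g
        using n by (simp add: r_def algebra_simps)
      have slack: "1 - h g \<le> real n * (1 - h g)" for g
        using mult_right_mono[of 1 "real n" "1 - h g"] rn h[of g] by simp
      have T: "0 \<le> T g" "T g \<le> 1" "T g \<le> 2 / (1 + real n * (1 - h g))" for g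
      proof -
        have ge: "1 \<le> real n * (1 - h g) + h g" using slack[of g] by linarith
        then show "0 \<le> T g" "T g \<le> 1" unfolding T_def den by (auto simp: divide_le_eq)
        have "(1 + u) / 2 \<le> u + v" if "1 - v \<le> u" "0 \<le> v" for u v :: real using that by simp
        from this[OF slack h(1)]
        have "(1 + real n * (1 - h g)) / 2 \<le> real n * (1 - h g) + h g" .
        moreover have "0 < 1 + real n * (1 - h g)" using h[of g] rn by (intro add_pos_nonneg) auto
        ultimately have "1 / (real n * (1 - h g) + h g) \<le> 1 / ((1 + real n * (1 - h g)) / 2)"
          using ge by (intro divide_left_mono) auto
        then show "T g \<le> 2 / (1 + real n * (1 - h g))" unfolding T_def den by simp
      qed
      have "(\<Sum>i\<in>I. ((1 / real n) / cmod (1 - complex_of_real r * hermitian z (\<zeta> i))) ^ (2 * CARD('d))) =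
          (\<Sum>g\<in>Q. \<Sum>k<n. ((1 / real n) / cmod (1 - complex_of_real r * hermitian z (\<zeta> (g, k)))) ^ (2 * CARD('d)))"
        unfolding I_def by (simp add: sum.cartesian_product split_beta)
      also have "\<dots> \<le> (\<Sum>g\<in>Q. 4 * T g ^ (2 * P + 1))"
      proof (rule sum_mono)
        fix g
        define y where "y = complex_of_real r * hermitian z (grid_vec i0 (x g) 1)"
        have y: "cmod y = r * h g" using r by (simp add: y_def h_def norm_mult)
        have "complex_of_real r * hermitian z (\<zeta> (g, k)) = cis (2 * pi * real k / real n) * y" for k
          unfolding \<zeta>_def y_def hermitian_grid_vec by (simp add: cis_cnj)
        moreover have "cmod y \<le> 1 - 1 / real n"
          unfolding y using mult_left_mono[OF h(2) r, of g] by (simp add: r_def)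
        moreover have "2 * CARD('d) = 2 * P + 2" using d by simp
        ultimately show "(\<Sum>k<n. ((1 / real n) / cmod (1 - complex_of_real r * hermitian z (\<zeta> (g, k)))) ^ (2 * CARD('d)))
            \<le> 4 * T g ^ (2 * P + 1)"
          using sum_over_rotations[OF n, of y "2 * P"] by (simp only: y T_def)
      qed
      also have "\<dots> = 4 * (\<Sum>g\<in>Q. T g ^ (2 * P + 1))" by (simp only: sum_distrib_left)
      also have "\<dots> \<le> 4 * (2 * B) ^ (2 * P)"
      proof (cases "cmod (z $ i0) \<le> 1 / 4")
        case True
        have "T g ^ (2 * P + 1) \<le> (4 / real n) ^ P" if g: "g \<in> Q" for g
        proof -
          have "h g \<le> 3 / 4"
            unfolding h_def using grid_defect(2)[OF z _ small[OF g, unfolded J_def], of 1] True by simp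
          then have "real n * (1 / 4) \<le> real n * (1 - h g) + h g"
            using h(1)[of g] mult_left_mono[of "1 / 4" "1 - h g" "real n"] by linarith
          then have "T g \<le> 1 / (real n * (1 / 4))"
            unfolding T_def den using n by (intro divide_left_mono) (auto intro!: mult_pos_pos simp: add_pos_nonneg)
          then have "T g ^ P \<le> (4 / real n) ^ P" using T(1)[of g] by (intro power_mono) auto
          moreover have "T g ^ (2 * P + 1) \<le> T g ^ P" using T[of g] by (intro power_decreasing) auto
          ultimately show ?thesis by linarith
        qed
        then have "(\<Sum>g\<in>Q. T g ^ (2 * P + 1)) \<le> real (card Q) * (4 / real n) ^ P"
          using sum_bounded_above[of Q "\<lambda>g. T g ^ (2 * P + 1)"] by simp
        also have "\<dots> = ((real l * real l) * (4 / real n)) ^ P"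
          unfolding cardQ by (simp only: of_nat_power of_nat_mult power_mult_distrib)
        also have "\<dots> \<le> ((2 * B)\<^sup>2) ^ P"
        proof (intro power_mono)
          have "real l * real l \<le> real n"
            unfolding rn power2_eq_square using m by (intro mult_mono) auto
          then have "(real l * real l) * (4 / real n) \<le> real n * (4 / real n)"
            by (intro mult_right_mono) auto
          also have "\<dots> = 4" using n by simp
          also have "4 \<le> (2 * B)\<^sup>2" using B power_mono[of 2 "2 * B" 2] by simp
          finally show "(real l * real l) * (4 / real n) \<le> (2 * B)\<^sup>2" .
        qed auto
        finally show ?thesis by (simp only: power_mult[symmetric])
      next
        case False
        define y where "y i = z $ i / z $ i0" for i
        have z0: "z $ i0 \<noteq> 0" using False by auto
        \<comment> \<open>The point of the chart in units of the mesh.\<close>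
        define a where "a i = real m * Re (y i)" for i
        define b where "b i = real m * Im (y i)" for i
        define U where "U g i = (1 / (1 + (real (fst (g i)) - a i)\<^sup>2 / 64)) * (1 / (1 + (real (snd (g i)) - b i)\<^sup>2 / 64))"
          for g :: "'d \<Rightarrow> nat \<times> nat" and i
        have "T g ^ (2 * P + 1) \<le> 2 ^ (2 * P) * (\<Prod>i\<in>J. U g i)" if g: "g \<in> Q" for g
        proof -
          define W where "W = (\<Sum>i\<in>J. (real (fst (g i)) - a i)\<^sup>2 / 64 + (real (snd (g i)) - b i)\<^sup>2 / 64)"
          have "W \<le> real n * (1 - h g)"
          proof -
            have "(real (fst (g i)) - a i)\<^sup>2 / 64 + (real (snd (g i)) - b i)\<^sup>2 / 64 \<le>
                real n / 4 * (cmod (z $ i - z $ i0 * x g i))\<^sup>2" for i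
            proof -
              have "complex_of_real (real m) * (x g i - y i) =
                  (of_nat (fst (g i)) + \<i> * of_nat (snd (g i))) - complex_of_real (real m) * y i"
                using m by (simp add: x_def right_diff_distrib)
              then have "(cmod (complex_of_real (real m) * (x g i - y i)))\<^sup>2 =
                  (real (fst (g i)) - a i)\<^sup>2 + (real (snd (g i)) - b i)\<^sup>2"
                by (simp add: cmod_power2 a_def b_def)
              then have e1: "(real (fst (g i)) - a i)\<^sup>2 + (real (snd (g i)) - b i)\<^sup>2 = real n * (cmod (x g i - y i))\<^sup>2"
                by (simp add: norm_mult power_mult_distrib rn)
              have "z $ i - z $ i0 * x g i = z $ i0 * (y i - x g i)"
                using z0 by (simp add: y_def right_diff_distrib)
              then have e2: "(cmod (z $ i - z $ i0 * x g i))\<^sup>2 = (cmod (z $ i0))\<^sup>2 * (cmod (x g i - y i))\<^sup>2"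
                by (simp add: norm_mult power_mult_distrib norm_minus_commute)
              have "(1 / 4)\<^sup>2 \<le> (cmod (z $ i0))\<^sup>2" using False by (intro power_mono) auto
              then have "real n / 4 * ((1 / 4)\<^sup>2 * (cmod (x g i - y i))\<^sup>2) \<le>
                  real n / 4 * ((cmod (z $ i0))\<^sup>2 * (cmod (x g i - y i))\<^sup>2)"
                by (intro mult_left_mono mult_right_mono) auto
              then show ?thesis unfolding e2 using e1 by (simp add: power2_eq_square[of 4] field_simps)
            qed
            then have "W \<le> real n / 4 * (\<Sum>i\<in>J. (cmod (z $ i - z $ i0 * x g i))\<^sup>2)"
              unfolding W_def sum_distrib_left by (rule sum_mono)
            also have "\<dots> \<le> real n / 4 * (4 * (1 - h g))"
              unfolding h_def J_def
              by (intro mult_left_mono grid_defect(1)[OF z _ small[OF g, unfolded J_def]]) auto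
            also have "\<dots> = real n * (1 - h g)" by (simp add: field_simps)
            finally show ?thesis .
          qed
          moreover have W0: "0 \<le> W" unfolding W_def by (intro sum_nonneg) auto
          ultimately have "2 / (1 + real n * (1 - h g)) \<le> 2 * (1 / (1 + W))"
            by (simp add: frac_le)
          then have TW: "T g \<le> 2 * (1 / (1 + W))" using T(3)[of g] by linarith
          have "T g ^ (2 * P + 1) \<le> T g ^ (2 * P)" using T[of g] by (intro power_decreasing) auto
          also have "\<dots> \<le> (2 * (1 / (1 + W))) ^ (2 * P)" using TW T(1)[of g] by (intro power_mono)
          also have "\<dots> = 2 ^ (2 * P) * (\<Prod>i\<in>J. (1 / (1 + W)) * (1 / (1 + W)))"
            unfolding power_mult_distrib by (simp add: P_def power_mult power2_eq_square)
          also have "\<dots> \<le> 2 ^ (2 * P) * (\<Prod>i\<in>J. U g i)"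
          proof (intro mult_left_mono prod_mono conjI)
            fix i assume i: "i \<in> J"
            have "(real (fst (g i)) - a i)\<^sup>2 / 64 + (real (snd (g i)) - b i)\<^sup>2 / 64 \<le> W"
              unfolding W_def
              by (rule member_le_sum[OF i, of "\<lambda>i. (real (fst (g i)) - a i)\<^sup>2 / 64 + (real (snd (g i)) - b i)\<^sup>2 / 64"]) auto
            then have le: "(real (fst (g i)) - a i)\<^sup>2 / 64 \<le> W" "(real (snd (g i)) - b i)\<^sup>2 / 64 \<le> W"
              using zero_le_power2[of "real (fst (g i)) - a i"] zero_le_power2[of "real (snd (g i)) - b i"] by linarith+
            show "(1 / (1 + W)) * (1 / (1 + W)) \<le> U g i"
              unfolding U_def using le W0 by (intro mult_mono frac_le) (auto simp: add_pos_nonneg)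
            show "0 \<le> (1 / (1 + W)) * (1 / (1 + W))" using W0 by simp
          qed simp
          finally show ?thesis .
        qed
        then have "(\<Sum>g\<in>Q. T g ^ (2 * P + 1)) \<le> (\<Sum>g\<in>Q. 2 ^ (2 * P) * (\<Prod>i\<in>J. U g i))" by (rule sum_mono)
        also have "\<dots> = 2 ^ (2 * P) * (\<Sum>g\<in>Q. \<Prod>i\<in>J. U g i)" by (simp only: sum_distrib_left)
        also have "(\<Sum>g\<in>Q. \<Prod>i\<in>J. U g i) =
            (\<Prod>i\<in>J. \<Sum>pq\<in>{..<l} \<times> {..<l}. (1 / (1 + (real (fst pq) - a i)\<^sup>2 / 64)) * (1 / (1 + (real (snd pq) - b i)\<^sup>2 / 64)))"
          unfolding Q_def U_def
          by (subst prod_sum_PiE[OF finJ]) auto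
        also have "2 ^ (2 * P) * \<dots> \<le> 2 ^ (2 * P) * (\<Prod>i\<in>J. B * B)"
        proof (intro mult_left_mono prod_mono conjI)
          fix i
          have "(\<Sum>pq\<in>{..<l} \<times> {..<l}. (1 / (1 + (real (fst pq) - a i)\<^sup>2 / 64)) * (1 / (1 + (real (snd pq) - b i)\<^sup>2 / 64))) =
              (\<Sum>p<l. 1 / (1 + (real p - a i)\<^sup>2 / 64)) * (\<Sum>q<l. 1 / (1 + (real q - b i)\<^sup>2 / 64))"
            by (simp only: sum_product sum.cartesian_product case_prod_unfold)
          also have "\<dots> \<le> B * B"
            using B by (intro mult_mono lattice sum_nonneg) (auto simp: add_nonneg_nonneg)
          finally show "(\<Sum>pq\<in>{..<l} \<times> {..<l}. (1 / (1 + (real (fst pq) - a i)\<^sup>2 / 64)) * (1 / (1 + (real (snd pq) - b i)\<^sup>2 / 64))) \<le> B * B" .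
        qed (auto intro!: sum_nonneg mult_nonneg_nonneg divide_nonneg_nonneg add_nonneg_nonneg)
        also have "2 ^ (2 * P) * (\<Prod>i\<in>J. B * B) = (2 * B) ^ (2 * P)"
          by (simp add: P_def power_mult_distrib power_mult power2_eq_square)
        finally show ?thesis by simp
      qed
      finally show ?thesis by (simp add: r_def G_def)
    qed
    moreover have "finite I" using finQ by (simp add: I_def)
    ultimately show "\<exists>(I :: (('d \<Rightarrow> nat \<times> nat) \<times> nat) set) (\<zeta> :: _ \<Rightarrow> complex ^ 'd).
      finite I \<and> l ^ (2 * CARD('d)) \<le> card I \<and> (\<forall>i\<in>I. norm (\<zeta> i) = 1) \<and>
      (\<forall>z. norm z \<le> 1 \<longrightarrow> (\<Sum>i\<in>I. ((1 / real ((4 * CARD('d) * l)\<^sup>2)) /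
        cmod (1 - complex_of_real (1 - 1 / real ((4 * CARD('d) * l)\<^sup>2)) * hermitian z (\<zeta> i))) ^ (2 * CARD('d))) \<le> G)"
      unfolding m_def[symmetric] n_def[symmetric] using norm_\<zeta> by (intro exI[of _ I] exI[of _ \<zeta>]) auto
  qed
qed

section \<open>Failure of topological subhomogeneity\<close>

context D_space
begin

lemma one_in_H: "on_ball (\<lambda>z. 1) \<in> H" "nrm (on_ball (\<lambda>z. 1)) = 1"
proof -
  have "ker 0 = on_ball (\<lambda>z. 1)" by (auto simp: on_ball_def D_kernel_def hermitian_def)
  moreover have "(nrm (ker 0))\<^sup>2 = 1" using kernel_self[of 0] by (simp add: D_kernel_def hermitian_def)
  moreover have "ker 0 \<in> H" by (rule kernel_mem) simp
  ultimately show "on_ball (\<lambda>z. 1) \<in> H" "nrm (on_ball (\<lambda>z. 1)) = 1"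
    using nrm_nonneg[of "on_ball (\<lambda>z. 1)"] by (auto simp: power2_eq_1_iff)
qed

lemma mult_in_H:
  assumes "f \<in> mults"
  shows "f \<in> H" "nrm f \<le> mnorm f"
proof -
  have eq: "(\<lambda>x. f x * on_ball (\<lambda>z. 1) x) = f"
    using multiplierD(1)[OF assms] by (auto simp: on_ball_def)
  show "f \<in> H" using multiplierD(2)[OF assms one_in_H(1)] by (simp add: eq)
  show "nrm f \<le> mnorm f" using mult_norm_bound[OF assms one_in_H(1)] by (simp add: eq one_in_H(2))
qed

lemma kernel_norm:
  assumes "norm w < 1"
  shows "(nrm (ker w))\<^sup>2 = (1 - (norm w)\<^sup>2) powr (- a)"
proof -
  have pos: "0 < 1 - (norm w)\<^sup>2" using assms by (simp add: abs_square_less_1)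
  have "1 - hermitian w w = complex_of_real (1 - (norm w)\<^sup>2)" by (simp add: hermitian_self)
  then have "D_kernel a w w = complex_of_real (1 / (1 - (norm w)\<^sup>2) powr a)"
    unfolding D_kernel_def using pos by (simp only: powr_of_real less_imp_le) simp
  then show ?thesis using kernel_self[of w] assms by (simp add: powr_minus_divide)
qed

text \<open>Evaluation at \<open>(1 - t) \<zeta>\<close>, where the function is at least \<open>2\<^sup>-\<^sup>p\<close> and the evaluation functional has squared norm
  at most \<open>t\<^sup>-\<^sup>a\<close>.\<close>

lemma kernel_function_lower_bound:
  assumes \<zeta>: "norm \<zeta> = 1" and t: "0 < t" "t < 1"
    and g: "on_ball (\<lambda>z. (of_real t / (1 - of_real (1 - t) * hermitian z \<zeta>)) ^ p) \<in> H" (is "?g \<in> H")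
  shows "(1 / 4) ^ p * t powr a \<le> (nrm ?g)\<^sup>2"
proof -
  define r where "r = 1 - t"
  have r: "0 < r" "r < 1" using t by (auto simp: r_def)
  define w where "w = r *\<^sub>R \<zeta>"
  have w: "norm w = r" using \<zeta> r by (simp add: w_def)
  define \<rho> where "\<rho> = 1 - r\<^sup>2"
  have \<rho>: "t \<le> \<rho>" "\<rho> \<le> 2 * t" using t unfolding \<rho>_def r_def by (auto simp: power2_eq_square algebra_simps)
  have "hermitian w \<zeta> = complex_of_real r * hermitian \<zeta> \<zeta>"
    unfolding hermitian_def w_def sum_distrib_left
    by (intro sum.cong refl) (simp only: vector_scaleR_component, simp add: scaleR_conv_of_real)
  then have h: "hermitian w \<zeta> = complex_of_real r" using \<zeta> by (simp add: hermitian_self)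
  have "1 - complex_of_real (1 - t) * hermitian w \<zeta> = complex_of_real \<rho>"
    by (simp add: h \<rho>_def r_def power2_eq_square)
  then have gw: "?g w = complex_of_real ((t / \<rho>) ^ p)"
    using w r by (simp add: on_ball_def)
  have "(1 / 2) ^ p \<le> (t / \<rho>) ^ p"
    using t \<rho> by (intro power_mono) (auto simp: divide_simps)
  also have "\<dots> = cmod (?g w)"
    unfolding gw norm_of_real using t \<rho> by simp
  also have "\<dots> \<le> nrm ?g * nrm (ker w)"
    using evaluation_bound[OF g, of w] w r by simp
  finally have "((1 / 2) ^ p)\<^sup>2 \<le> (nrm ?g * nrm (ker w))\<^sup>2" by (intro power_mono) auto
  also have "\<dots> = (nrm ?g)\<^sup>2 * \<rho> powr (- a)"
    unfolding power_mult_distrib using kernel_norm[of w] w r by (simp add: \<rho>_def)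
  also have "\<dots> \<le> (nrm ?g)\<^sup>2 * t powr (- a)"
    using \<rho> t a_pos by (intro mult_left_mono powr_mono2') auto
  finally have "((1 / 2) ^ p)\<^sup>2 * t powr a \<le> (nrm ?g)\<^sup>2 * t powr (- a) * t powr a"
    by (intro mult_right_mono) auto
  also have "\<dots> = (nrm ?g)\<^sup>2" using t by (simp add: mult.assoc flip: powr_add)
  also have "((1 / 2 :: real) ^ p)\<^sup>2 = (1 / 4) ^ p"
    by (simp add: power2_eq_square flip: power_mult_distrib)
  finally show ?thesis .
qed

end

context D_algebra
begin

lemma test_function_lower_bound:
  assumes I: "finite I" and \<zeta>: "\<And>i. i \<in> I \<Longrightarrow> norm (\<zeta> i) = 1" and t: "0 < t" "t < 1"
  obtains e :: "'i \<Rightarrow> complex" where "\<And>i. cmod (e i) \<le> 1"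
    "real (card I) * ((1 / 4) ^ p * t powr a) \<le> (mnorm (test_function I e \<zeta> t (1 - t) p))\<^sup>2"
proof -
  define g where "g i = on_ball (\<lambda>z. (of_real t / (1 - of_real (1 - t) * hermitian z (\<zeta> i))) ^ p)" for i
  have gH: "g i \<in> H" if "i \<in> I" for i
    using mult_in_H(1) sub power_C[OF kernel_function_C[OF \<zeta>[OF that], of "1 - t" t], of p] t
    by (auto simp: g_def)
  obtain e where e: "\<forall>i. e i = 1 \<or> e i = (-1::complex)"
    and le: "(\<Sum>i\<in>I. (nrm (g i))\<^sup>2) \<le> (nrm (\<lambda>x. \<Sum>i\<in>I. e i * g i x))\<^sup>2"
    using exists_signs[OF I, of g] gH by blast
  have eq: "(\<lambda>x. \<Sum>i\<in>I. e i * g i x) = test_function I e \<zeta> t (1 - t) p"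
    by (auto simp: test_function_def g_def on_ball_def)
  have C: "test_function I e \<zeta> t (1 - t) p \<in> \<C>"
    using t by (intro test_function_C \<zeta>) auto
  have "real (card I) * ((1 / 4) ^ p * t powr a) = (\<Sum>i\<in>I. (1 / 4) ^ p * t powr a)" by simp
  also have "\<dots> \<le> (\<Sum>i\<in>I. (nrm (g i))\<^sup>2)"
    unfolding g_def using gH by (intro sum_mono kernel_function_lower_bound \<zeta> t) (auto simp: g_def)
  also have "\<dots> \<le> (nrm (test_function I e \<zeta> t (1 - t) p))\<^sup>2" using le unfolding eq .
  also have "\<dots> \<le> (mnorm (test_function I e \<zeta> t (1 - t) p))\<^sup>2"
    using mult_in_H C sub by (intro power_mono nrm_nonneg) auto
  finally have "real (card I) * ((1 / 4) ^ p * t powr a) \<le> (mnorm (test_function I e \<zeta> t (1 - t) p))\<^sup>2" .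
  moreover have "cmod (e i) \<le> 1" for i using e by (metis norm_minus_cancel norm_one order_refl)
  ultimately show thesis using that by blast
qed

definition alg :: "(complex ^ 'd \<Rightarrow> complex) normed_alg" where
  "alg = (Mult_alg (ball 0 1) H ip)\<lparr>carrier := \<C>\<rparr>"

lemma alg_simps [simp]:
  "carrier alg = \<C>" "alg_norm alg = mnorm" "\<one>\<^bsub>alg\<^esub> = on_ball (\<lambda>z. 1)"
  "f \<otimes>\<^bsub>alg\<^esub> g = (\<lambda>z. f z * g z)" "f \<oplus>\<^bsub>alg\<^esub> g = (\<lambda>z. f z + g z)" "c \<odot>\<^bsub>alg\<^esub> f = (\<lambda>z. c * f z)"
  by (simp_all add: alg_def Mult_alg_def on_ball_def)

text \<open>The norm of a homomorphism is a supremum over the closed unit ball; scaling by \<open>\<parallel>f\<parallel> + e\<close> avoids a case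
  distinction when \<open>\<parallel>f\<parallel> = 0\<close>.\<close>

lemma matrix_hom_rep:
  assumes hom: "\<pi> \<in> matrix_homs alg k" and bound: "hom_norm alg \<pi> \<le> ennreal C"
  shows "D_rep a H ip \<C> \<pi> k (max C 0)"
proof
  have ring: "\<pi> \<in> ring_hom alg (ring_mat TYPE(complex) k ())"
    and smult: "\<And>c f. f \<in> \<C> \<Longrightarrow> \<pi> (\<lambda>z. c * f z) = c \<cdot>\<^sub>m \<pi> f"
    using hom by (auto simp: matrix_homs_def)
  show pc: "\<pi> f \<in> carrier_mat k k" if "f \<in> \<C>" for f
    using ring_hom_closed[OF ring, of f] that by (simp add: ring_mat_simps)
  show "\<pi> (\<lambda>z. f z + g z) = \<pi> f + \<pi> g" if "f \<in> \<C>" "g \<in> \<C>" for f g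
    using ring_hom_add[OF ring, of f g] that by (simp add: ring_mat_simps)
  show "\<pi> (\<lambda>z. f z * g z) = \<pi> f * \<pi> g" if "f \<in> \<C>" "g \<in> \<C>" for f g
    using ring_hom_mult[OF ring, of f g] that by (simp add: ring_mat_simps)
  show "\<pi> (\<lambda>z. c * f z) = c \<cdot>\<^sub>m \<pi> f" if "f \<in> \<C>" for c f by (rule smult[OF that])
  show "\<pi> (on_ball (\<lambda>z. 1)) = 1\<^sub>m k"
    using ring_hom_one[OF ring] by (simp add: ring_mat_simps)
  show "0 \<le> max C 0" by simp
  fix f assume f: "f \<in> \<C>"
  have fm: "f \<in> mults" using f sub by blast
  have m0: "0 \<le> mnorm f" by (rule mult_norm_nonneg[OF fm])
  have bd: "mat_op_norm (\<pi> f) \<le> (mnorm f + e) * max C 0" if e: "0 < e" for e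
  proof -
    define s where "s = mnorm f + e"
    have s: "0 < s" using m0 e by (simp add: s_def)
    define g where "g = (\<lambda>z. complex_of_real (1 / s) * f z)"
    have g: "g \<in> \<C>" unfolding g_def by (rule scale_C[OF f])
    have "mnorm g \<le> cmod (complex_of_real (1 / s)) * mnorm f"
      unfolding g_def by (rule multiplier_scale(2)[OF fm])
    also have "cmod (complex_of_real (1 / s)) = 1 / s" using s by (simp only: norm_of_real) simp
    also have "1 / s * mnorm f \<le> 1" using s e by (simp add: s_def)
    finally have "g \<in> {f \<in> carrier alg. alg_norm alg f \<le> 1}" using g by simp
    then have "ennreal (mat_op_norm (\<pi> g)) \<le> hom_norm alg \<pi>"
      unfolding hom_norm_def by (rule SUP_upper)
    also have "\<dots> \<le> ennreal (max C 0)" using bound by (rule order_trans) (auto intro: ennreal_leI)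
    finally have gC: "mat_op_norm (\<pi> g) \<le> max C 0" by (simp add: ennreal_le_iff)
    show ?thesis
    proof (rule mat_op_norm_least[OF pc[OF f]])
      show "0 \<le> (mnorm f + e) * max C 0" using s by (simp add: s_def)
      fix v :: "complex Matrix.vec" assume v: "v \<in> carrier_vec k"
      have "\<pi> g *\<^sub>v v = complex_of_real (1 / s) \<cdot>\<^sub>v (\<pi> f *\<^sub>v v)"
        unfolding g_def smult[OF f] using pc[OF f] v by (intro eq_vecI) (auto simp: smult_scalar_prod_distrib)
      then have "vec_l2_norm (\<pi> f *\<^sub>v v) = s * vec_l2_norm (\<pi> g *\<^sub>v v)"
        using s by (simp add: vec_l2_norm_smult norm_divide)
      also have "\<dots> \<le> s * (mat_op_norm (\<pi> g) * vec_l2_norm v)"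
        using s by (intro mult_left_mono mat_op_norm_bound[OF pc[OF g] v]) auto
      also have "\<dots> \<le> s * (max C 0 * vec_l2_norm v)"
        using s by (intro mult_left_mono mult_right_mono gC vec_l2_norm_nonneg) auto
      finally show "vec_l2_norm (\<pi> f *\<^sub>v v) \<le> (mnorm f + e) * max C 0 * vec_l2_norm v"
        by (simp add: s_def mult.assoc)
    qed
  qed
  show "mat_op_norm (\<pi> f) \<le> max C 0 * mnorm f"
  proof (rule field_le_epsilon)
    fix \<epsilon> :: real assume \<epsilon>: "0 < \<epsilon>"
    define e where "e = \<epsilon> / (max C 0 + 1)"
    have e: "0 < e" "e * max C 0 \<le> \<epsilon>" using \<epsilon> by (auto simp: e_def field_simps add_nonneg_pos)
    then show "mat_op_norm (\<pi> f) \<le> max C 0 * mnorm f + \<epsilon>"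
      using bd[OF e(1)] by (simp add: algebra_simps)
  qed
qed

text \<open>With \<open>t = 1 / n\<close> and \<open>n\<close> of order \<open>l\<^sup>2\<close>, the representations keep the test function bounded while its norm
  squared is at least a constant times \<open>l\<^sup>2\<^sup>d n\<^sup>-\<^sup>a\<close>, that is, \<open>l\<^sup>2\<^sup>(\<^sup>d\<^sup>-\<^sup>a\<^sup>)\<close>.\<close>

lemma not_subhomogeneous:
  assumes a: "a < real CARD('d)"
  shows "\<not> topologically_subhomogeneous alg"
proof
  assume "topologically_subhomogeneous alg"
  then obtain c C :: real and N :: nat where bound: "\<And>f. f \<in> \<C> \<Longrightarrow>
      ennreal (mnorm f) \<le> ennreal c * (SUP (k, \<pi>) \<in> {(k, \<pi>). 1 \<le> k \<and> k \<le> N \<and> \<pi> \<in> matrix_homs alg k \<and>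
        hom_norm alg \<pi> \<le> ennreal C}. ennreal (mat_op_norm (\<pi> f)))"
    unfolding topologically_subhomogeneous_def by auto
  define d where "d = CARD('d)"
  have d: "0 < d" by (simp add: d_def)
  obtain G where G: "0 \<le> G" and grid: "\<And>l. 1 \<le> l \<Longrightarrow>
    \<exists>(I :: (('d \<Rightarrow> nat \<times> nat) \<times> nat) set) (\<zeta> :: _ \<Rightarrow> complex ^ 'd).
      finite I \<and> l ^ (2 * d) \<le> card I \<and> (\<forall>i\<in>I. norm (\<zeta> i) = 1) \<and>
      (\<forall>z. norm z \<le> 1 \<longrightarrow> (\<Sum>i\<in>I. ((1 / real ((4 * d * l)\<^sup>2)) /
        cmod (1 - complex_of_real (1 - 1 / real ((4 * d * l)\<^sup>2)) * hermitian z (\<zeta> i))) ^ (2 * d)) \<le> G)"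
    using grid_family[where 'd = 'd] unfolding d_def by blast
  define \<Lambda> where "\<Lambda> = max C 0 * sqrt (2 * M)"
  define \<Gamma> where "\<Gamma> = (real N * (1 + \<Lambda>) ^ N * real (N ^ d)) ^ (2 * d) * real (N ^ d) * G"
  have \<Lambda>: "0 \<le> \<Lambda>" using M_ge_1 by (simp add: \<Lambda>_def)
  have \<Gamma>: "0 \<le> \<Gamma>" using G \<Lambda> by (simp add: \<Gamma>_def)
  define B where "B = (max c 0 * \<Gamma>)\<^sup>2"
  define \<kappa> where "\<kappa> = (1 / 4) ^ (2 * d) * (1 / (4 * real d)) powr (2 * a)"
  have upper: "\<kappa> * real l powr (2 * (real d - a)) \<le> B" if l: "1 \<le> l" for l
  proof -
    define n where "n = (4 * d * l)\<^sup>2"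
    define t where "t = 1 / real n"
    have "4 * 1 * 1 \<le> 4 * d * l" using d l by (intro mult_le_mono) auto
    then have "1 < 4 * d * l" by linarith
    then have n: "1 < n" unfolding n_def by (intro one_less_power) auto
    have t: "0 < t" "t < 1" using n by (auto simp: t_def)
    obtain I :: "(('d \<Rightarrow> nat \<times> nat) \<times> nat) set" and \<zeta> :: "_ \<Rightarrow> complex ^ 'd"
      where I: "finite I" "l ^ (2 * d) \<le> card I" and \<zeta>: "\<And>i. i \<in> I \<Longrightarrow> norm (\<zeta> i) = 1"
        and sum: "\<And>z. norm z \<le> 1 \<Longrightarrow>
          (\<Sum>i\<in>I. (t / cmod (1 - complex_of_real (1 - t) * hermitian z (\<zeta> i))) ^ (2 * d)) \<le> G"
      using grid[OF l] unfolding n_def[symmetric] t_def[symmetric] by blast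
    obtain e where e: "\<And>i. cmod (e i) \<le> 1"
      and lower: "real (card I) * ((1 / 4) ^ (2 * d) * t powr a) \<le> (mnorm (test_function I e \<zeta> t (1 - t) (2 * d)))\<^sup>2"
      using test_function_lower_bound[where I = I and \<zeta> = \<zeta> and p = "2 * d", OF I(1) \<zeta> t] by blast
    define f where "f = test_function I e \<zeta> t (1 - t) (2 * d)"
    have f: "f \<in> \<C>" unfolding f_def using t by (intro test_function_C \<zeta>) auto
    have rep: "mat_op_norm (\<pi> f) \<le> \<Gamma>"
      if "k \<le> N" "\<pi> \<in> matrix_homs alg k" "hom_norm alg \<pi> \<le> ennreal C" for k \<pi>
    proof -
      interpret D_rep a H ip \<C> \<pi> k "max C 0" by (rule matrix_hom_rep[OF that(2,3)])
      have L: "\<Lambda> = L" by (simp add: L_def \<Lambda>_def)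
      show ?thesis
        unfolding L f_def \<Gamma>_def d_def
        using test_function_bound[where I = I and \<zeta> = \<zeta> and e = e and r = "1 - t" and t = t and p = "2 * d",
            OF I(1) \<zeta> e _ _ _ _ that(1) _ G] sum t d by (simp add: d_def)
    qed
    have "ennreal (mnorm f) \<le> ennreal c * (SUP (k, \<pi>) \<in> {(k, \<pi>). 1 \<le> k \<and> k \<le> N \<and> \<pi> \<in> matrix_homs alg k \<and>
        hom_norm alg \<pi> \<le> ennreal C}. ennreal (mat_op_norm (\<pi> f)))" by (rule bound[OF f])
    also have "\<dots> \<le> ennreal (max c 0) * ennreal \<Gamma>"
      using rep by (intro mult_mono SUP_least ennreal_leI) (auto intro: ennreal_leI)
    also have "\<dots> = ennreal (max c 0 * \<Gamma>)" using \<Gamma> by (simp add: ennreal_mult)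
    finally have "mnorm f \<le> max c 0 * \<Gamma>" using \<Gamma> by (simp add: ennreal_le_iff)
    then have "(mnorm f)\<^sup>2 \<le> B"
      unfolding B_def using mult_norm_nonneg[of f] f sub by (intro power_mono) auto
    moreover have "\<kappa> * real l powr (2 * (real d - a)) \<le> real (card I) * ((1 / 4) ^ (2 * d) * t powr a)"
    proof -
      have l0: "0 < real l" using l by simp
      have "t = (1 / (4 * real d)) powr 2 * real l powr (- 2)"
        using d l0 by (simp add: t_def n_def powr_minus power_mult_distrib powr_divide divide_simps)
      then have "t powr a = (1 / (4 * real d)) powr (2 * a) * real l powr (- 2 * a)"
        by (simp only: powr_powr powr_mult powr_ge_zero)
      moreover have "real l powr (2 * (real d - a)) = real (l ^ (2 * d)) * real l powr (- 2 * a)"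
        using l0 by (simp add: powr_realpow[symmetric] powr_add[symmetric] algebra_simps)
      ultimately have "\<kappa> * real l powr (2 * (real d - a)) = real (l ^ (2 * d)) * ((1 / 4) ^ (2 * d) * t powr a)"
        by (simp add: \<kappa>_def)
      also have "\<dots> \<le> real (card I) * ((1 / 4) ^ (2 * d) * t powr a)"
        using I(2) by (intro mult_right_mono) (auto simp only: of_nat_le_iff, simp)
      finally show ?thesis .
    qed
    ultimately show ?thesis using lower unfolding f_def by linarith
  qed
  have \<kappa>: "0 < \<kappa>" using d by (simp add: \<kappa>_def)
  define q where "q = 2 * (real d - a)"
  have q: "0 < q" using a by (simp add: q_def d_def)
  obtain l :: nat where l: "max 1 ((\<bar>B / \<kappa>\<bar> + 1) powr (1 / q)) \<le> real l" using real_arch_simple by blast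
  have "\<bar>B / \<kappa>\<bar> + 1 = ((\<bar>B / \<kappa>\<bar> + 1) powr (1 / q)) powr q"
    using q by (simp only: powr_powr) simp
  also have "\<dots> \<le> real l powr q" using l q by (intro powr_mono2) auto
  finally have "B / \<kappa> < real l powr q" by linarith
  then have "B < \<kappa> * real l powr q" using \<kappa> by (simp add: divide_less_eq mult.commute)
  moreover have "1 \<le> l" using l by simp
  ultimately show False using upper[of l] by (simp add: q_def)
qed

end

theorem theorem6p2:
  fixes a :: real
    and H :: "(complex ^ 'd \<Rightarrow> complex) set"
    and ip :: "(complex ^ 'd) ip"
  assumes "0 < a" and "a < real CARD('d)"
    and "rkhs (ball 0 1) (D_kernel a) H ip"
  shows "\<not> topologically_subhomogeneous (A_alg (ball 0 1) H ip) \<and>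
         \<not> topologically_subhomogeneous (Mult_alg (ball 0 1) H ip)"
proof -
  interpret D_space a H ip
    using assms by (simp add: D_space_def D_space_axioms_def)
  interpret A: D_algebra a H ip A_carrier
  proof
    show "A_carrier \<subseteq> mults" by (auto simp: A_carrier_def)
  qed (auto intro: A_carrier_const A_carrier_add A_carrier_mult A_carrier_scale A_carrier_hermitian A_carrier_cauchy)
  interpret Mu: D_algebra a H ip mults
  proof
    show "on_ball (\<lambda>z. hermitian z \<zeta>) \<in> mults" if "norm \<zeta> = 1" for \<zeta> :: "complex ^ 'd"
      using hermitian_power_mults(1)[OF that, of 1] by simp
  qed (auto intro: const_mults(1) multiplier_add(1) multiplier_times(1) multiplier_scale(1) cauchy_mults)
  have "A_alg (ball 0 1) H ip = A.alg"
    unfolding A.alg_def by (simp only: A_alg_def A_carrier_def)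
  moreover have "Mult_alg (ball 0 1) H ip = Mu.alg"
    by (simp add: Mult_alg_def Mu.alg_def)
  ultimately show ?thesis
    using A.not_subhomogeneous Mu.not_subhomogeneous assms(2) by simp
qed

end
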